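(* Let $\alpha\in(0,2)$, $\beta=\alpha+d$, and let the equilibrium $M_\beta$ be in the anomalous diffusion case: $M_\beta$ is an even positive function on $\mathbb{R}^d$ with $\langle M_\beta\rangle=1$, $\langle vM_\beta\rangle=0$, $\langle v\otimes v M_\beta\rangle=\infty$, and heavy tail $M_\beta(v)\sim \frac{m}{|v|^\beta}$ as $|v|\to\infty$, where $m>0$ is a normalization factor. Consider the following scheme, defined for all $k$ and for all time indices $0\le n\le N$, $N\Delta t=T$, by \[ \hat\rho^{n+1}(k)=\frac{\displaystyle\left\langle \frac{\hat f^n}{1+\mathrm{i}\lambda\varepsilon k\cdot v} \right\rangle}{\displaystyle\left\langle \frac{M_\beta}{1+\mathrm{i}\lambda\varepsilon k\cdot v} \right\rangle +\frac{\left( \varepsilon \lambda |k|\right)^\alpha}{1-\lambda}\left\langle \frac{m}{\left( \varepsilon \lambda |k| \right)^{\alpha+d}+|v|^{\alpha+d}} \frac{\left( v\cdot e \right)^2}{ 1+\left( v\cdot e \right)^2} \right\rangle }, \] \[ \hat f^{n+1}=\frac{1}{1+\mathrm{i}\lambda\varepsilon k\cdot v} \left[ (1-\lambda) \hat f^n+\lambda \hat\rho^{n+1}M_\beta\right], \] with $\lambda=\Delta t/(\varepsilon^\alpha+\Delta t)$, where $e\in\mathbb{R}^d$ is any unit vector, and with the initial condition $\hat f^0(k,v)=\hat f_0(k,v)$. This scheme has the following properties: (i) The scheme is of order $1$ for any fixed $\varepsilon$ and preserves the total mass: for all $n\in\{1,\dots,N\}$, $\hat\rho^n(0)=\hat\rho^0(0)$.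 (ii) The scheme is AP (Asymptotic Preserving): for a fixed $\Delta t$, the scheme solves the anomalous diffusion equation when $\varepsilon$ goes to zero, in the form \[ \frac{\hat\rho^{n+1}(k)-\hat\rho^{n}(k)}{\Delta t}=-\kappa |k|^\alpha \hat\rho^{n+1}(k), \qquad \kappa=\int_{\mathbb{R}^d}\frac{(w\cdot e)^2}{1+(w\cdot e)^2}\frac{m}{|w|^\beta}\,\mathrm{d}w . \]
   Context: Brackets denote integration over velocity: $\langle h\rangle=\int_{\mathbb{R}^d}h(v)\,\mathrm{d}v$, with $d\in\{1,2,3\}$. The kinetic equation being approximated, with Knudsen number $\varepsilon>0$, is $\varepsilon^\alpha\partial_t f+\varepsilon v\cdot\nabla_x f=\rho M_\beta-f$ with $\rho(t,x)=\langle f(t,x,v)\rangle$, initial condition $f(0,x,v)=f_0(x,v)$ and periodic boundary conditions in the space variable $x$ in a bounded domain $\Omega\subset\mathbb{R}^d$. Hats denote the Fourier transform in $x$, with Fourier variable $k$; $\hat f_0$ is the Fourier transform of $f_0$ in $x$ and $\hat\rho^0(k)=\langle\hat f_0(k,\cdot)\rangle$. The time discretization is $t_n=n\Delta t$, $n=0,\dots,N$, with $N\Delta t=T$ the final time, and $\hat f^n\simeq\hat f(t_n)$, $\hat\rho^n\simeq\hat\rho(t_n)$. "Order $1$" refers to order in time. The value of $\kappa$ and of the bracket containing $e$ does not depend on the unit vector $e$. A scheme is Asymptotic Preserving (AP) if, for arbitrary initial condition $f_0$, it is consistent with the kinetic equation when $\Delta t\to0$ with $\varepsilon$ fixed, and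 it degenerates into a scheme solving the asymptotic equation when $\varepsilon\to0$ with $\Delta t$ fixed; here the asymptotic equation is the anomalous diffusion equation $\partial_t\hat\rho(t,k)=-\kappa|k|^\alpha\hat\rho(t,k)$.
   Formalization: Order 1 is shown for solutions with integrable second time derivative and, if α<1, under the extra tail rate M_β − m/|v|^β = O(|v|^{-(d+1)}); with the tail equivalence alone it fails: a slower tail correction |v|^{-(β+η)}, α+η<1, gives an error of order Δt^{α+η}. *)

theory Defs
  imports "HOL-Analysis.Analysis" "HOL-Library.Landau_Symbols"
begin

definition bracket :: "(real ^ 'd \<Rightarrow> 'b) \<Rightarrow> 'b::{banach, second_countable_topology}" where
  "bracket h = (\<integral>v. h v \<partial>lborel)"

text \<open>
  The condition on the first moment is understood as a principal value over balls: for
  \<open>\<beta> \<le> 1 + d\<close> the function \<open>v M(v)\<close> is not absolutely integrable. The infinite second moment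
  \<open>\<langle>v \<otimes> v M\<rangle>\<close> is expressed for every diagonal entry of the tensor, in every orthonormal frame.
\<close>
definition anomalous_equilibrium :: "real \<Rightarrow> real \<Rightarrow> (real ^ 'd \<Rightarrow> real) \<Rightarrow> bool" where
  "anomalous_equilibrium \<beta> m M \<longleftrightarrow>
     0 < m \<and>
     (\<forall>v. 0 < M v) \<and>
     (\<forall>v. M (- v) = M v) \<and>
     integrable lborel M \<and>
     bracket M = 1 \<and>
     ((\<lambda>R. \<integral>v\<in>cball 0 R. M v *\<^sub>R v \<partial>lborel) \<longlongrightarrow> 0) at_top \<and>
     (\<forall>u. norm u = 1 \<longrightarrow> (\<integral>\<^sup>+v. ennreal ((v \<bullet> u)\<^sup>2 * M v) \<partial>lborel) = \<infinity>) \<and>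
     M \<sim>[at_infinity] (\<lambda>v. m / norm v powr \<beta>)"

text \<open>
  The scheme replaces \<open>M\<close> by \<open>m / (1 + |v|\<^sup>\<beta>)\<close> in
  \<open>1 - \<langle>M / (1 + i s v \<bullet> e)\<rangle> = \<langle>M (s v \<bullet> e)\<^sup>2 / (1 + (s v \<bullet> e)\<^sup>2)\<rangle>\<close>, where \<open>s = \<epsilon> \<lambda> |k|\<close> is of order
  \<open>\<Delta>t\<close>. The tail equivalence alone makes the resulting defect \<open>o(s\<^sup>\<alpha>)\<close>, which is \<open>o(s)\<close> when
  \<open>\<alpha> \<ge> 1\<close>. For \<open>\<alpha> < 1\<close> it need not be \<open>O(s)\<close>: a correction to the tail of size
  \<open>|v| powr - (\<beta> + \<eta>)\<close> with \<open>\<alpha> + \<eta> < 1\<close> and \<open>k \<noteq> 0\<close> generically produces a time error of exact order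
  \<open>\<Delta>t powr (\<alpha> + \<eta>)\<close>. Hence the rate required below in the case \<open>\<alpha> < 1\<close>.
\<close>
definition tail_rate :: "real \<Rightarrow> real \<Rightarrow> real \<Rightarrow> (real ^ 'd \<Rightarrow> real) \<Rightarrow> bool" where
  "tail_rate \<alpha> \<beta> m M \<longleftrightarrow>
     (\<alpha> < 1 \<longrightarrow>
       (\<lambda>v. M v - m / norm v powr \<beta>) \<in> O[at_infinity](\<lambda>v. norm v powr - (real CARD('d) + 1)))"

definition diffusion_coeff :: "real \<Rightarrow> real \<Rightarrow> real ^ 'd \<Rightarrow> real" where
  "diffusion_coeff \<beta> m e =
     bracket (\<lambda>w. (w \<bullet> e)\<^sup>2 / (1 + (w \<bullet> e)\<^sup>2) * (m / norm w powr \<beta>))"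

definition box_periodic :: "real ^ 'd \<Rightarrow> real ^ 'd \<Rightarrow> (real ^ 'd \<Rightarrow> 'b) \<Rightarrow> bool" where
  "box_periodic a b g \<longleftrightarrow> (\<forall>x i. g (x + axis i (b $ i - a $ i)) = g x)"

definition frequencies :: "real ^ 'd \<Rightarrow> real ^ 'd \<Rightarrow> (real ^ 'd) set" where
  "frequencies a b = {k. \<forall>i. \<exists>z::int. k $ i * (b $ i - a $ i) = 2 * pi * of_int z}"

definition fourier :: "real ^ 'd \<Rightarrow> real ^ 'd \<Rightarrow> (real ^ 'd \<Rightarrow> real) \<Rightarrow> real ^ 'd \<Rightarrow> complex" where
  "fourier a b g k = (\<integral>x\<in>cbox a b. complex_of_real (g x) * cis (- (k \<bullet> x)) \<partial>lborel)"

text \<open>Arguments of \<open>f\<close> are \<open>t\<close>, \<open>x\<close>, \<open>v\<close>, in this order.\<close>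
definition kinetic_solution ::
  "real \<Rightarrow> (real ^ 'd \<Rightarrow> real) \<Rightarrow> real \<Rightarrow> real \<Rightarrow> real ^ 'd \<Rightarrow> real ^ 'd \<Rightarrow>
   (real ^ 'd \<Rightarrow> real ^ 'd \<Rightarrow> real) \<Rightarrow> (real \<Rightarrow> real ^ 'd \<Rightarrow> real ^ 'd \<Rightarrow> real) \<Rightarrow> bool" where
  "kinetic_solution \<alpha> M \<epsilon> T a b f0 f \<longleftrightarrow>
     (\<forall>x v. f 0 x v = f0 x v) \<and>
     (\<forall>t\<in>{0..T}. \<forall>v. box_periodic a b (\<lambda>x. f t x v)) \<and>
     (\<forall>t\<in>{0..T}. set_integrable lborel (cbox a b \<times> UNIV) (\<lambda>(x, v). f t x v)) \<and>
     (\<forall>t\<in>{0..T}. \<forall>x. integrable lborel (f t x)) \<and>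
     (\<exists>ft fx.
        (\<forall>v. continuous_on ({0..T} \<times> UNIV) (\<lambda>(t, x). ft t x v)) \<and>
        (\<forall>v. continuous_on ({0..T} \<times> UNIV) (\<lambda>(t, x). fx t x v)) \<and>
        (\<forall>t\<in>{0..T}. \<forall>x v.
           ((\<lambda>s. f s x v) has_real_derivative ft t x v) (at t within {0..T}) \<and>
           GDERIV (\<lambda>y. f t y v) x :> fx t x v \<and>
           \<epsilon> powr \<alpha> * ft t x v + \<epsilon> * (v \<bullet> fx t x v) = bracket (f t x) * M v - f t x v))"

text \<open>
  Regularity in time under which the order of the scheme is measured: two time derivatives, the
  second one integrable over \<open>[0, T] \<times> \<Omega> \<times> \<real>\<^sup>d\<close>.
\<close>
definition time_regular ::
  "real \<Rightarrow> real ^ 'd \<Rightarrow> real ^ 'd \<Rightarrow> (real \<Rightarrow> real ^ 'd \<Rightarrow> real ^ 'd \<Rightarrow> real) \<Rightarrow> bool" where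
  "time_regular T a b f \<longleftrightarrow>
     (\<exists>ft ftt.
        (\<forall>t\<in>{0..T}. \<forall>x v.
           ((\<lambda>s. f s x v) has_real_derivative ft t x v) (at t within {0..T}) \<and>
           ((\<lambda>s. ft s x v) has_real_derivative ftt t x v) (at t within {0..T})) \<and>
        (\<forall>x v. continuous_on {0..T} (\<lambda>t. ftt t x v)) \<and>
        set_integrable lborel ({0..T} \<times> cbox a b \<times> UNIV) (\<lambda>(t, x, v). ftt t x v))"

definition relax :: "real \<Rightarrow> real \<Rightarrow> real \<Rightarrow> real" where
  "relax \<alpha> \<epsilon> \<Delta>t = \<Delta>t / (\<epsilon> powr \<alpha> + \<Delta>t)"

definition transport :: "real \<Rightarrow> real \<Rightarrow> real \<Rightarrow> real ^ 'd \<Rightarrow> real ^ 'd \<Rightarrow> complex" where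
  "transport \<alpha> \<epsilon> \<Delta>t k v = 1 + \<i> * complex_of_real (relax \<alpha> \<epsilon> \<Delta>t * \<epsilon> * (k \<bullet> v))"

definition tail_bracket :: "real \<Rightarrow> real \<Rightarrow> real ^ 'd \<Rightarrow> real \<Rightarrow> real" where
  "tail_bracket \<alpha> m e s =
     bracket (\<lambda>v. m / (s powr (\<alpha> + real CARD('d)) + norm v powr (\<alpha> + real CARD('d))) *
                  ((v \<bullet> e)\<^sup>2 / (1 + (v \<bullet> e)\<^sup>2)))"

text \<open>One step in the mode \<open>k\<close>: the argument \<open>g\<close> is the profile \<open>v \<mapsto> f\<^sup>n(k, v)\<close>.\<close>
definition rho_step ::
  "real \<Rightarrow> real \<Rightarrow> (real ^ 'd \<Rightarrow> real) \<Rightarrow> real ^ 'd \<Rightarrow> real \<Rightarrow> real \<Rightarrow> real ^ 'd \<Rightarrow>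
   (real ^ 'd \<Rightarrow> complex) \<Rightarrow> complex" where
  "rho_step \<alpha> m M e \<epsilon> \<Delta>t k g =
     (let l = relax \<alpha> \<epsilon> \<Delta>t; s = \<epsilon> * l * norm k in
       bracket (\<lambda>v. g v / transport \<alpha> \<epsilon> \<Delta>t k v) /
       (bracket (\<lambda>v. complex_of_real (M v) / transport \<alpha> \<epsilon> \<Delta>t k v) +
        complex_of_real (s powr \<alpha> / (1 - l) * tail_bracket \<alpha> m e s)))"

definition f_step ::
  "real \<Rightarrow> real \<Rightarrow> (real ^ 'd \<Rightarrow> real) \<Rightarrow> real ^ 'd \<Rightarrow> real \<Rightarrow> real \<Rightarrow> real ^ 'd \<Rightarrow>
   (real ^ 'd \<Rightarrow> complex) \<Rightarrow> real ^ 'd \<Rightarrow> complex" where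
  "f_step \<alpha> m M e \<epsilon> \<Delta>t k g v =
     (let l = relax \<alpha> \<epsilon> \<Delta>t in
       1 / transport \<alpha> \<epsilon> \<Delta>t k v *
       (complex_of_real (1 - l) * g v +
        complex_of_real l * rho_step \<alpha> m M e \<epsilon> \<Delta>t k g * complex_of_real (M v)))"

primrec scheme_f ::
  "real \<Rightarrow> real \<Rightarrow> (real ^ 'd \<Rightarrow> real) \<Rightarrow> real ^ 'd \<Rightarrow> real \<Rightarrow> real \<Rightarrow>
   (real ^ 'd \<Rightarrow> real ^ 'd \<Rightarrow> complex) \<Rightarrow> nat \<Rightarrow> real ^ 'd \<Rightarrow> real ^ 'd \<Rightarrow> complex" where
  "scheme_f \<alpha> m M e \<epsilon> \<Delta>t g0 0 k = g0 k"
| "scheme_f \<alpha> m M e \<epsilon> \<Delta>t g0 (Suc n) k =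
     f_step \<alpha> m M e \<epsilon> \<Delta>t k (scheme_f \<alpha> m M e \<epsilon> \<Delta>t g0 n k)"

fun scheme_rho ::
  "real \<Rightarrow> real \<Rightarrow> (real ^ 'd \<Rightarrow> real) \<Rightarrow> real ^ 'd \<Rightarrow> real \<Rightarrow> real \<Rightarrow>
   (real ^ 'd \<Rightarrow> real ^ 'd \<Rightarrow> complex) \<Rightarrow> nat \<Rightarrow> real ^ 'd \<Rightarrow> complex" where
  "scheme_rho \<alpha> m M e \<epsilon> \<Delta>t g0 0 k = bracket (g0 k)"
| "scheme_rho \<alpha> m M e \<epsilon> \<Delta>t g0 (Suc n) k =
     rho_step \<alpha> m M e \<epsilon> \<Delta>t k (scheme_f \<alpha> m M e \<epsilon> \<Delta>t g0 n k)"

text \<open>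
  All notions compare the scheme, in a fixed mode \<open>k\<close>, with the Fourier transforms \<open>F t v\<close> and
  \<open>r t\<close> of an exact solution and of its density. Order is the order of the global error: uniform
  in the time index, and measured in \<open>L\<^sup>1\<close> in velocity for \<open>f\<close>.
\<close>
definition first_order ::
  "real \<Rightarrow> (real \<Rightarrow> nat \<Rightarrow> complex) \<Rightarrow> (real \<Rightarrow> nat \<Rightarrow> real ^ 'd \<Rightarrow> complex) \<Rightarrow>
   (real \<Rightarrow> complex) \<Rightarrow> (real \<Rightarrow> real ^ 'd \<Rightarrow> complex) \<Rightarrow> bool" where
  "first_order T \<rho>n fn r F \<longleftrightarrow>
     (\<exists>C. \<forall>N\<ge>1. \<forall>n\<le>N. let \<Delta>t = T / real N; t = real n * \<Delta>t in
        norm (\<rho>n \<Delta>t n - r t) \<le> C * \<Delta>t \<and>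
        integrable lborel (\<lambda>v. fn \<Delta>t n v - F t v) \<and>
        bracket (\<lambda>v. norm (fn \<Delta>t n v - F t v)) \<le> C * \<Delta>t)"

definition convergent_scheme ::
  "real \<Rightarrow> (real \<Rightarrow> nat \<Rightarrow> complex) \<Rightarrow> (real \<Rightarrow> nat \<Rightarrow> real ^ 'd \<Rightarrow> complex) \<Rightarrow>
   (real \<Rightarrow> complex) \<Rightarrow> (real \<Rightarrow> real ^ 'd \<Rightarrow> complex) \<Rightarrow> bool" where
  "convergent_scheme T \<rho>n fn r F \<longleftrightarrow>
     (\<forall>\<eta>>0. \<exists>N0\<ge>1. \<forall>N\<ge>N0. \<forall>n\<le>N. let \<Delta>t = T / real N; t = real n * \<Delta>t in
        norm (\<rho>n \<Delta>t n - r t) < \<eta> \<and>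
        integrable lborel (\<lambda>v. fn \<Delta>t n v - F t v) \<and>
        bracket (\<lambda>v. norm (fn \<Delta>t n v - F t v)) < \<eta>)"

text \<open>
  Vanishing truncation errors: \<open>\<rho>s h g\<close> and \<open>fs h g\<close> are the results of one step of length \<open>h\<close>
  from the profile \<open>g\<close>.
\<close>
definition consistent_step ::
  "real \<Rightarrow> (real \<Rightarrow> (real ^ 'd \<Rightarrow> complex) \<Rightarrow> complex) \<Rightarrow>
   (real \<Rightarrow> (real ^ 'd \<Rightarrow> complex) \<Rightarrow> real ^ 'd \<Rightarrow> complex) \<Rightarrow>
   (real \<Rightarrow> complex) \<Rightarrow> (real \<Rightarrow> real ^ 'd \<Rightarrow> complex) \<Rightarrow> bool" where
  "consistent_step T \<rho>s fs r F \<longleftrightarrow>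
     (\<forall>t\<in>{0..<T}.
        ((\<lambda>h. \<rho>s h (F t) - r (t + h)) \<longlongrightarrow> 0) (at_right 0) \<and>
        (\<forall>v. ((\<lambda>h. (fs h (F t) v - F (t + h) v) / complex_of_real h) \<longlongrightarrow> 0) (at_right 0)))"

definition diffusion_solution :: "real \<Rightarrow> real \<Rightarrow> complex \<Rightarrow> (real \<Rightarrow> complex) \<Rightarrow> bool" where
  "diffusion_solution T c r0 r \<longleftrightarrow>
     r 0 = r0 \<and>
     (\<forall>t\<in>{0..T}. (r has_vector_derivative - (c *\<^sub>R r t)) (at t within {0..T}))"

end

theory Submission
  imports Defs
begin

text \<open>
  Everything takes place in one Fourier mode \<open>k\<close>. There the kinetic equation is, for every velocity
  \<open>v\<close>, the scalar relaxation equation \<open>c F' = r M - (1 + i y) F\<close> with \<open>c = \<epsilon> powr \<alpha>\<close> and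
  \<open>y = \<epsilon> (k \<bullet> v)\<close>; the velocities are coupled only through the density \<open>r = \<langle>F\<rangle>\<close>. The update of
  \<open>f\<close> is the implicit Euler step for this equation, and for the exact implicit Euler density the
  coefficient of \<open>1 / (1 - \<lambda>)\<close> in the denominator of the density update would be
  \<open>1 - \<langle>M / (1 + i \<lambda> y)\<rangle>\<close>. The scheme puts \<open>s powr \<alpha>\<close> times the tail bracket in its place, where
  \<open>s = \<epsilon> \<lambda> |k|\<close>. The difference \<open>\<delta>\<close> of these two numbers is the only error beyond that of implicit
  Euler.

  Convergence at fixed \<open>\<epsilon>\<close>. Let \<open>G\<close> be implicit Euler driven by the exact density \<open>r\<close>. At each
  velocity \<open>G\<close> is a contraction driven by truncation errors, so \<open>|G - F|\<close> is at most their sum. The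
  distance between the scheme and \<open>G\<close> obeys a discrete Gronwall inequality with source
  \<open>\<lambda> (H + |\<delta>|)\<close>, where \<open>H\<close> bounds the \<open>L\<^sup>1\<close> norm of \<open>G - F\<close>; stability comes from a lower bound for
  \<open>Re \<langle>M / (1 + i \<lambda> y)\<rangle>\<close> that is uniform in the step. This is \<open>scheme_error\<close>: the error is
  \<open>O(H + |\<delta>|)\<close>. Without regularity in time, \<open>H \<rightarrow> 0\<close> by dominated convergence in the velocity,
  because \<open>|F|\<close> and \<open>|G|\<close> stay below \<open>|F 0| + K M\<close> for a bound \<open>K\<close> of \<open>|r|\<close>, and \<open>\<delta> \<rightarrow> 0\<close> as well: the scheme converges.
  With an integrable second time derivative \<open>H = O(\<Delta>t)\<close>, and under the tail rate \<open>\<delta> = O(s)\<close>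
  (\<open>even_defect_linear\<close>): by rotation invariance \<open>\<delta>\<close> is the integral of
  \<open>M - m / (1 + |v| powr \<beta>)\<close>, a function of size \<open>|v| powr - (d + 1)\<close> at infinity, against
  \<open>x\<^sup>2 / (1 + x\<^sup>2)\<close> at \<open>x = s (v \<bullet> k) / |k|\<close>, and this scales like \<open>s\<close>.

  Passing from the solution to its modes needs Fubini for the densities, differentiation under the
  integral sign, and integration by parts over a period (\<open>kinetic_fourier_balance\<close>).

  Vanishing \<open>\<epsilon>\<close>. Now \<open>\<lambda> \<rightarrow> 1\<close>, the memory term \<open>(1 - \<lambda>) f\<^sup>n\<close> disappears, and
  \<open>s powr \<alpha> / (1 - \<lambda>) \<rightarrow> \<Delta>t |k| powr \<alpha>\<close> while the tail bracket tends to \<open>\<kappa>\<close>. So the density step becomes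
  division by \<open>1 + \<Delta>t \<kappa> |k| powr \<alpha>\<close>, which is implicit Euler for the diffusion equation
  (\<open>scheme_diffusion_limit\<close>). In the mode \<open>0\<close> transport and tail term vanish, and mass is conserved
  (\<open>scheme_mass_conservation\<close>).
\<close>

section \<open>Invariance of Lebesgue measure\<close>

lemma emeasure_lborel_translate:
  fixes A :: "'a::euclidean_space set"
  assumes "A \<in> sets borel"
  shows "emeasure lborel ((\<lambda>y. x + y) -` A) = emeasure lborel A"
  using assms emeasure_distr[of "(+) x" lborel borel A] by (simp add: lborel_distr_plus)

lemma orthogonal_transformation_measurable:
  fixes f :: "'a::euclidean_space \<Rightarrow> 'a"
  assumes "orthogonal_transformation f"
  shows "f \<in> borel_measurable borel"
  using orthogonal_transformation_linear[OF assms] linear_continuous_on[of f UNIV]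
  by (auto intro!: borel_measurable_continuous_onI simp: linear_conv_bounded_linear)

text \<open>
  For a translation invariant measure \<open>\<nu>\<close> Tonelli's theorem gives \<open>\<nu>(A) |B| = \<nu>(- B) |A|\<close>: integrate
  \<open>1\<^sub>A(x) 1\<^sub>B(y - x)\<close> in both orders. The image of Lebesgue measure under \<open>f\<close> is translation invariant
  because \<open>f\<close> is linear and onto, and it agrees with Lebesgue measure on the unit ball \<open>B\<close>.
\<close>
lemma lborel_distr_orthogonal:
  fixes f :: "'a::euclidean_space \<Rightarrow> 'a"
  assumes f: "orthogonal_transformation f"
  shows "distr lborel borel f = lborel"
proof (rule measure_eqI)
  let ?\<nu> = "distr lborel borel f"
  have fm [measurable]: "f \<in> borel_measurable borel"
    by (rule orthogonal_transformation_measurable[OF f])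
  have fl: "linear f" using f by (rule orthogonal_transformation_linear)
  have fs: "surj f" using f by (rule orthogonal_transformation_surj)
  show "sets ?\<nu> = sets lborel" by simp
  fix A assume "A \<in> sets ?\<nu>"
  then have A [measurable]: "A \<in> sets borel" by simp
  let ?B = "ball (0::'a) 1"
  have [measurable]: "?B \<in> sets borel" by simp
  have invariant: "emeasure lborel {x. f x + y \<in> C} = emeasure lborel {x. f x \<in> C}"
    if C [measurable]: "C \<in> sets borel" for C y
  proof -
    obtain z where z: "f z = y" using fs by (metis surjD)
    have "{x. f x + y \<in> C} = (\<lambda>x. z + x) -` {x. f x \<in> C}"
      using z fl by (auto simp: linear_add add.commute)
    moreover have "{x. f x \<in> C} \<in> sets borel" by measurable
    ultimately show ?thesis
      using emeasure_lborel_translate[of "{x. f x \<in> C}" z] by metis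
  qed
  \<comment> \<open>The double integral of the indicator of \<open>f x \<in> A\<close> times that of \<open>y - f x \<in> B\<close>, computed in both
    orders. As \<open>B\<close> is symmetric and \<open>f\<close> preserves norms, no reflection of \<open>B\<close> appears at the end.\<close>
  have "emeasure lborel {x. f x \<in> A} * emeasure lborel ?B =
        (\<integral>\<^sup>+x. indicator {x. f x \<in> A} x * emeasure lborel ?B \<partial>lborel)"
    by (subst nn_integral_multc) (auto simp: nn_integral_indicator)
  also have "\<dots> = (\<integral>\<^sup>+x. (\<integral>\<^sup>+y. indicator A (f x) * indicator ?B (y - f x) \<partial>lborel) \<partial>lborel)"
  proof (rule nn_integral_cong)
    fix x :: 'a
    have m: "(\<lambda>y. - f x + y) -` ?B \<in> sets borel"
      using measurable_sets[of "\<lambda>y. - f x + y" borel borel ?B] by simp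
    have "(\<integral>\<^sup>+y. indicator A (f x) * indicator ?B (y - f x) \<partial>lborel) =
          indicator A (f x) * (\<integral>\<^sup>+y. indicator ((\<lambda>y. - f x + y) -` ?B) y \<partial>lborel)"
    proof -
      have "indicator ((\<lambda>y. - f x + y) -` ?B) \<in> borel_measurable lborel"
        using m by (intro borel_measurable_indicator) simp
      then have "indicator A (f x) * (\<integral>\<^sup>+y. indicator ((\<lambda>y. - f x + y) -` ?B) y \<partial>lborel) =
          (\<integral>\<^sup>+y. indicator A (f x) * indicator ((\<lambda>y. - f x + y) -` ?B) y \<partial>lborel)"
        by (rule nn_integral_cmult[symmetric])
      also have "\<dots> = (\<integral>\<^sup>+y. indicator A (f x) * indicator ?B (y - f x) \<partial>lborel)"
        by (intro nn_integral_cong) (simp add: indicator_def)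
      finally show ?thesis by simp
    qed
    also have "(\<integral>\<^sup>+y. indicator ((\<lambda>y. - f x + y) -` ?B) y \<partial>lborel) = emeasure lborel ?B"
      using m emeasure_lborel_translate[of ?B "- f x"] by (simp only: nn_integral_indicator sets_lborel borel_open open_ball)
    finally show "indicator {x. f x \<in> A} x * emeasure lborel ?B =
        (\<integral>\<^sup>+y. indicator A (f x) * indicator ?B (y - f x) \<partial>lborel)"
      by (simp add: indicator_def)
  qed
  also have "\<dots> = (\<integral>\<^sup>+y. (\<integral>\<^sup>+x. indicator A (f x) * indicator ?B (y - f x) \<partial>lborel) \<partial>lborel)"
    by (rule lborel_pair.Fubini') measurable
  also have "\<dots> = (\<integral>\<^sup>+y. (\<integral>\<^sup>+x. indicator A (f x + y) * indicator ?B (f x) \<partial>lborel) \<partial>lborel)"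
  proof (rule nn_integral_cong)
    fix y :: 'a
    have *: "{x. x \<in> A \<and> y - x \<in> ?B} \<in> sets borel" by measurable
    have "(\<integral>\<^sup>+x. indicator A (f x) * indicator ?B (y - f x) \<partial>lborel)
        = (\<integral>\<^sup>+x. indicator {x. f x \<in> {x. x \<in> A \<and> y - x \<in> ?B}} x \<partial>lborel)"
      by (auto intro!: nn_integral_cong simp: indicator_def)
    also have "\<dots> = emeasure lborel {x. f x \<in> {x. x \<in> A \<and> y - x \<in> ?B}}"
      by (rule nn_integral_indicator) measurable
    also have "\<dots> = emeasure lborel {x. f x + y \<in> {x. x \<in> A \<and> y - x \<in> ?B}}"
      by (rule invariant[OF *, symmetric])
    also have "\<dots> = (\<integral>\<^sup>+x. indicator {x. f x + y \<in> {x. x \<in> A \<and> y - x \<in> ?B}} x \<partial>lborel)"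
      by (rule nn_integral_indicator[symmetric]) measurable
    also have "\<dots> = (\<integral>\<^sup>+x. indicator A (f x + y) * indicator ?B (f x) \<partial>lborel)"
      by (auto intro!: nn_integral_cong simp: indicator_def)
    finally show "(\<integral>\<^sup>+x. indicator A (f x) * indicator ?B (y - f x) \<partial>lborel) =
       (\<integral>\<^sup>+x. indicator A (f x + y) * indicator ?B (f x) \<partial>lborel)" .
  qed
  also have "\<dots> = (\<integral>\<^sup>+x. (\<integral>\<^sup>+y. indicator A (f x + y) * indicator ?B (f x) \<partial>lborel) \<partial>lborel)"
    by (rule lborel_pair.Fubini') measurable
  also have "\<dots> = (\<integral>\<^sup>+x. emeasure lborel A * indicator ?B x \<partial>lborel)"
  proof (rule nn_integral_cong)
    fix x :: 'a
    have n: "norm (f x) = norm x" using f by (simp add: orthogonal_transformation_norm)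
    have m: "(\<lambda>y. f x + y) -` A \<in> sets borel"
      using measurable_sets[of "\<lambda>y. f x + y" borel borel A] by simp
    have "(\<integral>\<^sup>+y. indicator A (f x + y) * indicator ?B (f x) \<partial>lborel) =
          (\<integral>\<^sup>+y. indicator ((\<lambda>y. f x + y) -` A) y \<partial>lborel) * indicator ?B (f x)"
      using m by (subst nn_integral_multc[symmetric]) (auto intro!: nn_integral_cong simp: indicator_def)
    also have "\<dots> = emeasure lborel ((\<lambda>y. f x + y) -` A) * indicator ?B (f x)"
      using m by (simp only: nn_integral_indicator sets_lborel)
    also have "\<dots> = emeasure lborel A * indicator ?B x"
      by (simp only: emeasure_lborel_translate[OF A]) (simp add: indicator_def n)
    finally show "(\<integral>\<^sup>+y. indicator A (f x + y) * indicator ?B (f x) \<partial>lborel) =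
      emeasure lborel A * indicator ?B x" .
  qed
  also have "\<dots> = emeasure lborel A * emeasure lborel ?B"
    by (subst nn_integral_cmult) (auto simp: nn_integral_indicator)
  finally have "emeasure lborel ?B * emeasure lborel {x. f x \<in> A} = emeasure lborel ?B * emeasure lborel A"
    by (simp add: mult.commute)
  moreover have "emeasure lborel ?B \<noteq> 0" "emeasure lborel ?B \<noteq> \<infinity>"
    using emeasure_bounded_finite[of ?B] unit_ball_vol_pos[OF of_nat_0_le_iff, of "DIM('a)"]
    by (auto simp: emeasure_ball simp del: unit_ball_vol_pos)
  ultimately have "emeasure lborel {x. f x \<in> A} = emeasure lborel A"
    by (simp add: ennreal_mult_cancel_left)
  then show "emeasure ?\<nu> A = emeasure lborel A"
    by (simp add: emeasure_distr vimage_def)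
qed

lemma integral_orthogonal_transformation:
  fixes f :: "'a::euclidean_space \<Rightarrow> 'a" and g :: "'a \<Rightarrow> 'b::{banach, second_countable_topology}"
  assumes f: "orthogonal_transformation f" and g: "g \<in> borel_measurable borel"
  shows "(\<integral>x. g (f x) \<partial>lborel) = (\<integral>x. g x \<partial>lborel)"
proof -
  have "(\<integral>x. g x \<partial>lborel) = (\<integral>x. g x \<partial>distr lborel borel f)"
    by (simp add: lborel_distr_orthogonal[OF f])
  also have "\<dots> = (\<integral>x. g (f x) \<partial>lborel)"
    using orthogonal_transformation_measurable[OF f] g by (intro integral_distr) auto
  finally show ?thesis by simp
qed

lemma integral_odd_eq_0:
  fixes g :: "'a::euclidean_space \<Rightarrow> real"
  assumes "g \<in> borel_measurable borel" and "\<And>x. g (- x) = - g x"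
  shows "(\<integral>x. g x \<partial>lborel) = 0"
proof -
  have "orthogonal_transformation (uminus :: 'a \<Rightarrow> 'a)"
    by (simp add: orthogonal_transformation_def linear_uminus)
  then have "(\<integral>x. g (- x) \<partial>lborel) = (\<integral>x. g x \<partial>lborel)"
    by (rule integral_orthogonal_transformation) fact
  then show ?thesis by (simp add: assms(2))
qed

text \<open>
  Any two vectors of equal norm are exchanged by some orthogonal transformation.
\<close>
lemma integral_radial_direction:
  fixes e e' :: "real ^ 'd" and g :: "real \<Rightarrow> real \<Rightarrow> 'b::{banach, second_countable_topology}"
  assumes "norm e = norm e'" and m: "(\<lambda>v. g (norm v) (v \<bullet> e)) \<in> borel_measurable borel"
  shows "(\<integral>v. g (norm v) (v \<bullet> e') \<partial>lborel) = (\<integral>v. g (norm v) (v \<bullet> e) \<partial>lborel)"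
proof -
  obtain f where f: "orthogonal_transformation f" "f e' = e"
    using orthogonal_transformation_exists[of e' e] assms(1) by metis
  have "norm (f v) = norm v" "f v \<bullet> e = v \<bullet> e'" for v
    using f by (auto simp: orthogonal_transformation_norm orthogonal_transformation_def)
  then show ?thesis
    using integral_orthogonal_transformation[OF f(1) m] by simp
qed

lemma nn_integral_scaleR:
  fixes g :: "'a::euclidean_space \<Rightarrow> ennreal"
  assumes [measurable]: "g \<in> borel_measurable borel" and "0 < s"
  shows "(\<integral>\<^sup>+x. g x \<partial>lborel) = ennreal (s ^ DIM('a)) * (\<integral>\<^sup>+x. g (s *\<^sub>R x) \<partial>lborel)"
  using assms(2) 
  by (subst lborel_affine[of s 0]) (simp_all add: nn_integral_density nn_integral_distr nn_integral_cmult)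

lemma integral_scaleR:
  fixes g :: "'a::euclidean_space \<Rightarrow> real"
  assumes [measurable]: "g \<in> borel_measurable borel" and "0 < s"
  shows "(\<integral>x. g x \<partial>lborel) = s ^ DIM('a) * (\<integral>x. g (s *\<^sub>R x) \<partial>lborel)"
  using assms(2) 
  by (subst lborel_affine[of s 0]) (simp_all add: integral_density integral_distr)

lemma integrable_scaleR:
  fixes g :: "'a::euclidean_space \<Rightarrow> real"
  assumes g: "integrable lborel g" and s: "0 < s"
  shows "integrable lborel (\<lambda>x. g (s *\<^sub>R x))"
proof -
  have [measurable]: "g \<in> borel_measurable borel" using g by auto
  have "(\<integral>\<^sup>+x. ennreal (norm (g x)) \<partial>lborel) =
        ennreal (s ^ DIM('a)) * (\<integral>\<^sup>+x. ennreal (norm (g (s *\<^sub>R x))) \<partial>lborel)"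
    by (rule nn_integral_scaleR) (use s in auto)
  moreover have "(\<integral>\<^sup>+x. ennreal (norm (g x)) \<partial>lborel) < \<infinity>"
    using g by (simp add: integrable_iff_bounded)
  ultimately have "(\<integral>\<^sup>+x. ennreal (norm (g (s *\<^sub>R x))) \<partial>lborel) < \<infinity>"
    using s by (auto simp: ennreal_mult_less_top zero_less_power)
  then show ?thesis by (simp add: integrable_iff_bounded)
qed

section \<open>Integrability of the anomalous kernel\<close>

lemma term_le_suminf_ennreal:
  fixes f :: "nat \<Rightarrow> ennreal"
  shows "f j \<le> (\<Sum>i. f i)"
  using sum_le_suminf[OF summableI, of "{j}" f] by simp

lemma dyadic_shell:
  fixes x :: real
  assumes "1 \<le> x"
  obtains j :: nat where "2 ^ j \<le> x" "x < 2 ^ Suc j"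
proof -
  obtain n where n: "x < 2 ^ n" using real_arch_pow[of 2 x] by auto
  define n0 where "n0 = (LEAST n. x < 2 ^ n)"
  have 1: "x < 2 ^ n0" unfolding n0_def using n by (rule LeastI)
  have "n0 \<noteq> 0" using 1 assms by (intro notI) simp
  then obtain j where j: "n0 = Suc j" by (cases n0) auto
  have "\<not> x < 2 ^ j" using not_less_Least[of j "\<lambda>n. x < 2 ^ n"] j unfolding n0_def by auto
  with 1 j show ?thesis by (intro that[of j]) auto
qed

lemma nn_integral_dyadic_balls_finite:
  fixes c :: "nat \<Rightarrow> real" and \<rho> :: "nat \<Rightarrow> real"
  assumes "\<And>j. 0 \<le> c j" "\<And>j. 0 \<le> \<rho> j" "summable (\<lambda>j. c j * \<rho> j ^ DIM('a::euclidean_space))"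
  shows "(\<integral>\<^sup>+x. (\<Sum>j. ennreal (c j) * indicator (cball (0::'a::euclidean_space) (\<rho> j)) x) \<partial>lborel) < \<infinity>"
proof -
  have "(\<integral>\<^sup>+x. (\<Sum>j. ennreal (c j) * indicator (cball (0::'a) (\<rho> j)) x) \<partial>lborel) =
        (\<Sum>j. ennreal (c j) * emeasure lborel (cball (0::'a) (\<rho> j)))"
    by (subst nn_integral_suminf)
       (auto simp: nn_integral_cmult_indicator borel_closed
             intro!: borel_measurable_times_ennreal borel_measurable_indicator)
  also have "\<dots> = (\<Sum>j. ennreal (unit_ball_vol DIM('a) * (c j * \<rho> j ^ DIM('a))))"
    using assms by (simp add: emeasure_cball ennreal_mult[symmetric] mult_ac)
  also have "\<dots> = ennreal (\<Sum>j. unit_ball_vol DIM('a) * (c j * \<rho> j ^ DIM('a)))"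
    using assms by (intro suminf_ennreal2 summable_mult) auto
  finally show ?thesis by simp
qed

text \<open>
  Comparison with two dyadic sums of indicators of balls: radii \<open>2 ^ Suc j\<close> for the part at infinity,
  where \<open>\<gamma> > 0\<close> makes the series geometric, and radii \<open>(1 / 2) ^ j\<close> for the part at the origin, where
  \<open>\<gamma> < 2\<close> does.
\<close>
lemma nn_integral_min_power_finite:
  fixes \<gamma> :: real
  assumes "0 < \<gamma>" "\<gamma> < 2"
  shows "(\<integral>\<^sup>+w. ennreal (min 1 ((norm w)\<^sup>2) / norm (w::'a::euclidean_space) powr (real DIM('a) + \<gamma>)) \<partial>lborel) < \<infinity>"
proof -
  define p where "p = real DIM('a) + \<gamma>"
  have p: "0 < p" using assms by (simp add: p_def add_nonneg_pos)
  \<comment> \<open>\<open>cO j\<close> is the value of \<open>|w| powr - p\<close> on the inner radius of the shell \<open>2 ^ j \<le> |w| < 2 ^ Suc j\<close>. On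
    \<open>(1 / 2) ^ Suc j \<le> |w| \<le> (1 / 2) ^ j\<close> the product of \<open>|w|\<^sup>2\<close> at the outer radius and \<open>|w| powr - p\<close> at the
    inner radius is \<open>cI j\<close>.\<close>
  let ?cO = "\<lambda>j::nat. (2 powr (- p)) ^ j" and ?rO = "\<lambda>j::nat. 2 ^ Suc j :: real"
  let ?cI = "\<lambda>j::nat. 2 powr p * (2 powr (p - 2)) ^ j" and ?rI = "\<lambda>j::nat. (1 / 2) ^ j :: real"
  let ?O = "\<lambda>w. \<Sum>j. ennreal (?cO j) * indicator (cball (0::'a) (?rO j)) w"
  let ?I = "\<lambda>w. \<Sum>j. ennreal (?cI j) * indicator (cball (0::'a) (?rI j)) w"
  have pw2: "2 powr (real n) = 2 ^ n" for n by (simp add: powr_realpow)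
  have "(\<integral>\<^sup>+w. ?O w \<partial>lborel) < \<infinity>"
  proof (rule nn_integral_dyadic_balls_finite)
    have eq: "?cO j * ?rO j ^ DIM('a) = 2 ^ DIM('a) * (2 powr (- \<gamma>)) ^ j" for j
    proof -
      have "(2::real) powr - p * 2 ^ DIM('a) = 2 powr (- \<gamma>)"
        by (simp add: p_def powr_add pw2[symmetric] flip: powr_add)
      moreover have "?rO j ^ DIM('a) = 2 ^ DIM('a) * (2 ^ DIM('a)) ^ j"
        by (simp add: power_mult_distrib power_mult[symmetric] mult.commute)
      ultimately show ?thesis
        by (simp only: power_mult_distrib[symmetric] mult_ac)
    qed
    have "2 powr (- \<gamma>) < 1" using assms by (simp add: powr_less_one)
    then show "summable (\<lambda>j. ?cO j * ?rO j ^ DIM('a))"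
      unfolding eq by (intro summable_mult summable_geometric) simp
  qed auto
  moreover have "(\<integral>\<^sup>+w. ?I w \<partial>lborel) < \<infinity>"
  proof (rule nn_integral_dyadic_balls_finite)
    have eq: "?cI j * ?rI j ^ DIM('a) = 2 powr p * (2 powr (\<gamma> - 2)) ^ j" for j
    proof -
      have "(2::real) powr (p - 2) = 2 powr (\<gamma> - 2) * 2 ^ DIM('a)"
      proof -
        have "p - 2 = (\<gamma> - 2) + real DIM('a)" by (simp add: p_def)
        then show ?thesis by (simp only: powr_add pw2)
      qed
      then have "(2::real) powr (p - 2) * (1 / 2) ^ DIM('a) = 2 powr (\<gamma> - 2)"
        by (simp add: power_one_over)
      moreover have "?rI j ^ DIM('a) = ((1 / 2) ^ DIM('a)) ^ j"
        by (simp add: power_mult[symmetric] mult.commute)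
      ultimately show ?thesis
        by (simp only: mult.assoc power_mult_distrib[symmetric])
    qed
    have "2 powr (\<gamma> - 2) < 1" using assms by (simp add: powr_less_one)
    then show "summable (\<lambda>j. ?cI j * ?rI j ^ DIM('a))"
      unfolding eq by (intro summable_mult summable_geometric) simp
  qed auto
  moreover have "(\<integral>\<^sup>+w. ?O w + ?I w \<partial>lborel) = (\<integral>\<^sup>+w. ?O w \<partial>lborel) + (\<integral>\<^sup>+w. ?I w \<partial>lborel)"
    by (intro nn_integral_add borel_measurable_suminf_order borel_measurable_times_ennreal
         borel_measurable_indicator borel_measurable_const) simp_all
  ultimately have "(\<integral>\<^sup>+w. ?O w + ?I w \<partial>lborel) < \<infinity>"
    by (simp only: ennreal_add_less_top infinity_ennreal_def simp_thms)
  moreover have "ennreal (min 1 ((norm w)\<^sup>2) / norm w powr p) \<le> ?O w + ?I w" for w :: 'a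
  proof -
    consider "w = 0" | "1 \<le> norm w" | "w \<noteq> 0" "1 \<le> 1 / norm w"
      by (cases "w = 0"; cases "1 \<le> norm w") (auto simp: field_simps)
    then show ?thesis
    proof cases
      case 1
      then show ?thesis by simp
    next
      case 2
      then obtain j where j: "2 ^ j \<le> norm w" "norm w < 2 ^ Suc j" by (rule dyadic_shell)
      have "min 1 ((norm w)\<^sup>2) / norm w powr p \<le> 1 / (2 ^ j) powr p"
        using j p 2 by (intro frac_le powr_mono2) auto
      also have "\<dots> = ?cO j"
      proof -
        have "(2 ^ j) powr p = 2 powr (real j * p)" by (simp only: pw2[symmetric] powr_powr)
        moreover have "?cO j = 2 powr (- p * real j)"
          using powr_powr[of 2 "- p" "real j"] by (simp only: powr_realpow powr_gt_zero)
        ultimately show ?thesis by (simp add: powr_minus divide_inverse mult.commute)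
      qed
      finally have "ennreal (min 1 ((norm w)\<^sup>2) / norm w powr p) \<le> ennreal (?cO j) * indicator (cball 0 (?rO j)) w"
        using j by (simp only: indicator_def mem_cball_0 order.strict_implies_order of_bool_eq mult_1_right ennreal_leI)
      also have "\<dots> \<le> ?O w"
        by (rule term_le_suminf_ennreal)
      finally show ?thesis by (rule order_trans) (rule add_increasing2; simp only: order_refl zero_le)
    next
      case 3
      obtain j where "2 ^ j \<le> 1 / norm w" "1 / norm w < 2 ^ Suc j"
        using 3(2) by (rule dyadic_shell)
      with 3 have j: "norm w \<le> (1/2) ^ j" "(1/2) ^ Suc j \<le> norm w"
        by (auto simp: field_simps)
      have "min 1 ((norm w)\<^sup>2) / norm w powr p \<le> ((1/2) ^ j)\<^sup>2 / ((1/2) ^ Suc j) powr p"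
        using j p 3 by (intro frac_le powr_mono2 min.coboundedI2 power_mono) auto
      also have "\<dots> = ?cI j"
      proof -
        have h: "(1/2::real) ^ n = 2 powr (- real n)" for n
          by (simp only: powr_minus pw2 power_one_over inverse_eq_divide)
        have 1: "((1/2::real) ^ j)\<^sup>2 = 2 powr (- 2 * real j)"
          by (subst power_even_eq[symmetric]) (simp only: h of_nat_mult of_nat_numeral minus_mult_left)
        have 2: "((1/2::real) ^ Suc j) powr p = 2 powr (- (real j + 1) * p)"
          unfolding h powr_powr by (simp add: add.commute)
        have 3: "?cI j = 2 powr (p + (p - 2) * real j)"
          using powr_powr[of 2 "p - 2" "real j"] by (simp only: powr_add powr_realpow powr_gt_zero)
        show ?thesis unfolding 1 2 3 powr_diff[symmetric] by (simp add: algebra_simps)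
      qed
      finally have "ennreal (min 1 ((norm w)\<^sup>2) / norm w powr p) \<le> ennreal (?cI j) * indicator (cball 0 (?rI j)) w"
        using j by (simp only: indicator_def mem_cball_0 order.strict_implies_order of_bool_eq mult_1_right ennreal_leI)
      also have "\<dots> \<le> ?I w"
        by (rule term_le_suminf_ennreal)
      finally show ?thesis by (rule order_trans) (rule add_increasing; simp only: order_refl zero_le)
    qed
  qed
  then have "(\<integral>\<^sup>+w. ennreal (min 1 ((norm (w::'a))\<^sup>2) / norm w powr p) \<partial>lborel) \<le> (\<integral>\<^sup>+w. ?O w + ?I w \<partial>lborel)"
    by (intro nn_integral_mono)
  ultimately show ?thesis unfolding p_def using le_less_trans by blast
qed

lemma square_fraction_le:
  fixes x :: real
  shows "0 \<le> x\<^sup>2 / (1 + x\<^sup>2)" "x\<^sup>2 / (1 + x\<^sup>2) \<le> 1" "x\<^sup>2 / (1 + x\<^sup>2) \<le> x\<^sup>2" "x\<^sup>2 / (1 + x\<^sup>2) \<le> \<bar>x\<bar>"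
proof -
  have pos: "0 < 1 + x\<^sup>2" by (simp add: add_pos_nonneg)
  show "0 \<le> x\<^sup>2 / (1 + x\<^sup>2)" "x\<^sup>2 / (1 + x\<^sup>2) \<le> 1" using pos by (auto simp: divide_simps)
  show "x\<^sup>2 / (1 + x\<^sup>2) \<le> x\<^sup>2" using pos by (simp add: divide_le_eq mult_le_cancel_left1)
  have "0 \<le> (1 - \<bar>x\<bar>)\<^sup>2" by simp
  then have "2 * \<bar>x\<bar> \<le> 1 + x\<^sup>2" by (simp add: power2_diff)
  then have "\<bar>x\<bar> * \<bar>x\<bar> \<le> \<bar>x\<bar> * (1 + x\<^sup>2)" by (intro mult_left_mono) auto
  then show "x\<^sup>2 / (1 + x\<^sup>2) \<le> \<bar>x\<bar>" using pos by (simp add: divide_le_eq power2_eq_square abs_mult_self_eq)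
qed

text \<open>
  This integral is \<open>\<kappa> / m\<close> for \<open>\<gamma> = \<alpha>\<close>. The case \<open>\<gamma> = 1\<close> gives the linear rate of the defect under the
  tail rate assumption.
\<close>
lemma integrable_anomalous_kernel:
  fixes e :: "'a::euclidean_space"
  assumes "norm e = 1" "0 < \<gamma>" "\<gamma> < 2"
  shows "integrable lborel (\<lambda>w. (w \<bullet> e)\<^sup>2 / (1 + (w \<bullet> e)\<^sup>2) * (1 / norm w powr (real DIM('a) + \<gamma>)))"
proof (rule integrableI_bounded)
  have bound: "norm ((w \<bullet> e)\<^sup>2 / (1 + (w \<bullet> e)\<^sup>2) * (1 / norm w powr (real DIM('a) + \<gamma>)))
     \<le> min 1 ((norm w)\<^sup>2) / norm w powr (real DIM('a) + \<gamma>)" for w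
  proof -
    have "(w \<bullet> e)\<^sup>2 \<le> (norm w)\<^sup>2"
      using Cauchy_Schwarz_ineq2[of w e] assms by (simp add: abs_le_square_iff[symmetric])
    then have "(w \<bullet> e)\<^sup>2 / (1 + (w \<bullet> e)\<^sup>2) \<le> min 1 ((norm w)\<^sup>2)"
      using square_fraction_le(2,3)[of "w \<bullet> e"] by auto
    then show ?thesis
      using square_fraction_le(1)[of "w \<bullet> e"]
        divide_right_mono[of "(w \<bullet> e)\<^sup>2 / (1 + (w \<bullet> e)\<^sup>2)" "min 1 ((norm w)\<^sup>2)" "norm w powr (real DIM('a) + \<gamma>)"]
      by (simp add: abs_mult)
  qed
  have "(\<integral>\<^sup>+w. norm ((w \<bullet> e)\<^sup>2 / (1 + (w \<bullet> e)\<^sup>2) * (1 / norm w powr (real DIM('a) + \<gamma>))) \<partial>lborel)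
     \<le> (\<integral>\<^sup>+w. ennreal (min 1 ((norm (w::'a))\<^sup>2) / norm w powr (real DIM('a) + \<gamma>)) \<partial>lborel)"
    by (intro nn_integral_mono ennreal_leI bound)
  also have "\<dots> < \<infinity>" using assms by (intro nn_integral_min_power_finite)
  finally show "(\<integral>\<^sup>+w. norm ((w \<bullet> e)\<^sup>2 / (1 + (w \<bullet> e)\<^sup>2) * (1 / norm w powr (real DIM('a) + \<gamma>))) \<partial>lborel) < \<infinity>" .
qed measurable

section \<open>Velocity integrals of the equilibrium and of its tail\<close>

lemma norm_one_plus_i_ge_1: "1 \<le> norm (1 + \<i> * complex_of_real x)"
  using complex_Re_le_cmod[of "1 + \<i> * complex_of_real x"] by simp

lemma one_plus_i_neq_0: "1 + \<i> * complex_of_real x \<noteq> 0"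
  using norm_one_plus_i_ge_1[of x] by auto

lemma norm_divide_one_plus_i_le: "norm (z / (1 + \<i> * complex_of_real x)) \<le> norm z"
  using norm_one_plus_i_ge_1[of x] by (simp add: norm_divide divide_le_eq mult_le_cancel_left1)

text \<open>
  The mechanism behind all limits in which the transport term disappears.
\<close>
lemma isCont_dilated_integral:
  fixes g :: "'a::euclidean_space \<Rightarrow> complex" and \<phi> :: "real \<Rightarrow> complex"
  assumes g: "integrable lborel g" and [measurable]: "\<phi> \<in> borel_measurable borel" "y \<in> borel_measurable borel"
    and bound: "\<And>x. norm (\<phi> x) \<le> 1" and cont: "isCont \<phi> 0"
  shows "isCont (\<lambda>\<theta>. \<integral>v. g v * \<phi> (\<theta> * y v) \<partial>lborel) 0"
proof (rule continuous_at_sequentiallyI)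
  fix u :: "nat \<Rightarrow> real" assume u: "u \<longlonglongrightarrow> 0"
  have [measurable]: "g \<in> borel_measurable borel" using g by auto
  show "(\<lambda>n. \<integral>v. g v * \<phi> (u n * y v) \<partial>lborel) \<longlonglongrightarrow> (\<integral>v. g v * \<phi> (0 * y v) \<partial>lborel)"
  proof (rule integral_dominated_convergence[where w = "\<lambda>v. norm (g v)"])
    show "integrable lborel (\<lambda>v. norm (g v))" using g by simp
    show "AE v in lborel. (\<lambda>n. g v * \<phi> (u n * y v)) \<longlonglongrightarrow> g v * \<phi> (0 * y v)"
    proof (rule AE_I2)
      fix v
      have "(\<lambda>n. u n * y v) \<longlonglongrightarrow> 0"
        using tendsto_mult_right[OF u, of "y v"] by simp
      then have "(\<lambda>n. \<phi> (u n * y v)) \<longlonglongrightarrow> \<phi> 0"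
        by (rule isCont_tendsto_compose[OF cont])
      then show "(\<lambda>n. g v * \<phi> (u n * y v)) \<longlonglongrightarrow> g v * \<phi> (0 * y v)"
        by (auto intro: tendsto_mult_left)
    qed
    show "AE v in lborel. norm (g v * \<phi> (u n * y v)) \<le> norm (g v)" for n
      using bound by (auto simp: norm_mult mult_left_le)
  qed measurable
qed

text \<open>
  The powers \<open>n = 1\<close> and \<open>n = 2\<close> occur, the second one when a step of the scheme is followed by the bracket
  of the next.
\<close>
lemma resolvent_integral_tendsto:
  fixes g :: "'a::euclidean_space \<Rightarrow> complex"
  assumes g: "integrable lborel g" and y: "y \<in> borel_measurable borel" and \<theta>: "(\<theta> \<longlongrightarrow> 0) \<F>"
  shows "((\<lambda>h. \<integral>v. g v / (1 + \<i> * complex_of_real (\<theta> h * y v)) ^ n \<partial>lborel) \<longlongrightarrow> (\<integral>v. g v \<partial>lborel)) \<F>"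
proof -
  let ?\<phi> = "\<lambda>x. 1 / (1 + \<i> * complex_of_real x) ^ n"
  have "norm (?\<phi> x) \<le> 1" for x
  proof -
    have "1 \<le> norm (1 + \<i> * complex_of_real x) ^ n" using norm_one_plus_i_ge_1 by (rule one_le_power)
    then show ?thesis by (simp add: norm_divide norm_power divide_le_eq_1)
  qed
  then have "isCont (\<lambda>\<theta>. \<integral>v. g v * ?\<phi> (\<theta> * y v) \<partial>lborel) 0"
    by (intro isCont_dilated_integral g y) (auto intro!: continuous_intros)
  from isCont_tendsto_compose[OF this \<theta>] show ?thesis by simp
qed

lemma integrable_mult_bounded:
  fixes g q :: "'a \<Rightarrow> 'b::{real_normed_field, banach, second_countable_topology}"
  assumes "integrable N g" "q \<in> borel_measurable N" "\<And>x. norm (q x) \<le> 1"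
  shows "integrable N (\<lambda>x. g x * q x)"
  by (rule Bochner_Integration.integrable_bound[OF assms(1)])
     (use assms in \<open>auto simp: norm_mult intro!: mult_left_le\<close>)

text \<open>
  The imaginary part is the integral of an odd function.
\<close>
lemma even_profile_transform:
  fixes M :: "'a::euclidean_space \<Rightarrow> real"
  assumes M: "integrable lborel M" and even: "\<And>v. M (- v) = M v"
  shows "(\<integral>v. complex_of_real (M v) / (1 + \<i> * complex_of_real (k \<bullet> v)) \<partial>lborel) =
     complex_of_real ((\<integral>v. M v \<partial>lborel) - (\<integral>v. M v * ((k \<bullet> v)\<^sup>2 / (1 + (k \<bullet> v)\<^sup>2)) \<partial>lborel))"
proof -
  have [measurable]: "M \<in> borel_measurable borel" using M by auto
  have i2: "integrable lborel (\<lambda>v. M v * ((k \<bullet> v)\<^sup>2 / (1 + (k \<bullet> v)\<^sup>2)))"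
    using square_fraction_le by (intro integrable_mult_bounded M) auto
  have "\<bar>x / (1 + x\<^sup>2)\<bar> \<le> 1" for x :: real
  proof -
    have "0 \<le> (1 - \<bar>x\<bar>)\<^sup>2" by simp
    then have "2 * \<bar>x\<bar> \<le> 1 + x\<^sup>2" by (simp add: power2_diff)
    then have "\<bar>x\<bar> \<le> 1 + x\<^sup>2" by linarith
    then show ?thesis by (simp add: abs_divide divide_le_eq add_pos_nonneg)
  qed
  then have i1: "integrable lborel (\<lambda>v. M v * ((k \<bullet> v) / (1 + (k \<bullet> v)\<^sup>2)))"
    by (intro integrable_mult_bounded M) auto
  have odd: "(\<integral>v. M v * ((k \<bullet> v) / (1 + (k \<bullet> v)\<^sup>2)) \<partial>lborel) = 0"
    by (rule integral_odd_eq_0) (auto simp: even)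
  have pt: "complex_of_real (M v) / (1 + \<i> * complex_of_real (k \<bullet> v)) =
      complex_of_real (M v - M v * ((k \<bullet> v)\<^sup>2 / (1 + (k \<bullet> v)\<^sup>2)))
      - \<i> * complex_of_real (M v * ((k \<bullet> v) / (1 + (k \<bullet> v)\<^sup>2)))" for v
  proof -
    have "1 + (k \<bullet> v)\<^sup>2 \<noteq> 0" using zero_le_power2[of "k \<bullet> v"] by linarith
    then have nz: "complex_of_real (1 + (k \<bullet> v)\<^sup>2) \<noteq> 0" by (simp only: of_real_eq_0_iff) simp
    have "complex_of_real (M v) / (1 + \<i> * complex_of_real (k \<bullet> v)) =
      complex_of_real (M v) * (1 - \<i> * complex_of_real (k \<bullet> v)) / complex_of_real (1 + (k \<bullet> v)\<^sup>2)"
      using one_plus_i_neq_0[of "k \<bullet> v"] nz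
      by (simp add: field_simps power2_eq_square)
    also have "\<dots> = complex_of_real (M v - M v * ((k \<bullet> v)\<^sup>2 / (1 + (k \<bullet> v)\<^sup>2)))
      - \<i> * complex_of_real (M v * ((k \<bullet> v) / (1 + (k \<bullet> v)\<^sup>2)))"
    proof -
      have "M v - M v * ((k \<bullet> v)\<^sup>2 / (1 + (k \<bullet> v)\<^sup>2)) = M v / (1 + (k \<bullet> v)\<^sup>2)"
        using \<open>1 + (k \<bullet> v)\<^sup>2 \<noteq> 0\<close> by (simp add: field_simps)
      then show ?thesis by (simp only: of_real_divide of_real_mult) (simp add: diff_divide_distrib algebra_simps)
    qed
    finally show ?thesis .
  qed
  have "(\<integral>v. complex_of_real (M v) / (1 + \<i> * complex_of_real (k \<bullet> v)) \<partial>lborel) =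
     (\<integral>v. complex_of_real (M v - M v * ((k \<bullet> v)\<^sup>2 / (1 + (k \<bullet> v)\<^sup>2))) \<partial>lborel)
     - (\<integral>v. \<i> * complex_of_real (M v * ((k \<bullet> v) / (1 + (k \<bullet> v)\<^sup>2))) \<partial>lborel)"
    unfolding pt using M i1 i2 by (intro Bochner_Integration.integral_diff integrable_mult_right integrable_of_real) auto
  also have "(\<integral>v. \<i> * complex_of_real (M v * ((k \<bullet> v) / (1 + (k \<bullet> v)\<^sup>2))) \<partial>lborel) = 0"
    by (simp only: integral_mult_right_zero integral_complex_of_real odd) simp
  finally show ?thesis
    using M i2 by (simp only: integral_complex_of_real Bochner_Integration.integral_diff) simp
qed

text \<open>
  The substitution \<open>v \<mapsto> s v\<close> shows that the term of the scheme is the defect of the profile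
  \<open>m / (1 + |v| powr \<beta>)\<close>.
\<close>
lemma tail_bracket_scaling:
  fixes e :: "real ^ 'd"
  assumes "0 < s"
  shows "s powr \<alpha> * tail_bracket \<alpha> m e s =
    (\<integral>v. m / (1 + norm v powr (\<alpha> + real CARD('d))) * ((s * (v \<bullet> e))\<^sup>2 / (1 + (s * (v \<bullet> e))\<^sup>2)) \<partial>lborel)"
proof -
  define \<beta> where "\<beta> = \<alpha> + real CARD('d)"
  let ?g = "\<lambda>v::real^'d. m / (s powr \<beta> + norm v powr \<beta>) * ((v \<bullet> e)\<^sup>2 / (1 + (v \<bullet> e)\<^sup>2))"
  let ?h = "\<lambda>v::real^'d. m / (1 + norm v powr \<beta>) * ((s * (v \<bullet> e))\<^sup>2 / (1 + (s * (v \<bullet> e))\<^sup>2))"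
  have g: "?g (s *\<^sub>R v) = s powr (- \<beta>) * ?h v" for v
  proof -
    have "s powr \<beta> + norm (s *\<^sub>R v) powr \<beta> = s powr \<beta> * (1 + norm v powr \<beta>)"
      using assms by (simp add: powr_mult distrib_left)
    then have "m / (s powr \<beta> + norm (s *\<^sub>R v) powr \<beta>) = s powr (- \<beta>) * (m / (1 + norm v powr \<beta>))"
      by (simp add: powr_minus divide_inverse)
    then show ?thesis by (simp only: inner_scaleR_left mult.assoc)
  qed
  have "tail_bracket \<alpha> m e s = (\<integral>v. ?g v \<partial>lborel)"
    by (simp add: tail_bracket_def bracket_def \<beta>_def)
  also have "\<dots> = s ^ DIM(real^'d) * (\<integral>v. ?g (s *\<^sub>R v) \<partial>lborel)"
    by (rule integral_scaleR) (use assms in auto)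
  also have "\<dots> = s powr (real CARD('d) - \<beta>) * (\<integral>v. ?h v \<partial>lborel)"
    unfolding g using assms by (simp add: powr_diff powr_minus powr_realpow divide_inverse)
  finally have "tail_bracket \<alpha> m e s = s powr (- \<alpha>) * (\<integral>v. ?h v \<partial>lborel)"
    by (simp add: \<beta>_def)
  then show ?thesis using assms by (simp add: powr_minus \<beta>_def)
qed

lemma tail_bracket_nonneg: "0 \<le> m \<Longrightarrow> 0 \<le> tail_bracket \<alpha> m e s"
  unfolding tail_bracket_def bracket_def by (intro integral_nonneg_AE AE_I2 mult_nonneg_nonneg divide_nonneg_nonneg) auto

text \<open>
  Dominated convergence: the integrand of \<open>\<kappa>\<close> is both the limit and the majorant.
\<close>
lemma tail_bracket_tendsto:
  fixes e :: "real ^ 'd"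
  assumes alpha: "0 < \<alpha>" "\<alpha> < 2" and unit: "norm e = 1" and m: "0 \<le> m"
  shows "(tail_bracket \<alpha> m e \<longlongrightarrow> diffusion_coeff (\<alpha> + real CARD('d)) m e) (at_right 0)"
  unfolding tendsto_at_iff_sequentially comp_def
proof (intro allI impI)
  fix X :: "nat \<Rightarrow> real" assume X: "\<forall>i. X i \<in> {0<..} - {0}" "X \<longlonglongrightarrow> 0"
  let ?\<beta> = "\<alpha> + real CARD('d)"
  let ?w = "\<lambda>w::real^'d. (w \<bullet> e)\<^sup>2 / (1 + (w \<bullet> e)\<^sup>2) * (m / norm w powr ?\<beta>)"
  have w: "integrable lborel ?w"
    using integrable_mult_right[OF integrable_anomalous_kernel[OF unit alpha], of m] by (simp add: mult_ac add_ac)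
  show "(\<lambda>n. tail_bracket \<alpha> m e (X n)) \<longlonglongrightarrow> diffusion_coeff ?\<beta> m e"
    unfolding tail_bracket_def diffusion_coeff_def bracket_def
  proof (rule integral_dominated_convergence[where w = ?w])
    have "(\<lambda>n. X n powr ?\<beta>) \<longlonglongrightarrow> 0 powr ?\<beta>"
      using X alpha by (intro tendsto_powr') (auto simp: add_pos_nonneg intro!: always_eventually less_imp_le)
    then have lim0: "(\<lambda>n. X n powr ?\<beta>) \<longlonglongrightarrow> 0" by simp
    show "AE v in lborel. (\<lambda>n. m / (X n powr ?\<beta> + norm v powr ?\<beta>) * ((v \<bullet> e)\<^sup>2 / (1 + (v \<bullet> e)\<^sup>2)))
        \<longlonglongrightarrow> ?w v"
    proof (rule AE_I2)
      fix v :: "real^'d"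
      show "(\<lambda>n. m / (X n powr ?\<beta> + norm v powr ?\<beta>) * ((v \<bullet> e)\<^sup>2 / (1 + (v \<bullet> e)\<^sup>2))) \<longlonglongrightarrow> ?w v"
      proof (cases "v = 0")
        case False
        then have "(\<lambda>n. m / (X n powr ?\<beta> + norm v powr ?\<beta>) * ((v \<bullet> e)\<^sup>2 / (1 + (v \<bullet> e)\<^sup>2)))
          \<longlonglongrightarrow> m / (0 + norm v powr ?\<beta>) * ((v \<bullet> e)\<^sup>2 / (1 + (v \<bullet> e)\<^sup>2))"
          by (intro tendsto_intros lim0) auto
        then show ?thesis by (simp add: mult.commute)
      qed simp
    qed
    show "AE v in lborel. norm (m / (X n powr ?\<beta> + norm v powr ?\<beta>) * ((v \<bullet> e)\<^sup>2 / (1 + (v \<bullet> e)\<^sup>2))) \<le> ?w v" for n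
    proof (rule AE_I2)
      fix v :: "real^'d"
      show "norm (m / (X n powr ?\<beta> + norm v powr ?\<beta>) * ((v \<bullet> e)\<^sup>2 / (1 + (v \<bullet> e)\<^sup>2))) \<le> ?w v"
      proof (cases "v = 0")
        case False
        then have "m / (X n powr ?\<beta> + norm v powr ?\<beta>) \<le> m / norm v powr ?\<beta>"
          using m by (intro divide_left_mono mult_pos_pos) (auto simp: add_nonneg_pos)
        moreover have "0 \<le> m / (X n powr ?\<beta> + norm v powr ?\<beta>)" using m by simp
        ultimately show ?thesis
          using square_fraction_le(1)[of "v \<bullet> e"]
          by (simp only: real_norm_def abs_mult abs_of_nonneg mult.commute[of "(v \<bullet> e)\<^sup>2 / _"] mult_right_mono)
      qed simp
    qed
    show "integrable lborel ?w" by (rule w)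
  qed measurable
qed

lemma integrable_tail_profile:
  assumes "0 < \<alpha>" "\<alpha> < 2"
  shows "integrable lborel (\<lambda>v::'a::euclidean_space. m / (1 + norm v powr (\<alpha> + real DIM('a))))"
proof -
  have "integrable lborel (\<lambda>v::'a. 1 / (1 + norm v powr (\<alpha> + real DIM('a))))"
  proof (rule integrableI_bounded)
    let ?K = "\<lambda>v::'a. min 1 ((norm v)\<^sup>2) / norm v powr (real DIM('a) + \<alpha>)"
    have bound: "ennreal (norm (1 / (1 + norm v powr (\<alpha> + real DIM('a))))) \<le> ennreal (?K v) + indicator (cball 0 1) v" for v :: 'a
    proof (cases "norm v \<le> 1")
      case True
      have "ennreal (norm (1 / (1 + norm v powr (\<alpha> + real DIM('a))))) \<le> 1"
      proof -
        have "0 < 1 + norm v powr (\<alpha> + real DIM('a))" by (simp add: add_pos_nonneg)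
        then show ?thesis by (subst ennreal_le_1) (simp add: divide_le_eq abs_of_pos)
      qed
      also have "1 = indicator (cball 0 1) v" using True by simp
      finally show ?thesis by (rule order_trans) simp
    next
      case False
      then have "1 / (1 + norm v powr (\<alpha> + real DIM('a))) \<le> ?K v"
      proof -
        have "0 < norm v powr (\<alpha> + real DIM('a))" "1 \<le> (norm v)\<^sup>2" using False by (auto simp: one_le_power)
        then show ?thesis by (simp add: min_def add.commute frac_le)
      qed
      then show ?thesis using False by (simp add: ennreal_leI)
    qed
    have "(\<integral>\<^sup>+v. norm (1 / (1 + norm (v::'a) powr (\<alpha> + real DIM('a)))) \<partial>lborel) \<le>
      (\<integral>\<^sup>+v. ennreal (?K v) + indicator (cball 0 1) v \<partial>lborel)"
      by (intro nn_integral_mono bound)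
    also have "\<dots> = (\<integral>\<^sup>+v. ennreal (?K v) \<partial>lborel) + emeasure lborel (cball (0::'a) 1)"
      by (subst nn_integral_add) (auto intro!: borel_measurable_indicator borel_closed)
    also have "\<dots> < \<infinity>"
      using nn_integral_min_power_finite[OF assms, where 'a = 'a] emeasure_bounded_finite[of "cball (0::'a) 1"] by auto
    finally show "(\<integral>\<^sup>+v. norm (1 / (1 + norm (v::'a) powr (\<alpha> + real DIM('a)))) \<partial>lborel) < \<infinity>" .
  qed measurable
  then show ?thesis using integrable_mult_right[of m lborel "\<lambda>v::'a. 1 / (1 + norm v powr (\<alpha> + real DIM('a)))"] by simp
qed

text \<open>
  After rotation, the two numbers compared are the defects of \<open>M\<close> and of the tail profile in the same
  direction, so the integral of their difference \<open>P\<close> remains. Inside a ball of radius \<open>R\<close> the weight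
  \<open>x\<^sup>2 / (1 + x\<^sup>2)\<close> is at most \<open>|x| \<le> s R\<close>; outside, \<open>|P| \<le> c |v| powr - (d + 1)\<close>, and dilation by \<open>s\<close> gives
  exactly \<open>s\<close> times the integral of the anomalous kernel with \<open>\<gamma> = 1\<close>.
\<close>
lemma even_defect_linear:
  fixes M :: "real ^ 'd \<Rightarrow> real" and e :: "real ^ 'd"
  assumes alpha: "0 < \<alpha>" "\<alpha> < 2" and unit: "norm e = 1" and M: "integrable lborel M"
    and tail: "(\<lambda>v. M v - m / (1 + norm v powr (\<alpha> + real CARD('d)))) \<in> O[at_infinity](\<lambda>v. norm v powr - (real CARD('d) + 1))"
  obtains C where "0 \<le> C" and
    "\<And>s e'. 0 < s \<Longrightarrow> norm e' = 1 \<Longrightarrow>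
       \<bar>(\<integral>v. M v * ((s * (v \<bullet> e'))\<^sup>2 / (1 + (s * (v \<bullet> e'))\<^sup>2)) \<partial>lborel) - s powr \<alpha> * tail_bracket \<alpha> m e s\<bar> \<le> C * s"
proof -
  have [measurable]: "M \<in> borel_measurable borel" using M by auto
  define p where "p = (\<lambda>v::real^'d. m / (1 + norm v powr (\<alpha> + real CARD('d))))"
  define P where "P = (\<lambda>v. M v - p v)"
  define \<phi> where "\<phi> = (\<lambda>x::real. x\<^sup>2 / (1 + x\<^sup>2))"
  define n where "n = real CARD('d) + 1"
  have [measurable]: "p \<in> borel_measurable borel" "P \<in> borel_measurable borel" "\<phi> \<in> borel_measurable borel"
    unfolding p_def P_def \<phi>_def by measurable
  have \<phi>: "0 \<le> \<phi> x" "\<phi> x \<le> 1" "\<phi> x \<le> \<bar>x\<bar>" for x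
    unfolding \<phi>_def by (rule square_fraction_le)+
  have p: "integrable lborel p"
    using integrable_tail_profile[OF alpha, of m, where 'a = "real^'d"] by (simp add: p_def)
  have P: "integrable lborel P" using M p by (simp add: P_def)
  obtain c where c: "0 < c" "\<forall>\<^sub>F v in at_infinity. norm (P v) \<le> c * norm (norm v powr - n)"
    using tail unfolding P_def p_def n_def by (auto elim!: landau_o.bigE)
  then obtain R0 where R0: "\<And>v. R0 \<le> norm v \<Longrightarrow> norm (P v) \<le> c * norm (norm v powr - n)"
    by (auto simp: eventually_at_infinity)
  define R where "R = max R0 0"
  define K where "K = (\<lambda>e' v. \<phi> (v \<bullet> e') * (1 / norm (v::real^'d) powr n))"
  have K: "integrable lborel (K e')" if "norm e' = 1" for e'
    using integrable_anomalous_kernel[OF that, of 1] by (simp add: K_def \<phi>_def n_def)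
  define J where "J = (\<integral>v. K e v \<partial>lborel)"
  have J: "(\<integral>v. K e' v \<partial>lborel) = J" if "norm e' = 1" for e'
    unfolding J_def K_def
    by (rule integral_radial_direction[where g = "\<lambda>r x. \<phi> x * (1 / r powr n)"]) (use that unit in auto)
  have J0: "0 \<le> J" unfolding J_def K_def using \<phi> by (intro integral_nonneg_AE) auto
  show ?thesis
  proof (rule that)
    show "0 \<le> R * (\<integral>v. \<bar>P v\<bar> \<partial>lborel) + c * J" using c J0 by (auto simp: R_def intro!: add_nonneg_nonneg mult_nonneg_nonneg)
    fix s :: real and e' :: "real^'d" assume s: "0 < s" and e': "norm e' = 1"
    have iM: "integrable lborel (\<lambda>v. M v * \<phi> (s * (v \<bullet> e')))" and ip: "integrable lborel (\<lambda>v. p v * \<phi> (s * (v \<bullet> e')))"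
      and iP: "integrable lborel (\<lambda>v. P v * \<phi> (s * (v \<bullet> e')))"
      using \<phi> by (auto intro!: integrable_mult_bounded M p P)
    have Ks: "K e' (s *\<^sub>R v) = s powr (- n) * (\<phi> (s * (v \<bullet> e')) * (1 / norm v powr n))" for v
      using s by (simp add: K_def powr_mult powr_minus divide_inverse)
    have "integrable lborel (\<lambda>v. s powr n * K e' (s *\<^sub>R v))"
      using s K[OF e'] by (intro integrable_mult_right integrable_scaleR)
    then have iK: "integrable lborel (\<lambda>v. \<phi> (s * (v \<bullet> e')) * (1 / norm v powr n))"
    proof -
      have "s powr n * s powr (- n) = 1" using s by (simp add: powr_minus)
      then have "s powr n * (s powr (- n) * x) = x" for x by (simp only: mult.assoc[symmetric] mult_1_left)
      then show ?thesis using \<open>integrable lborel (\<lambda>v. s powr n * K e' (s *\<^sub>R v))\<close> unfolding Ks by (simp only:)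
    qed
    have "J = s ^ DIM(real^'d) * (\<integral>v. K e' (s *\<^sub>R v) \<partial>lborel)"
      unfolding J[OF e', symmetric] by (rule integral_scaleR) (use s in \<open>auto simp: K_def\<close>)
    also have "\<dots> = s powr (real CARD('d) - n) * (\<integral>v. \<phi> (s * (v \<bullet> e')) * (1 / norm v powr n) \<partial>lborel)"
      unfolding Ks using s by (simp only: integral_mult_right_zero) (simp add: powr_diff powr_minus powr_realpow divide_inverse)
    finally have vK: "(\<integral>v. \<phi> (s * (v \<bullet> e')) * (1 / norm v powr n) \<partial>lborel) = s * J"
      using s by (simp add: n_def powr_minus)
    have "s powr \<alpha> * tail_bracket \<alpha> m e s = (\<integral>v. p v * \<phi> (s * (v \<bullet> e)) \<partial>lborel)"
      by (simp only: tail_bracket_scaling[OF s] p_def \<phi>_def)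
    also have "\<dots> = (\<integral>v. p v * \<phi> (s * (v \<bullet> e')) \<partial>lborel)"
      unfolding p_def
      by (rule integral_radial_direction[where g = "\<lambda>r x. m / (1 + r powr (\<alpha> + real CARD('d))) * \<phi> (s * x)", symmetric])
         (use unit e' in auto)
    finally have "(\<integral>v. M v * \<phi> (s * (v \<bullet> e')) \<partial>lborel) - s powr \<alpha> * tail_bracket \<alpha> m e s
      = (\<integral>v. P v * \<phi> (s * (v \<bullet> e')) \<partial>lborel)"
      using iM ip by (simp add: P_def left_diff_distrib)
    also have "\<bar>\<dots>\<bar> \<le> (\<integral>v. norm (P v * \<phi> (s * (v \<bullet> e'))) \<partial>lborel)"
      using integral_norm_bound[of lborel "\<lambda>v. P v * \<phi> (s * (v \<bullet> e'))"] by simp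
    also have "\<dots> \<le> (\<integral>v. (s * R) * \<bar>P v\<bar> + c * (\<phi> (s * (v \<bullet> e')) * (1 / norm v powr n)) \<partial>lborel)"
    proof (rule integral_mono)
      show "integrable lborel (\<lambda>v. norm (P v * \<phi> (s * (v \<bullet> e'))))" using iP by (rule integrable_norm)
      show "integrable lborel (\<lambda>v. (s * R) * \<bar>P v\<bar> + c * (\<phi> (s * (v \<bullet> e')) * (1 / norm v powr n)))"
        by (intro Bochner_Integration.integrable_add integrable_mult_right iK integrable_abs P)
      fix v :: "real^'d"
      show "norm (P v * \<phi> (s * (v \<bullet> e'))) \<le> (s * R) * \<bar>P v\<bar> + c * (\<phi> (s * (v \<bullet> e')) * (1 / norm v powr n))"
      proof (cases "R \<le> norm v")
        case True
        then have "\<bar>P v\<bar> * \<phi> (s * (v \<bullet> e')) \<le> (c * (1 / norm v powr n)) * \<phi> (s * (v \<bullet> e'))"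
          using R0[of v] \<phi> by (intro mult_right_mono) (auto simp: R_def powr_minus divide_inverse)
        moreover have "0 \<le> (s * R) * \<bar>P v\<bar>" using s by (simp add: R_def)
        ultimately show ?thesis using \<phi>(1)[of "s * (v \<bullet> e')"] by (simp add: abs_mult mult_ac)
      next
        case False
        have "\<bar>v \<bullet> e'\<bar> \<le> norm v" using Cauchy_Schwarz_ineq2[of v e'] e' by simp
        then have "\<bar>s * (v \<bullet> e')\<bar> \<le> s * R" using s False by (simp add: abs_mult)
        then have "\<phi> (s * (v \<bullet> e')) \<le> s * R" using \<phi>(3)[of "s * (v \<bullet> e')"] by linarith
        then have "\<bar>P v\<bar> * \<phi> (s * (v \<bullet> e')) \<le> \<bar>P v\<bar> * (s * R)" by (intro mult_left_mono) auto
        moreover have "0 \<le> c * (\<phi> (s * (v \<bullet> e')) * (1 / norm v powr n))" using c \<phi> by simp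
        ultimately show ?thesis using \<phi>(1)[of "s * (v \<bullet> e')"] by (simp add: abs_mult mult_ac)
      qed
    qed
    also have "\<dots> = (s * R) * (\<integral>v. \<bar>P v\<bar> \<partial>lborel) + c * (s * J)"
      using P iK by (simp only: Bochner_Integration.integral_add integrable_mult_right integrable_abs integral_mult_right_zero vK)
    finally show "\<bar>(\<integral>v. M v * ((s * (v \<bullet> e'))\<^sup>2 / (1 + (s * (v \<bullet> e'))\<^sup>2)) \<partial>lborel) - s powr \<alpha> * tail_bracket \<alpha> m e s\<bar>
      \<le> (R * (\<integral>v. \<bar>P v\<bar> \<partial>lborel) + c * J) * s"
      by (simp add: \<phi>_def algebra_simps)
  qed
qed

text \<open>
  For \<open>\<alpha> \<ge> 1\<close> the tail equivalence suffices, since \<open>\<beta> \<ge> d + 1\<close>. Replacing \<open>|v| powr - \<beta>\<close> by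
  \<open>1 / (1 + |v| powr \<beta>)\<close> costs \<open>|v| powr - (2 \<beta>)\<close>, and \<open>2 \<beta> \<ge> d + 1\<close>.
\<close>
lemma tail_correction_bigo:
  fixes M :: "real ^ 'd \<Rightarrow> real"
  assumes alpha: "0 < \<alpha>" and rate: "tail_rate \<alpha> (\<alpha> + real CARD('d)) m M"
    and equiv: "M \<sim>[at_infinity] (\<lambda>v. m / norm v powr (\<alpha> + real CARD('d)))"
  shows "(\<lambda>v. M v - m / (1 + norm v powr (\<alpha> + real CARD('d)))) \<in> O[at_infinity](\<lambda>v. norm v powr - (real CARD('d) + 1))"
proof -
  define \<beta> where "\<beta> = \<alpha> + real CARD('d)"
  define n where "n = real CARD('d) + 1"
  have card: "1 \<le> real CARD('d)" using zero_less_card_finite[where 'a='d] by linarith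
  have "- (2 * (\<alpha> + c)) \<le> - (c + 1)" if "1 \<le> c" for c :: real
  proof -
    have "1 + 0 \<le> c + 2 * \<alpha>" using that alpha by (intro add_mono) auto
    then show ?thesis by (simp add: algebra_simps)
  qed
  then have exponents: "- (2 * \<beta>) \<le> - n"
    using card unfolding \<beta>_def n_def by blast
  have big: "\<forall>\<^sub>F v::real^'d in at_infinity. 1 \<le> norm v"
    by (auto simp: eventually_at_infinity)
  have "(\<lambda>v. M v - m / norm v powr \<beta>) \<in> O[at_infinity](\<lambda>v. norm v powr - n)"
  proof (cases "\<alpha> < 1")
    case True
    then show ?thesis using rate by (simp add: tail_rate_def \<beta>_def n_def)
  next
    case False
    have "(\<lambda>v::real^'d. m / norm v powr \<beta>) \<in> O[at_infinity](\<lambda>v. norm v powr - n)"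
    proof (rule landau_o.bigI[where c = "\<bar>m\<bar> + 1"])
      show "\<forall>\<^sub>F v::real^'d in at_infinity. norm (m / norm v powr \<beta>) \<le> (\<bar>m\<bar> + 1) * norm (norm v powr - n)"
        using big
      proof eventually_elim
        case (elim v)
        have "norm v powr (- \<beta>) \<le> norm v powr (- n)"
          using elim False by (intro powr_mono) (auto simp: \<beta>_def n_def)
        then have "\<bar>m\<bar> * norm v powr (- \<beta>) \<le> (\<bar>m\<bar> + 1) * norm v powr (- n)"
          by (intro mult_mono) auto
        then show ?case by (simp add: powr_minus divide_inverse abs_mult)
      qed
    qed auto
    note profile = this
    have "M \<in> O[at_infinity](\<lambda>v. m / norm v powr \<beta>)"
      using asymp_equiv_imp_bigo[OF equiv] by (simp add: \<beta>_def)
    then have "M \<in> O[at_infinity](\<lambda>v. norm v powr - n)"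
      using profile by (rule landau_o.big_trans)
    then show ?thesis using profile by (rule sum_in_bigo(2))
  qed
  moreover have "(\<lambda>v::real^'d. m / norm v powr \<beta> - m / (1 + norm v powr \<beta>)) \<in> O[at_infinity](\<lambda>v. norm v powr - n)"
  proof (rule landau_o.bigI[where c = "\<bar>m\<bar> + 1"])
    show "\<forall>\<^sub>F v::real^'d in at_infinity. norm (m / norm v powr \<beta> - m / (1 + norm v powr \<beta>)) \<le> (\<bar>m\<bar> + 1) * norm (norm v powr - n)"
      using big
    proof eventually_elim
      case (elim v)
      define y where "y = norm v powr \<beta>"
      have y: "0 < y" using elim by (auto simp: y_def)
      have "m / y - m / (1 + y) = m * (1 / (y * (1 + y)))" using y by (simp add: field_simps)
      moreover have "1 / (y * (1 + y)) \<le> 1 / (y * y)" using y by (intro divide_left_mono mult_left_mono) auto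
      moreover have "1 / (y * y) = norm v powr (- (2 * \<beta>))" by (simp add: y_def powr_minus divide_inverse flip: powr_add)
      moreover have "norm v powr (- (2 * \<beta>)) \<le> norm v powr (- n)"
        using elim exponents by (intro powr_mono) auto
      moreover have "0 \<le> 1 / (y * (1 + y))" using y by simp
      ultimately have "norm (m / y - m / (1 + y)) \<le> \<bar>m\<bar> * norm v powr (- n)"
        by (simp only: real_norm_def abs_mult abs_of_nonneg) (intro mult_left_mono, auto)
      also have "\<dots> \<le> (\<bar>m\<bar> + 1) * norm (norm v powr (- n))" by (simp add: mult_right_mono)
      finally show ?case by (simp only: y_def)
    qed
  qed auto
  ultimately have "(\<lambda>v. (M v - m / norm v powr \<beta>) + (m / norm v powr \<beta> - m / (1 + norm v powr \<beta>))) \<in> O[at_infinity](\<lambda>v. norm v powr - n)"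
    by (rule sum_in_bigo)
  then show ?thesis by (simp add: \<beta>_def n_def)
qed

section \<open>The relaxation equation at a fixed velocity\<close>

text \<open>
  Each of the \<open>N\<close> terms is at most \<open>T / N\<close> times the modulus of continuity of the derivative at \<open>T / N\<close>.
\<close>
lemma summed_truncation_tendsto_0:
  fixes u D :: "real \<Rightarrow> 'b::real_normed_vector"
  assumes T: "0 < T" and deriv: "\<And>t. t \<in> {0..T} \<Longrightarrow> (u has_vector_derivative D t) (at t within {0..T})"
    and cont: "continuous_on {0..T} D"
  shows "(\<lambda>N. \<Sum>j<N. norm (u (real (Suc j) * (T / real N)) - u (real j * (T / real N))
            - (T / real N) *\<^sub>R D (real (Suc j) * (T / real N)))) \<longlonglongrightarrow> 0"
    (is "?S \<longlonglongrightarrow> 0")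
proof (rule LIMSEQ_I)
  fix \<eta> :: real assume \<eta>: "0 < \<eta>"
  have "uniformly_continuous_on {0..T} D"
    by (rule compact_uniformly_continuous[OF cont]) simp
  then obtain \<delta> where \<delta>: "0 < \<delta>"
    "\<And>s t. s \<in> {0..T} \<Longrightarrow> t \<in> {0..T} \<Longrightarrow> dist s t < \<delta> \<Longrightarrow> dist (D s) (D t) < \<eta> / (2 * T)"
    unfolding uniformly_continuous_on_def using \<eta> T by (metis divide_pos_pos mult_pos_pos zero_less_numeral)
  obtain N0 :: nat where N0: "T / \<delta> < real N0" using reals_Archimedean2 by blast
  show "\<exists>N0. \<forall>N\<ge>N0. norm (?S N - 0) < \<eta>"
  proof (intro exI allI impI)
    fix N assume N: "max 1 N0 \<le> N"
    define h where "h = T / real N"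
    have "T / \<delta> < real N" using N N0 by linarith
    then have h: "0 < h" "h < \<delta>" and hN: "real N * h = T" using \<delta> T N by (auto simp: h_def field_simps)
    have "norm (u (real (Suc j) * h) - u (real j * h) - h *\<^sub>R D (real (Suc j) * h)) \<le> h * (\<eta> / (2 * T))"
      if j: "j < N" for j
    proof -
      have "real (Suc j) * h \<le> T" using j h unfolding hN[symmetric] by (intro mult_right_mono) auto
      then have sub: "{real j * h .. real (Suc j) * h} \<subseteq> {0..T}" using h by auto
      have seg: "closed_segment (real j * h) (real (Suc j) * h) = {real j * h .. real (Suc j) * h}"
        using h by (auto simp: closed_segment_eq_real_ivl algebra_simps)
      have "norm (u (real (Suc j) * h) - u (real j * h) - (real (Suc j) * h - real j * h) *\<^sub>R D (real (Suc j) * h))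
          \<le> norm (real (Suc j) * h - real j * h) * (\<eta> / (2 * T))"
      proof (rule vector_differentiable_bound_linearization[where S = "{real j * h .. real (Suc j) * h}"])
        fix t assume t: "t \<in> {real j * h .. real (Suc j) * h}"
        with sub have "t \<in> {0..T}" by auto
        then show "(u has_vector_derivative D t) (at t within {real j * h .. real (Suc j) * h})"
          using deriv has_vector_derivative_within_subset sub by blast
        have "dist t (real (Suc j) * h) < \<delta>" using t h by (auto simp: dist_real_def algebra_simps)
        moreover have "real (Suc j) * h \<in> {0..T}" using sub h by (auto simp: algebra_simps)
        ultimately have "dist (D t) (D (real (Suc j) * h)) < \<eta> / (2 * T)"
          using \<delta>(2) \<open>t \<in> {0..T}\<close> by blast
        then show "norm (D t - D (real (Suc j) * h)) \<le> \<eta> / (2 * T)" by (simp add: dist_norm)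
      qed (use seg h in \<open>auto simp: algebra_simps\<close>)
      then show ?thesis using h by (simp add: algebra_simps)
    qed
    then have "?S N \<le> (\<Sum>j<N. h * (\<eta> / (2 * T)))" unfolding h_def by (intro sum_mono) auto
    also have "\<dots> = (real N * h) * (\<eta> / (2 * T))" by simp
    also have "\<dots> < \<eta>" unfolding hN using T \<eta> by simp
    finally show "norm (?S N - 0) < \<eta>" by (simp add: sum_nonneg)
  qed
qed

text \<open>
  The integrating factor \<open>exp (s (1 + i y) / c)\<close> has modulus \<open>exp (s / c)\<close>, so the oscillation
  \<open>y\<close>, which grows with the velocity, does not enter the bound.
\<close>
lemma relaxation_bound:
  fixes u :: "real \<Rightarrow> complex" and y c :: real
  assumes c: "0 < c" and t: "0 \<le> t"
    and deriv: "\<And>s. s \<in> {0..t} \<Longrightarrow>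
      (u has_vector_derivative (g s - (1 + \<i> * complex_of_real y) * u s) / complex_of_real c) (at s within {0..t})"
    and g: "\<And>s. s \<in> {0..t} \<Longrightarrow> norm (g s) \<le> K"
  shows "norm (u t) \<le> norm (u 0) + K"
proof (cases "t = 0")
  case True
  then show ?thesis using g[of 0] order_trans[OF norm_ge_zero, of "g 0" K] by simp
next
  case False
  with t have t: "0 < t" by simp
  define a where "a = (1 + \<i> * complex_of_real y) / complex_of_real c"
  define E where "E = (\<lambda>s. exp (complex_of_real s * a))"
  have nE: "norm (E s) = exp (s / c)" for s
    by (simp add: E_def a_def norm_exp_eq_Re)
  have E: "(E has_vector_derivative a * E s) (at s within S)" for s S
  proof -
    have "((\<lambda>z. exp (z * a)) has_field_derivative a * exp (complex_of_real s * a)) (at (complex_of_real s))"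
      by (auto intro!: derivative_eq_intros)
    from has_vector_derivative_real_field[OF this] show ?thesis
      unfolding E_def by (rule has_vector_derivative_at_within)
  qed
  \<comment> \<open>The right-hand side is the increment of a primitive of the bound \<open>K exp (s / c) / c\<close> of the derivative
    of \<open>E u\<close>.\<close>
  have "norm (E t * u t - E 0 * u 0) \<le> K * exp (t / c) - K * exp (0 / c)"
  proof (rule differentiable_bound_general[OF t])
    show "continuous_on {0..t} (\<lambda>s. E s * u s)"
      by (intro continuous_on_mult continuous_on_vector_derivative[OF E] continuous_on_vector_derivative[OF deriv])
    show "continuous_on {0..t} (\<lambda>s. K * exp (s / c))" by (intro continuous_intros) (use c in auto)
    fix s assume s: "0 < s" "s < t"
    have "(u has_vector_derivative (g s - (1 + \<i> * complex_of_real y) * u s) / complex_of_real c) (at s)"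
      using deriv[of s] s by (simp add: at_within_Icc_at)
    from has_vector_derivative_mult[OF E this]
    have "((\<lambda>s. E s * u s) has_vector_derivative
       (E s * ((g s - (1 + \<i> * complex_of_real y) * u s) / complex_of_real c) + a * E s * u s)) (at s)" .
    moreover have "E s * ((g s - (1 + \<i> * complex_of_real y) * u s) / complex_of_real c) + a * E s * u s
       = E s * g s / complex_of_real c"
      using c by (simp add: a_def field_simps)
    ultimately show "((\<lambda>s. E s * u s) has_vector_derivative E s * g s / complex_of_real c) (at s)" by simp
    show "((\<lambda>s. K * exp (s / c)) has_vector_derivative K * (exp (s / c) / c)) (at s)"
      using c by (auto intro!: derivative_eq_intros simp flip: has_real_derivative_iff_has_vector_derivative)
    show "norm (E s * g s / complex_of_real c) \<le> K * (exp (s / c) / c)"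
      using g[of s] s c by (simp add: norm_mult norm_divide nE divide_right_mono mult.commute)
  qed
  then have "norm (E t * u t) \<le> norm (u 0) + K * (exp (t / c) - 1)"
    using norm_triangle_ineq2[of "E t * u t" "E 0 * u 0"] by (simp add: E_def algebra_simps)
  then have "exp (t / c) * norm (u t) \<le> norm (u 0) + K * (exp (t / c) - 1)"
    by (simp add: norm_mult nE)
  also have "\<dots> \<le> exp (t / c) * norm (u 0) + K * exp (t / c)"
  proof -
    have "0 \<le> K" using g[of 0] t order_trans[OF norm_ge_zero, of "g 0" K] by simp
    moreover have "1 * norm (u 0) \<le> exp (t / c) * norm (u 0)" using t c by (intro mult_right_mono) auto
    ultimately show ?thesis by (simp add: algebra_simps)
  qed
  also have "\<dots> = exp (t / c) * (norm (u 0) + K)" by (simp add: algebra_simps)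
  finally show ?thesis by simp
qed

text \<open>
  The exact solution satisfies the implicit Euler recursion with a truncation error added to the old
  value, so the factor \<open>1 / (1 + i \<lambda> y)\<close>, of modulus at most \<open>1\<close> for every \<open>y\<close>, applies to that error too.
\<close>
lemma implicit_euler_truncation:
  fixes u0 u1 g :: complex and c h y :: real
  assumes "0 < c" "0 < h"
  defines "l \<equiv> h / (c + h)"
  shows "u1 = (complex_of_real (1 - l) * (u0 + (u1 - u0 - h *\<^sub>R ((g - (1 + \<i> * complex_of_real y) * u1) / complex_of_real c)))
              + complex_of_real l * g) / (1 + \<i> * complex_of_real (l * y))"
proof -
  have l: "1 - l = c / (c + h)" using assms by (simp add: l_def field_simps)
  have ch: "complex_of_real (c + h) \<noteq> 0" "complex_of_real c \<noteq> 0"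
    using assms by (simp_all del: of_real_add)
  let ?z = "(g - (1 + \<i> * complex_of_real y) * u1)"
  have 1: "complex_of_real c * (h *\<^sub>R (?z / complex_of_real c)) = complex_of_real h * ?z"
    using ch by (simp add: scaleR_conv_of_real)
  have distribute: "b * (p * (u0 + (u1 - u0 - x)) + p' * g) = (b * p) * (u1 - x) + (b * p') * g" for b p p' x :: complex
    by (simp add: algebra_simps)
  have e: "complex_of_real (c + h) * complex_of_real (1 - l) = complex_of_real c"
      "complex_of_real (c + h) * complex_of_real l = complex_of_real h"
    using assms unfolding of_real_mult[symmetric] of_real_eq_iff l by (simp_all add: l_def)
  have "complex_of_real (c + h) * ((complex_of_real (1 - l) * (u0 + (u1 - u0 - h *\<^sub>R (?z / complex_of_real c))) + complex_of_real l * g))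
     = complex_of_real c * (u1 - h *\<^sub>R (?z / complex_of_real c)) + complex_of_real h * g"
    unfolding distribute e ..
  also have "\<dots> = complex_of_real c * u1 - complex_of_real h * ?z + complex_of_real h * g"
    by (simp only: right_diff_distrib 1)
  also have "\<dots> = complex_of_real (c + h) * u1 + \<i> * complex_of_real (h * y) * u1"
    by (simp add: algebra_simps)
  also have "\<dots> = complex_of_real (c + h) * ((1 + \<i> * complex_of_real (l * y)) * u1)"
    unfolding l_def of_real_mult of_real_divide using ch by (simp add: field_simps)
  finally have "complex_of_real (1 - l) * (u0 + (u1 - u0 - h *\<^sub>R (?z / complex_of_real c))) + complex_of_real l * g
     = (1 + \<i> * complex_of_real (l * y)) * u1" using ch by simp
  then show ?thesis using one_plus_i_neq_0[of "l * y"] by (simp add: eq_divide_eq)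
qed

lemma perturbed_contraction_error:
  fixes G F \<tau> R :: "nat \<Rightarrow> complex" and l x :: real
  assumes l: "0 \<le> l" "l \<le> 1"
    and "G 0 = F 0"
    and G: "\<And>n. n < N \<Longrightarrow> G (Suc n) = (complex_of_real (1 - l) * G n + complex_of_real l * R n) / (1 + \<i> * complex_of_real x)"
    and F: "\<And>n. n < N \<Longrightarrow> F (Suc n) = (complex_of_real (1 - l) * (F n + \<tau> n) + complex_of_real l * R n) / (1 + \<i> * complex_of_real x)"
  shows "n \<le> N \<Longrightarrow> norm (G n - F n) \<le> (\<Sum>j<n. norm (\<tau> j))"
proof (induction n)
  case 0
  then show ?case using assms by simp
next
  case (Suc n)
  have "G (Suc n) - F (Suc n) = (complex_of_real (1 - l) * (G n - F n - \<tau> n)) / (1 + \<i> * complex_of_real x)"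
    using G F Suc.prems by (simp add: diff_divide_distrib[symmetric] algebra_simps)
  then have "norm (G (Suc n) - F (Suc n)) \<le> norm (complex_of_real (1 - l) * (G n - F n - \<tau> n))"
    using norm_divide_one_plus_i_le by metis
  also have "\<dots> \<le> 1 * norm (G n - F n - \<tau> n)"
    using l unfolding norm_mult norm_of_real by (intro mult_right_mono) auto
  also have "\<dots> \<le> norm (G n - F n) + norm (\<tau> n)" using norm_triangle_ineq4 by simp
  finally show ?case using Suc by simp
qed

lemma geometric_growth_bound:
  fixes p :: "nat \<Rightarrow> real"
  assumes "p 0 \<le> 0" "0 \<le> a" "0 \<le> B" and step: "\<And>n. n < N \<Longrightarrow> p (Suc n) \<le> p n + a * (p n + B)"
  shows "n \<le> N \<Longrightarrow> p n + B \<le> (1 + a) ^ n * B"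
proof (induction n)
  case (Suc n)
  have "p (Suc n) + B \<le> (1 + a) * (p n + B)" using step[of n] Suc.prems by (simp add: algebra_simps)
  also have "\<dots> \<le> (1 + a) * ((1 + a) ^ n * B)" using Suc assms by (intro mult_left_mono) auto
  finally show ?case by (simp add: mult_ac)
qed (use assms in simp)

text \<open>
  The density equation of the scheme at the exact density, \<open>X\<close> being the numerator obtained from
  implicit Euler with that density: what remains is the defect \<open>1 - A - Q\<close> and the error \<open>d\<close> of the mass.
\<close>
lemma density_defect_identity:
  fixes X r d lc A Q k :: complex
  assumes "k \<noteq> 0" "k = 1 - lc" "k * X = r + d - lc * r * A"
  shows "X - r * (A + Q / k) = (r * (1 - A - Q) + d) / k"
proof -
  have "k * (X - r * (A + Q / k)) = k * X - r * (k * A) - r * (k * (Q / k))" by (simp add: algebra_simps)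
  also have "k * (Q / k) = Q" using assms(1) by simp
  also have "k * X - r * (k * A) - r * Q = r * (1 - A - Q) + d"
    unfolding assms(3) by (simp add: assms(2) algebra_simps)
  finally show ?thesis using assms(1) by (simp add: eq_divide_eq mult.commute)
qed

text \<open>
  One implicit step moves the value by \<open>\<lambda>\<close> times a damped right-hand side of the relaxation equation.
\<close>
lemma resolvent_increment:
  fixes L Y u R :: complex
  assumes w: "1 + \<i> * (L * Y) \<noteq> 0"
  shows "((1 - L) * u + L * R) / (1 + \<i> * (L * Y)) - u = L * ((R - (1 + \<i> * Y) * u) / (1 + \<i> * (L * Y)))"
proof -
  have "((1 - L) * u + L * R) / (1 + \<i> * (L * Y)) - u
      = (((1 - L) * u + L * R) - u * (1 + \<i> * (L * Y))) / (1 + \<i> * (L * Y))"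
    using w by (simp add: diff_divide_distrib)
  also have "((1 - L) * u + L * R) - u * (1 + \<i> * (L * Y)) = L * (R - (1 + \<i> * Y) * u)"
    by (simp add: algebra_simps)
  finally show ?thesis by simp
qed

section \<open>The scheme in one Fourier mode\<close>

text \<open>
  One Fourier mode of the kinetic equation: \<open>c\<close> stands for \<open>\<epsilon> powr \<alpha>\<close>, \<open>y v\<close> for \<open>\<epsilon> (k \<bullet> v)\<close>, \<open>F\<close> and \<open>r\<close> for
  the transforms of the solution and of its density.
\<close>
locale relaxation_mode =
  fixes M :: "'a::euclidean_space \<Rightarrow> real" and c T :: real and y :: "'a \<Rightarrow> real"
    and F :: "real \<Rightarrow> 'a \<Rightarrow> complex" and r :: "real \<Rightarrow> complex"
  assumes M_integrable: "integrable lborel M" and M_pos: "\<And>v. 0 < M v" and M_mass: "(\<integral>v. M v \<partial>lborel) = 1"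
    and c_pos: "0 < c" and T_pos: "0 < T" and y_measurable [measurable]: "y \<in> borel_measurable borel"
    and F_integrable: "\<And>t. t \<in> {0..T} \<Longrightarrow> integrable lborel (F t)"
    and density: "\<And>t. t \<in> {0..T} \<Longrightarrow> (\<integral>v. F t v \<partial>lborel) = r t"
    and r_continuous: "continuous_on {0..T} r"
    and ode: "\<And>t v. t \<in> {0..T} \<Longrightarrow> ((\<lambda>s. F s v) has_vector_derivative
       (r t * complex_of_real (M v) - (1 + \<i> * complex_of_real (y v)) * F t v) / complex_of_real c) (at t within {0..T})"
begin

text \<open>
  The weight \<open>\<lambda>\<close> of the scheme for the time step \<open>h\<close>.
\<close>
definition l :: "real \<Rightarrow> real" where "l h = h / (c + h)"

text \<open>
  The time derivative of \<open>F\<close>, as prescribed by the equation.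
\<close>
definition D :: "real \<Rightarrow> 'a \<Rightarrow> complex" where
  "D t v = (r t * complex_of_real (M v) - (1 + \<i> * complex_of_real (y v)) * F t v) / complex_of_real c"

text \<open>
  Implicit Euler with the exact density on the right-hand side; it decouples the velocities.
\<close>
primrec G :: "real \<Rightarrow> nat \<Rightarrow> 'a \<Rightarrow> complex" where
  "G h 0 v = F 0 v"
| "G h (Suc n) v = (complex_of_real (1 - l h) * G h n v + complex_of_real (l h) * (r (real (Suc n) * h) * complex_of_real (M v)))
      / (1 + \<i> * complex_of_real (l h * y v))"

declare G.simps(2) [simp del]

text \<open>
  The first term of the denominator of the scheme; \<open>1 - A h\<close> is the defect of the equilibrium.
\<close>
definition A :: "real \<Rightarrow> complex" where
  "A h = (\<integral>v. complex_of_real (M v) / (1 + \<i> * complex_of_real (l h * y v)) \<partial>lborel)"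

definition truncation :: "nat \<Rightarrow> nat \<Rightarrow> 'a \<Rightarrow> complex" where
  "truncation N j v = F (real (Suc j) * (T / real N)) v - F (real j * (T / real N)) v
      - (T / real N) *\<^sub>R D (real (Suc j) * (T / real N)) v"

lemma M_measurable [measurable]: "M \<in> borel_measurable borel"
  using M_integrable by auto

lemma l_bounds: "0 < h \<Longrightarrow> 0 < l h" "0 < h \<Longrightarrow> l h < 1"
  using c_pos by (auto simp: l_def)

lemma grid: "1 \<le> N \<Longrightarrow> n \<le> N \<Longrightarrow> real n * (T / real N) \<in> {0..T}"
  using T_pos by (auto simp: field_simps)

lemma r_bounded: obtains K where "0 \<le> K" "\<And>t. t \<in> {0..T} \<Longrightarrow> norm (r t) \<le> K"
proof -
  have "bounded (r ` {0..T})"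
    by (intro compact_imp_bounded compact_continuous_image r_continuous) simp
  then obtain K where "\<forall>z\<in>r ` {0..T}. norm z \<le> K" unfolding bounded_iff by blast
  then have K: "norm (r t) \<le> K" if "t \<in> {0..T}" for t using that by blast
  moreover have "0 \<le> K" using K[of 0] T_pos by (intro order_trans[OF norm_ge_zero]) auto
  ultimately show ?thesis by (rule that[rotated])
qed

lemma integrable_division:
  fixes g :: "'a \<Rightarrow> complex"
  assumes "integrable lborel g"
  shows "integrable lborel (\<lambda>v. g v / (1 + \<i> * complex_of_real (x * y v)))"
proof -
  have "integrable lborel (\<lambda>v. g v * (1 / (1 + \<i> * complex_of_real (x * y v))))"
    using norm_divide_one_plus_i_le[of 1] by (intro integrable_mult_bounded assms) (auto simp del: of_real_mult)
  then show ?thesis by simp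
qed

lemma integral_division_le:
  fixes g :: "'a \<Rightarrow> complex"
  assumes g: "integrable lborel g"
  shows "norm (\<integral>v. g v / (1 + \<i> * complex_of_real (x * y v)) \<partial>lborel) \<le> (\<integral>v. norm (g v) \<partial>lborel)"
proof -
  have "norm (\<integral>v. g v / (1 + \<i> * complex_of_real (x * y v)) \<partial>lborel)
      \<le> (\<integral>v. norm (g v / (1 + \<i> * complex_of_real (x * y v))) \<partial>lborel)"
    by (rule integral_norm_bound)
  also have "\<dots> \<le> (\<integral>v. norm (g v) \<partial>lborel)"
    by (intro integral_mono integrable_norm integrable_division g norm_divide_one_plus_i_le)
  finally show ?thesis .
qed

lemma G_integrable: "integrable lborel (G h n)"
proof (induction n)
  case 0
  have "G h 0 = F 0" by (simp add: fun_eq_iff)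
  then show ?case using F_integrable[of 0] T_pos by simp
next
  case (Suc n)
  have "G h (Suc n) = (\<lambda>v. (complex_of_real (1 - l h) * G h n v + complex_of_real (l h) * (r (real (Suc n) * h) * complex_of_real (M v)))
      / (1 + \<i> * complex_of_real (l h * y v)))" by (simp only: fun_eq_iff G.simps(2) simp_thms)
  then show ?case
    by (simp only:) (intro integrable_division Bochner_Integration.integrable_add integrable_mult_right integrable_of_real Suc M_integrable)
qed

text \<open>
  \<open>Re (1 / (1 + i \<lambda> y)) = 1 / (1 + (\<lambda> y)\<^sup>2)\<close> and \<open>\<lambda> < 1\<close>. This bounds the denominator of the scheme away
  from \<open>0\<close> for all steps at once.
\<close>
lemma A_lower_bound: obtains a where "0 < a" "\<And>h. 0 < h \<Longrightarrow> a \<le> Re (A h)"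
proof
  let ?a = "\<integral>v. M v * (1 / (1 + (y v)\<^sup>2)) \<partial>lborel"
  have pos: "0 < 1 + x\<^sup>2" for x :: real by (simp add: add_pos_nonneg)
  have int: "integrable lborel (\<lambda>v. M v * (1 / (1 + (x * y v)\<^sup>2)))" for x
    using pos by (intro integrable_mult_bounded M_integrable) (auto simp: divide_le_eq abs_of_pos)
  have ia: "integrable lborel (\<lambda>v. M v * (1 / (1 + (y v)\<^sup>2)))" using int[of 1] by simp
  have nonneg: "0 \<le> M v * (1 / (1 + (y v)\<^sup>2))" for v using M_pos[of v] pos by (simp add: less_imp_le)
  then have "0 \<le> ?a" by (intro integral_nonneg_AE) simp
  moreover have "?a \<noteq> 0"
  proof
    assume "?a = 0"
    then have "AE v in lborel. M v * (1 / (1 + (y v)\<^sup>2)) = 0"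
      using integral_nonneg_eq_0_iff_AE[OF ia] nonneg by simp
    moreover have "M v * (1 / (1 + (y v)\<^sup>2)) \<noteq> 0" for v using M_pos[of v] pos[of "y v"] by simp
    ultimately have "AE v in (lborel :: 'a measure). False" by simp
    then show False using AE_iff_null[of lborel "\<lambda>v::'a. False"] by (simp add: null_sets_def)
  qed
  ultimately show "0 < ?a" by linarith
  fix h :: real assume h: "0 < h"
  have Re: "Re (complex_of_real m / (1 + \<i> * complex_of_real x)) = m * (1 / (1 + x\<^sup>2))" for m x
    by (simp add: Re_divide power2_eq_square)
  have "?a \<le> (\<integral>v. M v * (1 / (1 + (l h * y v)\<^sup>2)) \<partial>lborel)"
  proof (intro integral_mono ia int mult_left_mono)
    fix v
    have "(l h * y v)\<^sup>2 \<le> (1 * \<bar>y v\<bar>)\<^sup>2"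
      unfolding abs_le_square_iff[symmetric] abs_mult using l_bounds[OF h] by (intro mult_mono) auto
    then show "1 / (1 + (y v)\<^sup>2) \<le> 1 / (1 + (l h * y v)\<^sup>2)"
      using pos by (intro divide_left_mono mult_pos_pos) auto
  qed (use M_pos less_imp_le in auto)
  also have "\<dots> = Re (A h)"
    unfolding A_def using M_integrable
    by (subst integral_Re[symmetric]) (auto intro!: integrable_division integrable_of_real simp only: Re)
  finally show "?a \<le> Re (A h)" .
qed

text \<open>
  Stability. Here \<open>q\<close> is the term that the scheme puts in the place of \<open>1 - A\<close>. Since the new density
  enters \<open>f\<close> with weight \<open>\<lambda> = O(\<Delta>t)\<close>, an error \<open>H + |\<delta>|\<close> of the density made at each step accumulates to
  the same order only.
\<close>
lemma scheme_error:
  fixes q :: "real \<Rightarrow> real" and f :: "real \<Rightarrow> nat \<Rightarrow> 'a \<Rightarrow> complex" and \<rho> :: "real \<Rightarrow> nat \<Rightarrow> complex"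
  assumes q: "\<And>h. 0 < h \<Longrightarrow> 0 \<le> q h"
    and f0: "\<And>h v. f h 0 v = F 0 v" and \<rho>0: "\<And>h. \<rho> h 0 = r 0"
    and \<rho>: "\<And>h n. \<rho> h (Suc n) = (\<integral>v. f h n v / (1 + \<i> * complex_of_real (l h * y v)) \<partial>lborel)
              / (A h + complex_of_real (q h / (1 - l h)))"
    and f: "\<And>h n v. f h (Suc n) v = (complex_of_real (1 - l h) * f h n v + complex_of_real (l h) * (\<rho> h (Suc n) * complex_of_real (M v)))
              / (1 + \<i> * complex_of_real (l h * y v))"
  obtains C where "0 \<le> C"
    "\<And>N n H. 1 \<le> N \<Longrightarrow> n \<le> N \<Longrightarrow>
       (\<And>j. j \<le> N \<Longrightarrow> (\<integral>v. norm (G (T / real N) j v - F (real j * (T / real N)) v) \<partial>lborel) \<le> H) \<Longrightarrow>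
       norm (\<rho> (T / real N) n - r (real n * (T / real N))) \<le> C * (H + norm (1 - A (T / real N) - complex_of_real (q (T / real N)))) \<and>
       integrable lborel (\<lambda>v. f (T / real N) n v - F (real n * (T / real N)) v) \<and>
       (\<integral>v. norm (f (T / real N) n v - F (real n * (T / real N)) v) \<partial>lborel)
          \<le> C * (H + norm (1 - A (T / real N) - complex_of_real (q (T / real N))))"
proof -
  obtain K where K: "0 \<le> K" "\<And>t. t \<in> {0..T} \<Longrightarrow> norm (r t) \<le> K" by (rule r_bounded) blast
  obtain a where a: "0 < a" "\<And>h. 0 < h \<Longrightarrow> a \<le> Re (A h)" by (rule A_lower_bound) blast
  define b where "b = 1 / a"
  have b: "0 < b" using a by (simp add: b_def)
  \<comment> \<open>\<open>b\<close> bounds the inverse of the denominator, \<open>s\<close> the factor \<open>1 / (1 - \<lambda>) = 1 + h / c\<close> together with the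
    density, and \<open>E\<close> the growth \<open>(1 + b \<lambda>) ^ N\<close>.\<close>
  define s where "s = (1 + T / c) * max 1 K"
  define E where "E = exp (b * T / c)"
  define C where "C = (b + 1) * (E + 1) * (s + 1)"
  have s: "0 < s" "0 < E" using T_pos c_pos by (auto simp: s_def E_def intro!: mult_pos_pos add_pos_pos)
  have f_int: "integrable lborel (f h n)" for h n
  proof (induction n)
    case 0
    have "f h 0 = F 0" by (simp add: fun_eq_iff f0)
    then show ?case using F_integrable[of 0] T_pos by simp
  next
    case (Suc n)
    have "f h (Suc n) = (\<lambda>v. (complex_of_real (1 - l h) * f h n v + complex_of_real (l h) * (\<rho> h (Suc n) * complex_of_real (M v)))
        / (1 + \<i> * complex_of_real (l h * y v)))" by (simp add: fun_eq_iff f)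
    then show ?case
      by (simp only:) (intro integrable_division Bochner_Integration.integrable_add integrable_mult_right integrable_of_real Suc M_integrable)
  qed
  show ?thesis
  proof (rule that)
    show "0 \<le> C" using b s by (simp add: C_def)
    fix N n :: nat and H :: real
    assume N: "1 \<le> N" and n: "n \<le> N"
    define h where "h = T / real N"
    assume "\<And>j. j \<le> N \<Longrightarrow> (\<integral>v. norm (G (T / real N) j v - F (real j * (T / real N)) v) \<partial>lborel) \<le> H"
    then have H: "(\<integral>v. norm (G h j v - F (real j * h) v) \<partial>lborel) \<le> H" if "j \<le> N" for j using that by (simp add: h_def)
    have h: "0 < h" and Nh: "real N * h = T" using T_pos N by (auto simp: h_def)
    have hT: "h \<le> T" using N h unfolding Nh[symmetric] by (simp add: mult_le_cancel_right1)
    have tn: "real j * h \<in> {0..T}" if "j \<le> N" for j using grid[OF N that] by (simp add: h_def)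
    note l = l_bounds[OF h]
    define \<delta> where "\<delta> = 1 - A h - complex_of_real (q h)"
    define den where "den = A h + complex_of_real (q h / (1 - l h))"
    have H0: "0 \<le> H" using H[of 0] by (rule order_trans[rotated]) (auto intro: integral_nonneg_AE)
    define B where "B = (H + K * norm \<delta>) / (1 - l h)"
    have B0: "0 \<le> B" using H0 K l by (simp add: B_def)
    have "a \<le> Re den" using a(2)[OF h] q[OF h] l by (simp add: den_def add_increasing2)
    then have "a \<le> norm den" using complex_Re_le_cmod[of den] by linarith
    then have den: "den \<noteq> 0" "1 / norm den \<le> b" using a by (auto simp: b_def frac_le)
    \<comment> \<open>The error is split at \<open>G\<close>. The part \<open>P\<close> sees only the error of the density and vanishes initially.\<close>
    define P where "P = (\<lambda>j v. f h j v - G h j v)"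
    have P_int: "integrable lborel (P j)" for j unfolding P_def using f_int G_integrable by simp
    define p where "p = (\<lambda>j. \<integral>v. norm (P j v) \<partial>lborel)"
    have p0: "0 \<le> p j" for j unfolding p_def by (intro integral_nonneg_AE) auto
    have rho_err: "norm (\<rho> h (Suc j) - r (real (Suc j) * h)) \<le> b * (p j + B)" if j: "j < N" for j
    proof -
      let ?r = "r (real (Suc j) * h)" and ?lc = "complex_of_real (l h)"
      let ?I = "\<lambda>g. \<integral>v. g v / (1 + \<i> * complex_of_real (l h * y v)) \<partial>lborel"
      have t: "real (Suc j) * h \<in> {0..T}" using j by (intro tn) simp
      have lc: "1 - ?lc = complex_of_real (1 - l h)" by simp
      then have l1: "1 - ?lc \<noteq> 0" using l by (simp only: of_real_eq_0_iff)
      define d where "d = (\<integral>v. G h (Suc j) v \<partial>lborel) - ?r"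
      have "d = (\<integral>v. G h (Suc j) v - F (real (Suc j) * h) v \<partial>lborel)"
        unfolding d_def density[OF t, symmetric]
        by (rule Bochner_Integration.integral_diff[OF G_integrable F_integrable[OF t], symmetric])
      then have "norm d \<le> (\<integral>v. norm (G h (Suc j) v - F (real (Suc j) * h) v) \<partial>lborel)"
        by (simp only: integral_norm_bound)
      also have "\<dots> \<le> H" using j by (intro H) simp
      finally have d: "norm d \<le> H" .
      have "(\<integral>v. G h (Suc j) v \<partial>lborel) =
         (\<integral>v. (1 - ?lc) * (G h j v / (1 + \<i> * complex_of_real (l h * y v)))
              + ?lc * ?r * (complex_of_real (M v) / (1 + \<i> * complex_of_real (l h * y v))) \<partial>lborel)"
        by (intro Bochner_Integration.integral_cong) (auto simp: add_divide_distrib G.simps(2))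
      also have "\<dots> = (1 - ?lc) * ?I (G h j) + ?lc * ?r * A h"
        unfolding A_def
        by (simp only: Bochner_Integration.integral_add integral_mult_right_zero integrable_mult_right
            integrable_division[OF G_integrable] integrable_division[OF integrable_of_real[OF M_integrable]])
      finally have G': "(1 - ?lc) * ?I (G h j) = ?r + d - ?lc * ?r * A h" by (simp add: d_def)
      have "\<rho> h (Suc j) * den = ?I (f h j)" unfolding \<rho> den_def[symmetric] using den by simp
      also have "\<dots> = ?I (\<lambda>v. P j v + G h j v)" by (simp add: P_def)
      also have "\<dots> = ?I (P j) + ?I (G h j)"
        unfolding add_divide_distrib using P_int G_integrable
        by (intro Bochner_Integration.integral_add integrable_division)
      finally have "(\<rho> h (Suc j) - ?r) * den = ?I (P j) + (?I (G h j) - ?r * den)" by (simp add: algebra_simps)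
      moreover have "?I (G h j) - ?r * den = (?r * \<delta> + d) / (1 - ?lc)"
        using density_defect_identity[OF l1 refl G', of "complex_of_real (q h)"]
        by (simp only: den_def \<delta>_def of_real_divide of_real_diff of_real_1)
      ultimately have "(\<rho> h (Suc j) - ?r) * den = ?I (P j) + (?r * \<delta> + d) / (1 - ?lc)" by simp
      then have "norm (\<rho> h (Suc j) - ?r) * norm den \<le> norm (?I (P j)) + norm ((?r * \<delta> + d) / (1 - ?lc))"
        unfolding norm_mult[symmetric] by (simp only: norm_triangle_ineq)
      also have "\<dots> \<le> p j + B"
      proof (intro add_mono)
        show "norm (?I (P j)) \<le> p j" unfolding p_def by (rule integral_division_le[OF P_int])
        have "norm (?r * \<delta> + d) \<le> K * norm \<delta> + H"
          using K(2)[OF t] d by (intro norm_triangle_le add_mono) (auto simp: norm_mult mult_right_mono)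
        moreover have "norm (1 - ?lc) = 1 - l h"
          using l unfolding lc norm_of_real by simp
        ultimately show "norm ((?r * \<delta> + d) / (1 - ?lc)) \<le> B"
          using l unfolding norm_divide B_def by (simp add: divide_right_mono add.commute)
      qed
      finally have "norm (\<rho> h (Suc j) - ?r) \<le> (1 / norm den) * (p j + B)"
        using den(1) by (simp only: pos_le_divide_eq zero_less_norm_iff times_divide_eq_left mult_1_left simp_thms)
      also have "\<dots> \<le> b * (p j + B)" using den(2) p0 B0 by (intro mult_right_mono) auto
      finally show ?thesis .
    qed
    have p_step: "p (Suc j) \<le> p j + (b * l h) * (p j + B)" if j: "j < N" for j
    proof -
      let ?z = "\<rho> h (Suc j) - r (real (Suc j) * h)"
      have "norm (P (Suc j) v) \<le> norm (P j v) + l h * norm ?z * M v" for v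
      proof -
        have "P (Suc j) v = (complex_of_real (1 - l h) * P j v + complex_of_real (l h) * (?z * complex_of_real (M v)))
              / (1 + \<i> * complex_of_real (l h * y v))"
          by (simp add: P_def f G.simps(2) diff_divide_distrib[symmetric] algebra_simps)
        then have "norm (P (Suc j) v) \<le> norm (complex_of_real (1 - l h) * P j v + complex_of_real (l h) * (?z * complex_of_real (M v)))"
          using norm_divide_one_plus_i_le by metis
        also have "\<dots> \<le> norm (complex_of_real (1 - l h) * P j v) + norm (complex_of_real (l h) * (?z * complex_of_real (M v)))"
          by (rule norm_triangle_ineq)
        also have "\<dots> = (1 - l h) * norm (P j v) + l h * norm ?z * M v"
          using l M_pos[of v] by (simp only: norm_mult norm_of_real abs_of_pos diff_gt_0_iff_gt mult.assoc)
        also have "\<dots> \<le> norm (P j v) + l h * norm ?z * M v"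
          using l by (simp add: mult_left_le_one_le)
        finally show ?thesis .
      qed
      then have "p (Suc j) \<le> (\<integral>v. norm (P j v) + l h * norm ?z * M v \<partial>lborel)"
        unfolding p_def using P_int M_integrable
        by (intro integral_mono Bochner_Integration.integrable_add integrable_norm integrable_mult_right) auto
      also have "\<dots> = p j + l h * norm ?z"
        unfolding p_def using P_int M_integrable by (subst Bochner_Integration.integral_add) (auto simp: M_mass)
      also have "\<dots> \<le> p j + l h * (b * (p j + B))"
        using rho_err[OF j] l by (intro add_left_mono mult_left_mono) auto
      finally show ?thesis by (simp add: mult_ac)
    qed
    have growth: "p j + B \<le> E * B" if "j \<le> N" for j
    proof -
      have "p 0 = 0" by (simp add: p_def P_def f0)
      then have "p j + B \<le> (1 + b * l h) ^ j * B"
        using geometric_growth_bound[of p "b * l h" B N j] p_step b l B0 that by simp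
      also have "(1 + b * l h) ^ j \<le> (1 + b * l h) ^ N" using that b l by (intro power_increasing) auto
      also have "(1 + b * l h) ^ N \<le> (exp (b * l h)) ^ N"
        using b l by (intro power_mono) (auto simp: exp_ge_add_one_self)
      also have "\<dots> = exp (real N * (b * l h))" by (simp add: exp_of_nat_mult)
      also have "\<dots> \<le> E"
      proof -
        have "l h \<le> h / c" using h c_pos by (simp add: l_def frac_le)
        then have "real N * (b * l h) \<le> real N * (b * (h / c))" using b by (intro mult_left_mono) auto
        also have "\<dots> = b * T / c" using Nh by (metis mult.assoc mult.commute times_divide_eq_right)
        finally show ?thesis by (simp add: E_def)
      qed
      finally show ?thesis using B0 by (simp add: mult_right_mono)
    qed
    have Bs: "B \<le> s * (H + norm \<delta>)"
    proof -
      have "1 / (1 - l h) = 1 + h / c" using h c_pos by (simp add: l_def field_simps)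
      also have "\<dots> \<le> 1 + T / c" using hT c_pos by (simp add: divide_right_mono)
      finally have i: "1 / (1 - l h) \<le> 1 + T / c" .
      have "H + K * norm \<delta> \<le> max 1 K * (H + norm \<delta>)"
        unfolding distrib_left using H0 by (intro add_mono mult_right_mono) (auto simp: mult_le_cancel_right1)
      then have "(H + K * norm \<delta>) * (1 / (1 - l h)) \<le> (max 1 K * (H + norm \<delta>)) * (1 + T / c)"
        using i H0 K l by (intro mult_mono) auto
      then show ?thesis by (simp add: B_def s_def mult_ac)
    qed
    have H\<delta>: "0 \<le> H + norm \<delta>" using H0 by simp
    have EB: "E * B \<le> E * (s * (H + norm \<delta>))" using Bs s by (intro mult_left_mono) auto
    have "norm (\<rho> h n - r (real n * h)) \<le> b * (E * (s * (H + norm \<delta>)))"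
    proof (cases n)
      case 0
      then show ?thesis using b s H\<delta> by (simp add: \<rho>0)
    next
      case (Suc j)
      have "norm (\<rho> h n - r (real n * h)) \<le> b * (p j + B)" using rho_err[of j] Suc n by simp
      also have "\<dots> \<le> b * (E * (s * (H + norm \<delta>)))"
        using growth[of j] Suc n EB b by (intro mult_left_mono) auto
      finally show ?thesis .
    qed
    also have "\<dots> = (b * E * s) * (H + norm \<delta>)" by (simp add: mult_ac)
    also have "\<dots> \<le> C * (H + norm \<delta>)"
      unfolding C_def using b s H\<delta> by (intro mult_right_mono mult_mono) auto
    finally have 1: "norm (\<rho> h n - r (real n * h)) \<le> C * (H + norm \<delta>)" .
    have Fn: "integrable lborel (F (real n * h))" by (rule F_integrable[OF tn[OF n]])
    then have 2: "integrable lborel (\<lambda>v. f h n v - F (real n * h) v)" using f_int by simp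
    have "(\<integral>v. norm (f h n v - F (real n * h) v) \<partial>lborel) \<le> (\<integral>v. norm (P n v) + norm (G h n v - F (real n * h) v) \<partial>lborel)"
    proof (rule integral_mono)
      show "norm (f h n v - F (real n * h) v) \<le> norm (P n v) + norm (G h n v - F (real n * h) v)" for v
        using norm_triangle_ineq[of "P n v" "G h n v - F (real n * h) v"] by (simp add: P_def)
    qed (use 2 P_int G_integrable Fn in auto)
    also have "\<dots> = p n + (\<integral>v. norm (G h n v - F (real n * h) v) \<partial>lborel)"
      unfolding p_def using P_int G_integrable Fn by (intro Bochner_Integration.integral_add) auto
    also have "\<dots> \<le> E * (s * (H + norm \<delta>)) + (H + norm \<delta>)"
      using growth[OF n] EB B0 H[OF n] norm_ge_zero[of \<delta>] by linarith
    also have "\<dots> = (E * s + 1) * (H + norm \<delta>)" by (simp add: algebra_simps)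
    also have "\<dots> \<le> C * (H + norm \<delta>)"
    proof (intro mult_right_mono H\<delta>)
      have "E * s + 1 \<le> 1 * ((E + 1) * (s + 1))" using s by (simp add: algebra_simps)
      also have "\<dots> \<le> (b + 1) * ((E + 1) * (s + 1))" using b s by (intro mult_right_mono) auto
      finally show "E * s + 1 \<le> C" by (simp add: C_def mult.assoc)
    qed
    finally have 3: "(\<integral>v. norm (f h n v - F (real n * h) v) \<partial>lborel) \<le> C * (H + norm \<delta>)" .
    show "norm (\<rho> (T / real N) n - r (real n * (T / real N))) \<le> C * (H + norm (1 - A (T / real N) - complex_of_real (q (T / real N)))) \<and>
       integrable lborel (\<lambda>v. f (T / real N) n v - F (real n * (T / real N)) v) \<and>
       (\<integral>v. norm (f (T / real N) n v - F (real n * (T / real N)) v) \<partial>lborel)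
          \<le> C * (H + norm (1 - A (T / real N) - complex_of_real (q (T / real N))))"
      using 1 2 3 by (simp add: h_def \<delta>_def)
  qed
qed

lemma exact_density_error_pointwise:
  assumes N: "1 \<le> N" and n: "n \<le> N"
  shows "norm (G (T / real N) n v - F (real n * (T / real N)) v) \<le> (\<Sum>j<N. norm (truncation N j v))"
proof -
  define h where "h = T / real N"
  have h: "0 < h" using T_pos N by (simp add: h_def)
  have "norm (G h n v - F (real n * h) v) \<le> (\<Sum>j<n. norm (truncation N j v))"
  proof (rule perturbed_contraction_error[where N = N and l = "l h" and x = "l h * y v"
        and G = "\<lambda>n. G h n v" and F = "\<lambda>n. F (real n * h) v" and R = "\<lambda>n. r (real (Suc n) * h) * complex_of_real (M v)"])
    show "F (real (Suc j) * h) v = (complex_of_real (1 - l h) * (F (real j * h) v + truncation N j v) +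
           complex_of_real (l h) * (r (real (Suc j) * h) * complex_of_real (M v))) / (1 + \<i> * complex_of_real (l h * y v))" for j
      using implicit_euler_truncation[OF c_pos h, of "F (real (Suc j) * h) v" "F (real j * h) v"
          "r (real (Suc j) * h) * complex_of_real (M v)" "y v"]
      by (simp only: truncation_def D_def l_def h_def[symmetric])
  qed (use l_bounds[OF h] n in \<open>auto simp: G.simps(2)\<close>)
  also have "\<dots> \<le> (\<Sum>j<N. norm (truncation N j v))" using n by (intro sum_mono2) auto
  finally show ?thesis by (simp add: h_def)
qed

lemma truncation_measurable:
  assumes "1 \<le> N" "j < N"
  shows "truncation N j \<in> borel_measurable borel"
proof -
  have "F (real (Suc j) * (T / real N)) \<in> borel_measurable borel" "F (real j * (T / real N)) \<in> borel_measurable borel"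
    using borel_measurable_integrable[OF F_integrable[OF grid[of N "Suc j"]]]
      borel_measurable_integrable[OF F_integrable[OF grid[of N j]]] assms by simp_all
  then show ?thesis unfolding truncation_def[abs_def] D_def by measurable
qed

lemma truncation_tendsto_0: "(\<lambda>N. \<Sum>j<N. norm (truncation N j v)) \<longlonglongrightarrow> 0"
  unfolding truncation_def
proof (rule summed_truncation_tendsto_0[OF T_pos])
  show "((\<lambda>s. F s v) has_vector_derivative D t v) (at t within {0..T})" if "t \<in> {0..T}" for t
    using ode[OF that] by (simp add: D_def)
  have "continuous_on {0..T} (\<lambda>s. F s v)" by (rule continuous_on_vector_derivative[OF ode])
  then show "continuous_on {0..T} (\<lambda>t. D t v)"
    unfolding D_def using r_continuous c_pos by (intro continuous_intros) auto
qed

text \<open>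
  The sum of the truncation errors tends to \<open>0\<close> at each velocity but need not have an integrable majorant; the
  error itself has one, namely \<open>2 (|F 0| + K M)\<close>. The minimum of both is used.
\<close>
lemma exact_density_error_tendsto_0:
  obtains H where "H \<longlonglongrightarrow> 0"
    "\<And>N n. 1 \<le> N \<Longrightarrow> n \<le> N \<Longrightarrow> (\<integral>v. norm (G (T / real N) n v - F (real n * (T / real N)) v) \<partial>lborel) \<le> H N"
proof -
  obtain K where K: "0 \<le> K" "\<And>t. t \<in> {0..T} \<Longrightarrow> norm (r t) \<le> K" by (rule r_bounded) blast
  define B where "B = (\<lambda>v. norm (F 0 v) + K * M v)"
  have B0: "0 \<le> B v" for v using K M_pos[of v] by (simp add: B_def)
  have F0: "integrable lborel (F 0)" using T_pos by (intro F_integrable) auto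
  have B: "integrable lborel B" unfolding B_def using F0 M_integrable by auto
  have F_le: "norm (F t v) \<le> B v" if t: "t \<in> {0..T}" for t v
    unfolding B_def
  proof (rule relaxation_bound[OF c_pos, where g = "\<lambda>s. r s * complex_of_real (M v)" and y = "y v"])
    show "0 \<le> t" using t by simp
    fix s assume s: "s \<in> {0..t}"
    then have s': "s \<in> {0..T}" using t by auto
    have "{0..t} \<subseteq> {0..T}" using t by auto
    with ode[OF s'] show "((\<lambda>s. F s v) has_vector_derivative
      (r s * complex_of_real (M v) - (1 + \<i> * complex_of_real (y v)) * F s v) / complex_of_real c) (at s within {0..t})"
      by (rule has_vector_derivative_within_subset)
    show "norm (r s * complex_of_real (M v)) \<le> K * M v"
      using K(2)[OF s'] M_pos[of v] by (simp add: norm_mult mult_right_mono)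
  qed
  have G_le: "norm (G (T / real N) n v) \<le> B v" if N: "1 \<le> N" and "n \<le> N" for N n v
    using \<open>n \<le> N\<close>
  proof (induction n)
    case 0
    then show ?case using K M_pos[of v] by (simp add: B_def)
  next
    case (Suc n)
    define h where "h = T / real N"
    have h: "0 < h" using T_pos N by (simp add: h_def)
    have "norm (r (real (Suc n) * h)) \<le> K" using K(2) grid[OF N Suc.prems] by (simp add: h_def)
    then have "norm (r (real (Suc n) * h) * complex_of_real (M v)) \<le> K * M v"
      using M_pos[of v] by (simp add: norm_mult mult_right_mono)
    then have r: "norm (r (real (Suc n) * h) * complex_of_real (M v)) \<le> B v" unfolding B_def by (simp add: add_increasing)
    have "norm (G h (Suc n) v) \<le> norm (complex_of_real (1 - l h) * G h n v + complex_of_real (l h) * (r (real (Suc n) * h) * complex_of_real (M v)))"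
      unfolding G.simps by (rule norm_divide_one_plus_i_le)
    also have "\<dots> \<le> (1 - l h) * norm (G h n v) + l h * norm (r (real (Suc n) * h) * complex_of_real (M v))"
    proof -
      have "norm (complex_of_real (1 - l h) * x + complex_of_real (l h) * z) \<le> (1 - l h) * norm x + l h * norm z" for x z
        using norm_triangle_ineq[of "complex_of_real (1 - l h) * x" "complex_of_real (l h) * z"] l_bounds[OF h]
        by (simp only: norm_mult norm_of_real abs_of_pos diff_gt_0_iff_gt)
      then show ?thesis .
    qed
    also have "\<dots> \<le> (1 - l h) * B v + l h * B v"
      using Suc r l_bounds[OF h] by (intro add_mono mult_left_mono) (auto simp: h_def)
    finally show ?case by (simp add: h_def algebra_simps)
  qed
  \<comment> \<open>The sum tends to \<open>0\<close> pointwise and \<open>2 B\<close> is integrable. Below, \<open>N\<close> is shifted to \<open>Suc N\<close> because the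
    time grid needs a step.\<close>
  define m where "m = (\<lambda>N v. min (\<Sum>j<N. norm (truncation N j v)) (2 * B v))"
  have [measurable]: "B \<in> borel_measurable borel" using B by auto
  have m_meas: "m (Suc N) \<in> borel_measurable borel" for N
    unfolding m_def using truncation_measurable[of "Suc N"]
    by (intro borel_measurable_min borel_measurable_sum borel_measurable_norm) auto
  have m_bound: "norm (m N v) \<le> 2 * B v" for N v
    using B0[of v] by (auto simp: m_def min_def sum_nonneg)
  have m_int: "integrable lborel (m (Suc N))" for N
    by (rule Bochner_Integration.integrable_bound[where f = "\<lambda>v. 2 * B v"]) (use B m_meas m_bound B0 in auto)
  show ?thesis
  proof (rule that)
    have "(\<lambda>N. \<integral>v. m (Suc N) v \<partial>lborel) \<longlonglongrightarrow> (\<integral>v. 0 \<partial>(lborel :: 'a measure))"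
    proof (rule integral_dominated_convergence[where w = "\<lambda>v. 2 * B v"])
      show "AE v in lborel. (\<lambda>N. m (Suc N) v) \<longlonglongrightarrow> 0"
      proof (rule AE_I2)
        fix v
        have "(\<lambda>N. \<Sum>j<Suc N. norm (truncation (Suc N) j v)) \<longlonglongrightarrow> 0"
          using truncation_tendsto_0 by (rule LIMSEQ_Suc)
        moreover have "0 \<le> m (Suc N) v" "m (Suc N) v \<le> (\<Sum>j<Suc N. norm (truncation (Suc N) j v))" for N
          unfolding m_def using B0[of v] by (auto intro!: sum_nonneg simp del: sum.lessThan_Suc)
        ultimately show "(\<lambda>N. m (Suc N) v) \<longlonglongrightarrow> 0"
          by (intro tendsto_sandwich[of "\<lambda>_. 0" "\<lambda>N. m (Suc N) v" sequentially
              "\<lambda>N. \<Sum>j<Suc N. norm (truncation (Suc N) j v)" 0] always_eventually allI tendsto_const)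
      qed
    qed (use m_meas m_bound B in auto)
    then show "(\<lambda>N. \<integral>v. m N v \<partial>lborel) \<longlonglongrightarrow> 0"
      using LIMSEQ_imp_Suc[of "\<lambda>N. \<integral>v. m N v \<partial>lborel" 0] by (simp only: Bochner_Integration.integral_zero)
    fix N n :: nat assume N: "1 \<le> N" "n \<le> N"
    then obtain N' where N': "N = Suc N'" by (cases N) auto
    show "(\<integral>v. norm (G (T / real N) n v - F (real n * (T / real N)) v) \<partial>lborel) \<le> (\<integral>v. m N v \<partial>lborel)"
    proof (rule integral_mono)
      show "integrable lborel (\<lambda>v. norm (G (T / real N) n v - F (real n * (T / real N)) v))"
        using G_integrable F_integrable[OF grid[OF N]] by auto
      show "integrable lborel (m N)" using m_int N' by simp
      fix v
      have "norm (G (T / real N) n v - F (real n * (T / real N)) v) \<le> 2 * B v"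
        using norm_triangle_ineq4[of "G (T / real N) n v" "F (real n * (T / real N)) v"] G_le[OF N, of v] F_le[OF grid[OF N], of v] by linarith
      then show "norm (G (T / real N) n v - F (real n * (T / real N)) v) \<le> m N v"
        using exact_density_error_pointwise[OF N] by (simp add: m_def)
    qed
  qed
qed

lemma exact_density_error_linear:
  assumes \<Theta> [measurable]: "\<Theta> \<in> borel_measurable borel" and fin: "(\<integral>\<^sup>+v. \<Theta> v \<partial>lborel) < \<infinity>"
    and trunc: "\<And>N v. 1 \<le> N \<Longrightarrow> ennreal (\<Sum>j<N. norm (truncation N j v)) \<le> ennreal (T / real N) * \<Theta> v"
  obtains C where "0 \<le> C"
    "\<And>N n. 1 \<le> N \<Longrightarrow> n \<le> N \<Longrightarrow> (\<integral>v. norm (G (T / real N) n v - F (real n * (T / real N)) v) \<partial>lborel) \<le> C * (T / real N)"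
proof
  show "0 \<le> enn2real (\<integral>\<^sup>+v. \<Theta> v \<partial>lborel)" by simp
  fix N n :: nat assume N: "1 \<le> N" "n \<le> N"
  have int: "integrable lborel (\<lambda>v. norm (G (T / real N) n v - F (real n * (T / real N)) v))"
    using G_integrable F_integrable[OF grid[OF N]] by auto
  have h: "0 \<le> T / real N" using T_pos by simp
  have "ennreal (\<integral>v. norm (G (T / real N) n v - F (real n * (T / real N)) v) \<partial>lborel)
     = (\<integral>\<^sup>+v. ennreal (norm (G (T / real N) n v - F (real n * (T / real N)) v)) \<partial>lborel)"
    using int by (intro nn_integral_eq_integral[symmetric]) auto
  also have "\<dots> \<le> (\<integral>\<^sup>+v. ennreal (T / real N) * \<Theta> v \<partial>lborel)"
    by (intro nn_integral_mono order_trans[OF ennreal_leI[OF exact_density_error_pointwise[OF N]] trunc[OF N(1)]])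
  also have "\<dots> = ennreal (T / real N) * ennreal (enn2real (\<integral>\<^sup>+v. \<Theta> v \<partial>lborel))"
    using fin by (simp add: nn_integral_cmult)
  also have "\<dots> = ennreal (enn2real (\<integral>\<^sup>+v. \<Theta> v \<partial>lborel) * (T / real N))"
    using h by (simp add: ennreal_mult[symmetric] mult.commute)
  finally show "(\<integral>v. norm (G (T / real N) n v - F (real n * (T / real N)) v) \<partial>lborel)
      \<le> enn2real (\<integral>\<^sup>+v. \<Theta> v \<partial>lborel) * (T / real N)"
    using mult_nonneg_nonneg[OF enn2real_nonneg h] by (simp only: ennreal_le_iff)
qed

end

context relaxation_mode
begin

lemma l_tendsto_0: "(l \<longlongrightarrow> 0) (at_right 0)"
proof -
  have "((\<lambda>h. h / (c + h)) \<longlongrightarrow> 0 / (c + 0)) (at_right 0)"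
    by (intro tendsto_intros) (use c_pos in auto)
  then show ?thesis by (simp add: l_def[abs_def])
qed

lemma division_integral_tendsto:
  assumes "integrable lborel g"
  shows "((\<lambda>h. \<integral>v. g v / (1 + \<i> * complex_of_real (l h * y v)) \<partial>lborel) \<longlongrightarrow> (\<integral>v. g v \<partial>lborel)) (at_right 0)"
  using resolvent_integral_tendsto[OF assms y_measurable l_tendsto_0, of 1] by simp

lemma A_tendsto_1: "(A \<longlongrightarrow> 1) (at_right 0)"
  unfolding A_def[abs_def]
  using division_integral_tendsto[of "\<lambda>v. complex_of_real (M v)"] M_integrable
  by (simp add: M_mass integral_complex_of_real)

lemma time_shift_tendsto:
  fixes u :: "real \<Rightarrow> complex"
  assumes t: "t \<in> {0..<T}" and lim: "(u \<longlongrightarrow> L) (at t within {0..T})"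
  shows "((\<lambda>h. u (t + h)) \<longlongrightarrow> L) (at_right 0)"
proof (rule filterlim_compose[OF lim])
  have "eventually (\<lambda>h. h \<in> {0<..<T - t}) (at_right 0)"
    using t by (intro eventually_at_right_real) auto
  then have "eventually (\<lambda>h. t + h \<in> {0..T} \<and> t + h \<noteq> t) (at_right 0)"
    using t by (auto elim!: eventually_mono)
  moreover have "((\<lambda>h. t + h) \<longlongrightarrow> t + 0) (at_right 0)" by (intro tendsto_intros)
  ultimately show "filterlim ((+) t) (at t within {0..T}) (at_right 0)"
    by (auto simp: filterlim_at elim: eventually_mono)
qed

text \<open>
  \<open>\<lambda> / h\<close> tends to \<open>1 / c\<close>, which turns the increment of one step into the right-hand side of the equation.
\<close>
lemma one_step_consistency:
  fixes q :: "real \<Rightarrow> real" and t :: real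
  assumes q: "(q \<longlongrightarrow> 0) (at_right 0)" and t: "t \<in> {0..<T}"
  defines "\<rho> \<equiv> \<lambda>h. (\<integral>v. F t v / (1 + \<i> * complex_of_real (l h * y v)) \<partial>lborel) / (A h + complex_of_real (q h / (1 - l h)))"
  shows "((\<lambda>h. \<rho> h - r (t + h)) \<longlongrightarrow> 0) (at_right 0)"
    and "((\<lambda>h. ((complex_of_real (1 - l h) * F t v + complex_of_real (l h) * (\<rho> h * complex_of_real (M v)))
            / (1 + \<i> * complex_of_real (l h * y v)) - F (t + h) v) / complex_of_real h) \<longlongrightarrow> 0) (at_right 0)"
proof -
  have t': "t \<in> {0..T}" using t by auto
  have "((\<lambda>h. complex_of_real (q h / (1 - l h))) \<longlongrightarrow> complex_of_real (0 / (1 - 0))) (at_right 0)"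
    by (intro tendsto_intros q l_tendsto_0) auto
  from tendsto_add[OF A_tendsto_1 this]
  have "((\<lambda>h. A h + complex_of_real (q h / (1 - l h))) \<longlongrightarrow> 1) (at_right 0)" by simp
  from tendsto_divide[OF division_integral_tendsto[OF F_integrable[OF t']] this]
  have \<rho>: "(\<rho> \<longlongrightarrow> r t) (at_right 0)" unfolding \<rho>_def density[OF t'] by simp
  have "(r \<longlongrightarrow> r t) (at t within {0..T})" using r_continuous t' by (simp add: continuous_on_def)
  from tendsto_diff[OF \<rho> time_shift_tendsto[OF t this]]
  show "((\<lambda>h. \<rho> h - r (t + h)) \<longlongrightarrow> 0) (at_right 0)" by simp
  let ?w = "\<lambda>h. 1 + \<i> * complex_of_real (l h * y v)"
  let ?z = "\<lambda>h. \<rho> h * complex_of_real (M v) - (1 + \<i> * complex_of_real (y v)) * F t v"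
  have lim1: "((\<lambda>h. complex_of_real (1 / (c + h)) * (?z h / ?w h)) \<longlongrightarrow>
      complex_of_real (1 / (c + 0)) * ((r t * complex_of_real (M v) - (1 + \<i> * complex_of_real (y v)) * F t v)
          / (1 + \<i> * complex_of_real (0 * y v)))) (at_right 0)"
    by (intro tendsto_intros \<rho> l_tendsto_0) (use c_pos in auto)
  have "((\<lambda>s. (F s v - F t v) / complex_of_real (s - t)) \<longlongrightarrow> D t v) (at t within {0..T})"
  proof -
    have "((\<lambda>s. norm ((F s v - F t v) - (s - t) *\<^sub>R D t v) / norm (s - t)) \<longlongrightarrow> 0) (at t within {0..T})"
      using ode[OF t', of v] unfolding D_def[symmetric] has_vector_derivative_def has_derivative_iff_norm by blast
    then have "((\<lambda>s. norm ((F s v - F t v) / complex_of_real (s - t) - D t v)) \<longlongrightarrow> 0) (at t within {0..T})"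
    proof (rule Lim_transform_eventually)
      have "norm ((F s v - F t v) - (s - t) *\<^sub>R D t v) / norm (s - t) = norm ((F s v - F t v) / complex_of_real (s - t) - D t v)"
        if "s \<noteq> t" for s
      proof -
        have "complex_of_real (s - t) \<noteq> 0" using that by (simp del: of_real_diff)
        then have "(F s v - F t v) / complex_of_real (s - t) - D t v
            = ((F s v - F t v) - complex_of_real (s - t) * D t v) / complex_of_real (s - t)"
          by (simp add: diff_divide_distrib)
        then show ?thesis by (simp only: norm_divide norm_of_real scaleR_conv_of_real real_norm_def)
      qed
      then show "\<forall>\<^sub>F s in at t within {0..T}. norm ((F s v - F t v) - (s - t) *\<^sub>R D t v) / norm (s - t)
          = norm ((F s v - F t v) / complex_of_real (s - t) - D t v)"
        by (simp add: eventually_at_filter)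
    qed
    then show ?thesis by (simp only: tendsto_norm_zero_iff LIM_zero_iff)
  qed
  from time_shift_tendsto[OF t this]
  have lim2: "((\<lambda>h. (F (t + h) v - F t v) / complex_of_real h) \<longlongrightarrow> D t v) (at_right 0)" by simp
  have "((\<lambda>h. complex_of_real (1 / (c + h)) * (?z h / ?w h) - (F (t + h) v - F t v) / complex_of_real h) \<longlongrightarrow> 0) (at_right 0)"
    using tendsto_diff[OF lim1 lim2] by (simp add: D_def)
  then show "((\<lambda>h. ((complex_of_real (1 - l h) * F t v + complex_of_real (l h) * (\<rho> h * complex_of_real (M v)))
            / ?w h - F (t + h) v) / complex_of_real h) \<longlongrightarrow> 0) (at_right 0)"
  proof (rule Lim_transform_eventually)
    have "eventually (\<lambda>h::real. 0 < h) (at_right 0)" by (simp add: eventually_at_right_less)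
    then show "\<forall>\<^sub>F h in at_right 0. complex_of_real (1 / (c + h)) * (?z h / ?w h) - (F (t + h) v - F t v) / complex_of_real h
       = ((complex_of_real (1 - l h) * F t v + complex_of_real (l h) * (\<rho> h * complex_of_real (M v))) / ?w h - F (t + h) v) / complex_of_real h"
    proof eventually_elim
      case (elim h)
      have w: "?w h \<noteq> 0" by (rule one_plus_i_neq_0)
      have "complex_of_real (1 / (c + h)) = complex_of_real (l h) / complex_of_real h"
        using elim by (simp add: l_def)
      moreover have "(complex_of_real (1 - l h) * F t v + complex_of_real (l h) * (\<rho> h * complex_of_real (M v))) / ?w h - F t v
          = complex_of_real (l h) * (?z h / ?w h)"
        using resolvent_increment[OF w[unfolded of_real_mult], of "F t v" "\<rho> h * complex_of_real (M v)"] by simp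
      moreover have "p * Z - (u' - u) / x = (X - u') / x" if "p = L / x" "X - u = L * Z" for p L x X Z u u' :: complex
      proof -
        have "X = L * Z + u" using that(2) by (simp add: diff_eq_eq)
        then show ?thesis by (simp add: that(1) diff_divide_distrib add_divide_distrib)
      qed
      ultimately show ?case by blast
    qed
  qed
qed

end

section \<open>Fourier transform of periodic functions\<close>

lemma cis_measurable [measurable]: "cis \<in> borel_measurable borel"
  by (intro borel_measurable_continuous_onI continuous_intros)

lemma integral_cbox_split_at:
  fixes g :: "real ^ 'd \<Rightarrow> 'b::banach"
  assumes g: "continuous_on UNIV g" and s: "a $ i \<le> s" "s \<le> b $ i"
  shows "integral (cbox a b) g = integral (cbox a (\<chi> j. if j = i then s else b $ j)) g
       + integral (cbox (\<chi> j. if j = i then s else a $ j) b) g"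
proof -
  have box: "x \<in> cbox p q \<longleftrightarrow> (\<forall>j. j \<noteq> i \<longrightarrow> p $ j \<le> x $ j \<and> x $ j \<le> q $ j) \<and> p $ i \<le> x $ i \<and> x $ i \<le> q $ i"
    for x p q :: "real ^ 'd"
    unfolding mem_box_cart by metis
  have "cbox a b \<inter> {x. x \<bullet> axis i 1 \<le> s} = cbox a (\<chi> j. if j = i then s else b $ j)"
    using s by (auto simp: box inner_axis)
  moreover have "cbox a b \<inter> {x. s \<le> x \<bullet> axis i 1} = cbox (\<chi> j. if j = i then s else a $ j) b"
    using s by (auto simp: box inner_axis)
  moreover have "g integrable_on cbox a b"
    using g continuous_on_subset integrable_continuous subset_UNIV by metis
  moreover have "axis i (1::real) \<in> Basis" by (auto simp: Basis_vec_def)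
  ultimately show ?thesis using integral_split[of g a b "axis i 1" s] by simp
qed

text \<open>
  Cutting the union of the box and its translate in two ways leaves two slabs of width \<open>h\<close>, at the two ends
  of the period; they are translates of each other by one period.
\<close>
lemma integral_periodic_shift:
  fixes g :: "real ^ 'd \<Rightarrow> 'b::banach"
  assumes g: "continuous_on UNIV g" and periodic: "\<And>x. g (x + axis i (b $ i - a $ i)) = g x"
    and h: "0 \<le> h" "h \<le> b $ i - a $ i" 
  shows "integral (cbox a b) (\<lambda>x. g (x + axis i h)) = integral (cbox a b) g"
proof -
  define c where "c = axis i h"
  define L where "L = axis i (b $ i - a $ i)"
  have shift: "integral (cbox p q) (\<lambda>x. g (x + z)) = integral (cbox (p + z) (q + z)) g" for p q z
    using integral_shift_cbox[of "p + z" z "q + z" g] by simp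
  let ?S = "cbox a (\<chi> j. if j = i then a $ i + h else b $ j)"
  have "integral (cbox a (b + c)) g = integral (cbox a b) g + integral (cbox (\<chi> j. if j = i then b $ i else a $ j) (b + c)) g"
  proof -
    have "(\<chi> j. if j = i then b $ i else (b + c) $ j) = b" by (simp add: vec_eq_iff c_def axis_def)
    then show ?thesis using integral_cbox_split_at[OF g, of a i "b $ i" "b + c"] h by (simp add: c_def axis_def)
  qed
  moreover have "integral (cbox a (b + c)) g = integral ?S g + integral (cbox (a + c) (b + c)) g"
  proof -
    have "(\<chi> j. if j = i then a $ i + h else a $ j) = a + c"
      "(\<chi> j. if j = i then a $ i + h else (b + c) $ j) = (\<chi> j. if j = i then a $ i + h else b $ j)"
      by (simp_all add: vec_eq_iff c_def axis_def)
    then show ?thesis using integral_cbox_split_at[OF g, of a i "a $ i + h" "b + c"] h by (simp add: c_def axis_def)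
  qed
  moreover have "integral (cbox (\<chi> j. if j = i then b $ i else a $ j) (b + c)) g = integral ?S g"
  proof -
    have "(\<chi> j. if j = i then b $ i else a $ j) = a + L"
      "b + c = (\<chi> j. if j = i then a $ i + h else b $ j) + L"
      by (simp_all add: vec_eq_iff c_def L_def axis_def)
    then show ?thesis
      using shift[of a "\<chi> j. if j = i then a $ i + h else b $ j" L] periodic by (simp add: L_def)
  qed
  ultimately show ?thesis using shift[of a b c] by (simp add: c_def)
qed

lemma linear_axis: "linear (\<lambda>s::real. axis i s :: real ^ 'd)"
  by (auto intro!: linearI simp: vec_eq_iff axis_def)

text \<open>
  The derivative of the integral of \<open>x \<mapsto> g (x + s e\<^sub>i)\<close>, which does not depend on \<open>s\<close>.
\<close>
lemma integral_periodic_derivative: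
  fixes g g' :: "real ^ 'd \<Rightarrow> 'b::banach"
  assumes g: "continuous_on UNIV g" and g': "continuous_on UNIV g'"
    and deriv: "\<And>x s. ((\<lambda>s. g (x + axis i s)) has_vector_derivative g' (x + axis i s)) (at s)"
    and periodic: "\<And>x. g (x + axis i (b $ i - a $ i)) = g x" and ab: "a $ i < b $ i"
  shows "integral (cbox a b) g' = 0"
proof -
  let ?U = "{0..b $ i - a $ i}"
  have "((\<lambda>s. integral (cbox a b) (\<lambda>x. g (x + axis i s))) has_vector_derivative
      integral (cbox a b) (\<lambda>x. g' (x + axis i 0))) (at 0 within ?U)"
  proof (rule leibniz_rule_vector_derivative)
    show "((\<lambda>s. g (x + axis i s)) has_vector_derivative g' (x + axis i s)) (at s within ?U)" for s x
      using deriv by (rule has_vector_derivative_at_within)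
  next
    have c: "continuous_on UNIV (\<lambda>s::real. axis i s :: real^'d)"
      using linear_axis by (intro linear_continuous_on) (simp add: linear_conv_bounded_linear)
    show "(\<lambda>x. g (x + axis i s)) integrable_on cbox a b" for s
      by (intro integrable_continuous continuous_on_compose2[OF g] continuous_intros) auto
    have c': "continuous_on (?U \<times> cbox a b) (\<lambda>p. snd p + axis i (fst p))"
      by (intro continuous_intros continuous_on_compose2[OF c]) auto
    show "continuous_on (?U \<times> cbox a b) (\<lambda>(s, x). g' (x + axis i s))"
      unfolding split_beta by (rule continuous_on_compose2[OF g' c']) auto
  qed (use ab in auto)
  moreover have "((\<lambda>s. integral (cbox a b) (\<lambda>x. g (x + axis i s))) has_vector_derivative 0) (at 0 within ?U)"
  proof (rule has_vector_derivative_transform[where f = "\<lambda>_. integral (cbox a b) g"])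
    show "integral (cbox a b) (\<lambda>x. g (x + axis i s)) = integral (cbox a b) g" if "s \<in> ?U" for s
      using that by (intro integral_periodic_shift g periodic) auto
  qed (use ab in auto)
  ultimately have "integral (cbox a b) (\<lambda>x. g' (x + axis i 0)) = 0"
    using ab by (intro vector_derivative_unique_within_closed_interval[of 0 "b $ i - a $ i" 0]) auto
  moreover have "axis i 0 = (0 :: real^'d)" by (simp add: vec_eq_iff axis_def)
  ultimately show ?thesis by simp
qed

lemma fourier_eq_integral:
  assumes "continuous_on (cbox a b) g"
  shows "fourier a b g k = integral (cbox a b) (\<lambda>x. complex_of_real (g x) * cis (- (k \<bullet> x)))"
proof -
  have "set_integrable lborel (cbox a b) (\<lambda>x. complex_of_real (g x) * cis (- (k \<bullet> x)))"
    unfolding set_integrable_def by (intro borel_integrable_compact continuous_intros assms) auto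
  then show ?thesis unfolding fourier_def by (rule set_borel_integral_eq_integral(2))
qed

lemma cis_frequency_periodic:
  assumes "k \<in> frequencies a b"
  shows "cis (- (k \<bullet> (x + axis i (b $ i - a $ i)))) = cis (- (k \<bullet> x))"
proof -
  obtain z :: int where z: "k $ i * (b $ i - a $ i) = 2 * pi * of_int z"
    using assms by (auto simp: frequencies_def)
  have "k \<bullet> axis i (b $ i - a $ i) = 2 * pi * of_int z" by (simp add: inner_axis z)
  then have "- (k \<bullet> (x + axis i (b $ i - a $ i))) = - (k \<bullet> x) + 2 * pi * of_int (- z)"
    by (simp add: inner_add_right)
  then have "cis (- (k \<bullet> (x + axis i (b $ i - a $ i)))) = cis (- (k \<bullet> x)) * cis (2 * pi * of_int (- z))"
    by (simp only: cis_mult)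
  also have "cis (2 * pi * of_int (- z)) = 1" by (rule cis_multiple_2pi) simp
  finally show ?thesis by simp
qed

text \<open>
  Integration by parts without boundary term: \<open>u\<close> times the character is periodic, so the integral of each
  of its partial derivatives vanishes.
\<close>
lemma fourier_directional_derivative:
  fixes u :: "real ^ 'd \<Rightarrow> real" and u' :: "real ^ 'd \<Rightarrow> real ^ 'd"
  assumes u: "\<And>x. GDERIV u x :> u' x" and u': "continuous_on UNIV u'" and periodic: "box_periodic a b u"
    and k: "k \<in> frequencies a b" and ab: "\<forall>i. a $ i < b $ i"
  shows "integral (cbox a b) (\<lambda>x. complex_of_real (v \<bullet> u' x) * cis (- (k \<bullet> x)))
     = \<i> * complex_of_real (k \<bullet> v) * integral (cbox a b) (\<lambda>x. complex_of_real (u x) * cis (- (k \<bullet> x)))"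
proof -
  let ?e = "\<lambda>x. cis (- (k \<bullet> x))"
  let ?g = "\<lambda>x. complex_of_real (u x) * ?e x"
  let ?g' = "\<lambda>i x. complex_of_real (u' x $ i) * ?e x - \<i> * complex_of_real (k $ i) * ?g x"
  have du: "(u has_derivative (\<lambda>h. h \<bullet> u' x)) (at x)" for x using u[of x] by (simp add: gderiv_def)
  then have cu: "continuous_on UNIV u"
    by (intro continuous_at_imp_continuous_on) (auto intro: has_derivative_continuous)
  have cg: "continuous_on UNIV ?g" by (intro continuous_intros cu)
  have ci: "continuous_on UNIV (\<lambda>x. u' x $ i)" for i by (intro continuous_intros u')
  have cg': "continuous_on UNIV (?g' i)" for i by (intro continuous_intros ci cu)
  have 0: "integral (cbox a b) (?g' i) = 0" for i
  proof (rule integral_periodic_derivative[OF cg cg'])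
    fix x :: "real ^ 'd" and s :: real
    let ?z = "x + axis i s"
    have z: "((\<lambda>s. x + axis i s) has_derivative (\<lambda>h. axis i h)) (at s)"
      using has_derivative_add[OF has_derivative_const linear_imp_has_derivative[OF linear_axis]] by simp
    have "(?g has_derivative (\<lambda>h. complex_of_real (u ?z) * ((- (k \<bullet> h)) *\<^sub>R (\<i> * ?e ?z)) + complex_of_real (h \<bullet> u' ?z) * ?e ?z)) (at ?z)"
      by (intro has_derivative_mult has_derivative_of_real du has_derivative_cis) (auto intro!: derivative_eq_intros)
    from has_derivative_compose[OF z this]
    have "((\<lambda>s. ?g (x + axis i s)) has_derivative
      (\<lambda>h. complex_of_real (u ?z) * ((- (k \<bullet> axis i h)) *\<^sub>R (\<i> * ?e ?z)) + complex_of_real (axis i h \<bullet> u' ?z) * ?e ?z)) (at s)" .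
    moreover have "complex_of_real (u ?z) * ((- (k \<bullet> axis i h)) *\<^sub>R (\<i> * ?e ?z)) + complex_of_real (axis i h \<bullet> u' ?z) * ?e ?z
        = h *\<^sub>R ?g' i ?z" for h
      by (simp add: inner_axis inner_axis' scaleR_conv_of_real algebra_simps)
    ultimately show "((\<lambda>s. ?g (x + axis i s)) has_vector_derivative ?g' i (x + axis i s)) (at s)"
      by (simp only: has_vector_derivative_def)
  qed (use ab cis_frequency_periodic[OF k] periodic in \<open>auto simp: box_periodic_def\<close>)
  have int: "f integrable_on cbox a b" if "continuous_on UNIV f" for f :: "real^'d \<Rightarrow> complex"
    using that continuous_on_subset integrable_continuous subset_UNIV by metis
  have "0 = (\<Sum>i\<in>UNIV. complex_of_real (v $ i) * integral (cbox a b) (?g' i))" by (simp add: 0)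
  also have "\<dots> = integral (cbox a b) (\<lambda>x. \<Sum>i\<in>UNIV. complex_of_real (v $ i) * ?g' i x)"
    using int[OF cg'] by (subst integral_sum) (auto intro!: integrable_on_mult_right)
  also have "(\<lambda>x. \<Sum>i\<in>UNIV. complex_of_real (v $ i) * ?g' i x) =
      (\<lambda>x. complex_of_real (v \<bullet> u' x) * ?e x - (\<i> * complex_of_real (k \<bullet> v)) * ?g x)"
    by (simp add: inner_vec_def sum_distrib_left sum_distrib_right sum_subtractf algebra_simps fun_eq_iff)
  also have "integral (cbox a b) \<dots> = integral (cbox a b) (\<lambda>x. complex_of_real (v \<bullet> u' x) * ?e x)
       - (\<i> * complex_of_real (k \<bullet> v)) * integral (cbox a b) ?g"
  proof -
    have "continuous_on UNIV (\<lambda>x. complex_of_real (v \<bullet> u' x) * ?e x)" by (intro continuous_intros u')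
    then show ?thesis using int[OF cg] int
      by (subst integral_diff) (auto intro!: integrable_on_mult_right)
  qed
  finally show ?thesis by simp
qed

text \<open>
  Fubini. The null set of velocities at which \<open>x \<mapsto> g x v\<close> is not integrable does no harm: there the Bochner
  integral has its default value \<open>0\<close>.
\<close>
lemma fourier_velocity_integrable:
  fixes g :: "real ^ 'd \<Rightarrow> real ^ 'd \<Rightarrow> real"
  assumes g: "set_integrable lborel (cbox a b \<times> UNIV) (\<lambda>(x, v). g x v)"
  shows "integrable lborel (\<lambda>v. fourier a b (\<lambda>x. g x v) k)"
    and "(\<integral>v. fourier a b (\<lambda>x. g x v) k \<partial>lborel) = fourier a b (\<lambda>x. bracket (g x)) k"
proof -
  let ?h = "\<lambda>x v. indicator (cbox a b) x *\<^sub>R (complex_of_real (g x v) * cis (- (k \<bullet> x)))"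
  have "integrable (lborel \<Otimes>\<^sub>M lborel) (\<lambda>p. indicator (cbox a b \<times> UNIV) p *\<^sub>R (case p of (x, v) \<Rightarrow> g x v))"
    using g unfolding set_integrable_def by (simp add: lborel_prod)
  then have "integrable (lborel \<Otimes>\<^sub>M lborel) (\<lambda>p. complex_of_real (indicator (cbox a b \<times> UNIV) p *\<^sub>R (case p of (x, v) \<Rightarrow> g x v)) * cis (- (k \<bullet> fst p)))"
    by (intro integrable_mult_bounded integrable_of_real) auto
  also have "(\<lambda>p. complex_of_real (indicator (cbox a b \<times> UNIV) p *\<^sub>R (case p of (x, v) \<Rightarrow> g x v)) * cis (- (k \<bullet> fst p)))
      = case_prod ?h"
    by (auto simp: fun_eq_iff indicator_def)
  finally have h: "integrable (lborel \<Otimes>\<^sub>M lborel) (case_prod ?h)" .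
  have F: "fourier a b (\<lambda>x. g x v) k = (\<integral>x. ?h x v \<partial>lborel)" for v
    by (simp add: fourier_def set_lebesgue_integral_def)
  show "integrable lborel (\<lambda>v. fourier a b (\<lambda>x. g x v) k)"
    unfolding F by (rule lborel_pair.integrable_snd[OF h])
  have "(\<integral>v. fourier a b (\<lambda>x. g x v) k \<partial>lborel) = (\<integral>x. (\<integral>v. ?h x v \<partial>lborel) \<partial>lborel)"
    unfolding F by (rule lborel_pair.Fubini_integral[OF h])
  also have "\<dots> = fourier a b (\<lambda>x. bracket (g x)) k"
    unfolding fourier_def set_lebesgue_integral_def bracket_def
    by (intro Bochner_Integration.integral_cong refl) (simp only: integral_scaleR_right integral_mult_left_zero integral_complex_of_real)
  finally show "(\<integral>v. fourier a b (\<lambda>x. g x v) k \<partial>lborel) = fourier a b (\<lambda>x. bracket (g x)) k" .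
qed

section \<open>Fourier modes of kinetic solutions\<close>

text \<open>
  The truncation error of a step is an integral of \<open>(t - t\<^sub>j) u'' t\<close> over that step, hence at most
  \<open>T / N\<close> times the variation of \<open>u'\<close> there.
\<close>
lemma summed_truncation_le:
  fixes u u' u'' :: "real \<Rightarrow> real"
  assumes T: "0 < T" and N: "1 \<le> N"
    and u: "\<And>t. t \<in> {0..T} \<Longrightarrow> (u has_real_derivative u' t) (at t within {0..T})"
    and u': "\<And>t. t \<in> {0..T} \<Longrightarrow> (u' has_real_derivative u'' t) (at t within {0..T})"
    and u'': "continuous_on {0..T} u''"
  shows "(\<Sum>j<N. \<bar>u (real (Suc j) * (T / real N)) - u (real j * (T / real N)) - T / real N * u' (real (Suc j) * (T / real N))\<bar>)
     \<le> T / real N * integral {0..T} (\<lambda>t. \<bar>u'' t\<bar>)"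
proof -
  define h where "h = T / real N"
  have h: "0 < h" and Nh: "real N * h = T" using T N by (auto simp: h_def)
  define I where "I = (\<lambda>s. integral {0..s} (\<lambda>t. \<bar>u'' t\<bar>))"
  have I: "(I has_vector_derivative \<bar>u'' s\<bar>) (at s within {0..T})" if "s \<in> {0..T}" for s
    unfolding I_def by (rule integral_has_vector_derivative) (use that u'' in \<open>auto intro!: continuous_intros\<close>)
  have cI: "continuous_on {0..T} I" by (rule continuous_on_vector_derivative[OF I])
  have cu: "continuous_on {0..T} u" "continuous_on {0..T} u'"
    by (rule DERIV_continuous_on[OF u], assumption) (rule DERIV_continuous_on[OF u'], assumption)
  have "\<bar>u (real (Suc j) * h) - u (real j * h) - h * u' (real (Suc j) * h)\<bar>
      \<le> h * (I (real (Suc j) * h) - I (real j * h))" if j: "j < N" for j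
  proof -
    let ?s = "real j * h" and ?t = "real (Suc j) * h"
    have "?t \<le> T" using j h unfolding Nh[symmetric] by (intro mult_right_mono) auto
    then have sub: "{?s .. ?t} \<subseteq> {0..T}" and st: "?s < ?t" using h by (auto simp: algebra_simps)
    \<comment> \<open>The increment of \<open>w\<close> over the step is the truncation error, and \<open>w' t = - (t - t\<^sub>j) u'' t\<close>.\<close>
    define w where "w = (\<lambda>t. u t - (t - ?s) * u' t)"
    have "norm (w ?t - w ?s) \<le> h * I ?t - h * I ?s"
    proof (rule differentiable_bound_general[OF st])
      show "continuous_on {?s .. ?t} w" "continuous_on {?s .. ?t} (\<lambda>t. h * I t)"
        unfolding w_def using continuous_on_subset[OF _ sub] cu cI by (auto intro!: continuous_intros)
      fix t assume t: "?s < t" "t < ?t"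
      have "0 \<le> ?s" using h by simp
      then have "0 < t" "t < T" using t \<open>?t \<le> T\<close> by linarith+
      then have tT: "t \<in> {0..T}" "0 < t" "t < T" by auto
      then have at: "at t within {0..T} = at t" by (simp add: at_within_Icc_at)
      have du: "(u has_real_derivative u' t) (at t)" "(u' has_real_derivative u'' t) (at t)"
        using u[OF tT(1)] u'[OF tT(1)] at by auto
      have "(w has_real_derivative - ((t - ?s) * u'' t)) (at t)"
        unfolding w_def by (auto intro!: derivative_eq_intros du)
      then show "(w has_vector_derivative - ((t - ?s) * u'' t)) (at t)"
        by (simp add: has_real_derivative_iff_has_vector_derivative)
      have "(I has_vector_derivative \<bar>u'' t\<bar>) (at t)" using I[OF tT(1)] at by simp
      then show "((\<lambda>t. h * I t) has_vector_derivative h * \<bar>u'' t\<bar>) (at t)"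
        by (intro has_vector_derivative_mult_right)
      have "\<bar>t - ?s\<bar> \<le> h" using t by (auto simp: algebra_simps)
      then show "norm (- ((t - ?s) * u'' t)) \<le> h * \<bar>u'' t\<bar>" by (simp add: abs_mult mult_right_mono)
    qed
    moreover have "w ?t - w ?s = u ?t - u ?s - h * u' ?t" by (simp add: w_def algebra_simps)
    ultimately show ?thesis by (simp add: algebra_simps)
  qed
  then have "(\<Sum>j<N. \<bar>u (real (Suc j) * h) - u (real j * h) - h * u' (real (Suc j) * h)\<bar>)
     \<le> (\<Sum>j<N. h * (I (real (Suc j) * h) - I (real j * h)))"
    by (intro sum_mono) auto
  also have "\<dots> = h * (I (real N * h) - I (real 0 * h))"
    unfolding sum_distrib_left[symmetric] by (simp only: sum_lessThan_telescope[where f = "\<lambda>j. I (real j * h)"])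
  also have "\<dots> = h * integral {0..T} (\<lambda>t. \<bar>u'' t\<bar>)" by (simp only: Nh) (simp add: I_def)
  finally show ?thesis by (simp add: h_def)
qed

lemma ennreal_integral_cbox:
  fixes g :: "'a::euclidean_space \<Rightarrow> real"
  assumes g: "continuous_on (cbox a b) g" and nonneg: "\<And>x. 0 \<le> g x"
  shows "ennreal (integral (cbox a b) g) = (\<integral>\<^sup>+x. indicator (cbox a b) x * ennreal (g x) \<partial>lborel)"
proof -
  have i: "integrable lborel (\<lambda>x. indicator (cbox a b) x *\<^sub>R g x)"
    by (intro borel_integrable_compact g) simp
  then have "integral (cbox a b) g = (\<integral>x. indicator (cbox a b) x *\<^sub>R g x \<partial>lborel)"
    using set_borel_integral_eq_integral(2)[of "cbox a b" g] by (simp add: set_integrable_def set_lebesgue_integral_def)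
  also have "ennreal \<dots> = (\<integral>\<^sup>+x. ennreal (indicator (cbox a b) x *\<^sub>R g x) \<partial>lborel)"
    by (rule nn_integral_eq_integral[symmetric, OF i]) (simp add: nonneg indicator_def)
  also have "\<dots> = (\<integral>\<^sup>+x. indicator (cbox a b) x * ennreal (g x) \<partial>lborel)"
    by (intro nn_integral_cong) (simp add: indicator_def)
  finally show ?thesis .
qed

text \<open>
  The transform of the equation. The density is continuous in \<open>x\<close> because the equation expresses it through
  continuous functions divided by \<open>M v > 0\<close>.
\<close>
lemma kinetic_fourier_balance:
  fixes M :: "real ^ 'd \<Rightarrow> real"
  assumes M_pos: "\<And>v. 0 < M v" and ab: "\<forall>i. a $ i < b $ i" and k: "k \<in> frequencies a b"
    and sol: "kinetic_solution \<alpha> M \<epsilon> T a b f0 f"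
  obtains ft where
    "\<And>v. continuous_on ({0..T} \<times> UNIV) (\<lambda>(t, x). ft t x v)"
    "\<And>t x v. t \<in> {0..T} \<Longrightarrow> ((\<lambda>s. f s x v) has_real_derivative ft t x v) (at t within {0..T})"
    "\<And>t v. t \<in> {0..T} \<Longrightarrow> continuous_on UNIV (\<lambda>x. f t x v)"
    "\<And>t v. t \<in> {0..T} \<Longrightarrow>
       complex_of_real (\<epsilon> powr \<alpha>) * integral (cbox a b) (\<lambda>x. complex_of_real (ft t x v) * cis (- (k \<bullet> x)))
       + (1 + \<i> * complex_of_real (\<epsilon> * (k \<bullet> v))) * fourier a b (\<lambda>x. f t x v) k
       = fourier a b (\<lambda>x. bracket (f t x)) k * complex_of_real (M v)"
proof -
  obtain ft fx where
      *: "\<forall>v. continuous_on ({0..T} \<times> UNIV) (\<lambda>(t, x). ft t x v)"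
         "\<forall>v. continuous_on ({0..T} \<times> UNIV) (\<lambda>(t, x). fx t x v)"
         "\<forall>t\<in>{0..T}. \<forall>x v. ((\<lambda>s. f s x v) has_real_derivative ft t x v) (at t within {0..T}) \<and>
            GDERIV (\<lambda>y. f t y v) x :> fx t x v \<and>
            \<epsilon> powr \<alpha> * ft t x v + \<epsilon> * (v \<bullet> fx t x v) = bracket (f t x) * M v - f t x v"
    using sol unfolding kinetic_solution_def by (elim conjE exE) (rule that)
  have cft: "\<And>v. continuous_on ({0..T} \<times> UNIV) (\<lambda>(t, x). ft t x v)"
    and cfx: "\<And>v. continuous_on ({0..T} \<times> UNIV) (\<lambda>(t, x). fx t x v)"
    and ft: "\<And>t x v. t \<in> {0..T} \<Longrightarrow> ((\<lambda>s. f s x v) has_real_derivative ft t x v) (at t within {0..T})"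
    and fx: "\<And>t x v. t \<in> {0..T} \<Longrightarrow> GDERIV (\<lambda>y. f t y v) x :> fx t x v"
    and eq: "\<And>t x v. t \<in> {0..T} \<Longrightarrow> \<epsilon> powr \<alpha> * ft t x v + \<epsilon> * (v \<bullet> fx t x v) = bracket (f t x) * M v - f t x v"
    and per: "\<And>t v. t \<in> {0..T} \<Longrightarrow> box_periodic a b (\<lambda>x. f t x v)"
    using * sol by (simp_all add: kinetic_solution_def)
  have slice: "continuous_on UNIV (\<lambda>x. g t x)" if "continuous_on ({0..T} \<times> UNIV) (\<lambda>(t, x). g t x)" "t \<in> {0..T}"
    for g :: "real \<Rightarrow> real ^ 'd \<Rightarrow> 'b::topological_space" and t
  proof -
    have "continuous_on UNIV (\<lambda>x. (t, x))" by (intro continuous_intros)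
    from continuous_on_compose2[OF that(1) this] that(2) show ?thesis by (auto simp: image_subset_iff)
  qed
  have cf: "continuous_on UNIV (\<lambda>x. f t x v)" if "t \<in> {0..T}" for t v
    using fx[OF that, of v] unfolding gderiv_def
    by (intro continuous_at_imp_continuous_on) (auto intro: has_derivative_continuous)
  show ?thesis
  proof (rule that[OF cft ft cf])
    fix t v assume t: "t \<in> {0..T}"
    let ?e = "\<lambda>x. cis (- (k \<bullet> x))"
    let ?J = "\<lambda>u. integral (cbox a b) (\<lambda>x. complex_of_real (u x) * ?e x)"
    have c1: "continuous_on UNIV (\<lambda>x. ft t x v)" by (rule slice[OF cft t])
    have c2: "continuous_on UNIV (\<lambda>x. fx t x v)" by (rule slice[OF cfx t])
    have c3: "continuous_on UNIV (\<lambda>x. f t x v)" by (rule cf[OF t])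
    have c4: "continuous_on UNIV (\<lambda>x. v \<bullet> fx t x v)" by (intro continuous_intros c2)
    have int: "(\<lambda>x. complex_of_real (u x) * ?e x) integrable_on cbox a b" if "continuous_on UNIV u" for u
    proof -
      have "continuous_on (cbox a b) u" using that by (rule continuous_on_subset) simp
      then show ?thesis by (intro integrable_continuous continuous_intros)
    qed
    have F: "fourier a b (\<lambda>x. f t x v) k = ?J (\<lambda>x. f t x v)"
      by (rule fourier_eq_integral) (rule continuous_on_subset[OF c3], simp)
    have grad: "?J (\<lambda>x. v \<bullet> fx t x v) = \<i> * complex_of_real (k \<bullet> v) * ?J (\<lambda>x. f t x v)"
      by (rule fourier_directional_derivative[OF fx[OF t] c2 per[OF t] k ab])
    have rho: "bracket (f t x) = (\<epsilon> powr \<alpha> * ft t x v + \<epsilon> * (v \<bullet> fx t x v) + f t x v) / M v" for x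
      using eq[OF t, of x v] M_pos[of v] by (simp add: field_simps)
    have "continuous_on UNIV (\<lambda>x. bracket (f t x))"
      unfolding rho by (intro continuous_intros c1 c3 c4) (use M_pos[of v] in simp)
    then have r: "fourier a b (\<lambda>x. bracket (f t x)) k = ?J (\<lambda>x. bracket (f t x))"
      by (intro fourier_eq_integral) (rule continuous_on_subset[OF _ subset_UNIV])
    have "?J (\<lambda>x. bracket (f t x)) * complex_of_real (M v)
        = integral (cbox a b) (\<lambda>x. complex_of_real (bracket (f t x)) * ?e x * complex_of_real (M v))"
      by (rule integral_mult_left[symmetric])
    also have "\<dots> = integral (cbox a b) (\<lambda>x. complex_of_real (\<epsilon> powr \<alpha>) * (complex_of_real (ft t x v) * ?e x)
         + complex_of_real \<epsilon> * (complex_of_real (v \<bullet> fx t x v) * ?e x) + complex_of_real (f t x v) * ?e x)"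
    proof (rule integral_cong)
      fix x
      have "complex_of_real (bracket (f t x)) * complex_of_real (M v)
          = complex_of_real (\<epsilon> powr \<alpha> * ft t x v + \<epsilon> * (v \<bullet> fx t x v) + f t x v)"
        unfolding of_real_mult[symmetric] using eq[OF t, of x v] by simp
      moreover have "complex_of_real (bracket (f t x)) * ?e x * complex_of_real (M v)
          = (complex_of_real (bracket (f t x)) * complex_of_real (M v)) * ?e x" by (simp only: mult_ac)
      ultimately have "complex_of_real (bracket (f t x)) * ?e x * complex_of_real (M v)
          = complex_of_real (\<epsilon> powr \<alpha> * ft t x v + \<epsilon> * (v \<bullet> fx t x v) + f t x v) * ?e x"
        by simp
      also have "\<dots> = complex_of_real (\<epsilon> powr \<alpha>) * (complex_of_real (ft t x v) * ?e x)
         + complex_of_real \<epsilon> * (complex_of_real (v \<bullet> fx t x v) * ?e x) + complex_of_real (f t x v) * ?e x"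
        by (simp only: of_real_add of_real_mult distrib_right mult.assoc)
      finally show "complex_of_real (bracket (f t x)) * ?e x * complex_of_real (M v) = \<dots>" .
    qed
    also have "\<dots> = complex_of_real (\<epsilon> powr \<alpha>) * ?J (\<lambda>x. ft t x v) + complex_of_real \<epsilon> * ?J (\<lambda>x. v \<bullet> fx t x v) + ?J (\<lambda>x. f t x v)"
      using int[OF c1] int[OF c3] int[OF c4]
      by (simp only: integral_add integrable_add integrable_on_mult_right integral_mult_right)
    also have "\<dots> = complex_of_real (\<epsilon> powr \<alpha>) * ?J (\<lambda>x. ft t x v) + (1 + \<i> * complex_of_real (\<epsilon> * (k \<bullet> v))) * ?J (\<lambda>x. f t x v)"
      unfolding grad by (simp add: algebra_simps)
    finally show "complex_of_real (\<epsilon> powr \<alpha>) * ?J (\<lambda>x. ft t x v)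
       + (1 + \<i> * complex_of_real (\<epsilon> * (k \<bullet> v))) * fourier a b (\<lambda>x. f t x v) k
       = fourier a b (\<lambda>x. bracket (f t x)) k * complex_of_real (M v)"
      unfolding F r by simp
  qed
qed

text \<open>
  The transform is differentiated in time under the integral sign. Continuity of the density in time is
  read off from the balance at the velocity \<open>0\<close>.
\<close>
lemma kinetic_relaxation_mode:
  fixes M :: "real ^ 'd \<Rightarrow> real"
  assumes M: "integrable lborel M" "\<And>v. 0 < M v" "bracket M = 1"
    and ab: "\<forall>i. a $ i < b $ i" and k: "k \<in> frequencies a b" and pos: "0 < \<epsilon>" "0 < T"
    and sol: "kinetic_solution \<alpha> M \<epsilon> T a b f0 f"
  shows "relaxation_mode M (\<epsilon> powr \<alpha>) T (\<lambda>v. \<epsilon> * (k \<bullet> v)) (\<lambda>t v. fourier a b (\<lambda>x. f t x v) k)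
     (\<lambda>t. fourier a b (\<lambda>x. bracket (f t x)) k)"
proof -
  let ?c = "\<epsilon> powr \<alpha>"
  let ?F = "\<lambda>t v. fourier a b (\<lambda>x. f t x v) k" and ?r = "\<lambda>t. fourier a b (\<lambda>x. bracket (f t x)) k"
  obtain ft where
      cft: "\<And>v. continuous_on ({0..T} \<times> UNIV) (\<lambda>(t, x). ft t x v)"
    and ft: "\<And>t x v. t \<in> {0..T} \<Longrightarrow> ((\<lambda>s. f s x v) has_real_derivative ft t x v) (at t within {0..T})"
    and cf: "\<And>t v. t \<in> {0..T} \<Longrightarrow> continuous_on UNIV (\<lambda>x. f t x v)"
    and balance: "\<And>t v. t \<in> {0..T} \<Longrightarrow>
       complex_of_real ?c * integral (cbox a b) (\<lambda>x. complex_of_real (ft t x v) * cis (- (k \<bullet> x)))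
       + (1 + \<i> * complex_of_real (\<epsilon> * (k \<bullet> v))) * ?F t v = ?r t * complex_of_real (M v)"
    by (rule kinetic_fourier_balance[OF M(2) ab k sol]) blast
  let ?I = "\<lambda>t v. integral (cbox a b) (\<lambda>x. complex_of_real (ft t x v) * cis (- (k \<bullet> x)))"
  have c: "0 < ?c" using pos by simp
  have cft': "continuous_on ({0..T} \<times> cbox a b) (\<lambda>(t, x). complex_of_real (ft t x v) * cis (- (k \<bullet> x)))" for v
  proof -
    have "continuous_on ({0..T} \<times> cbox a b) (\<lambda>p. ft (fst p) (snd p) v)"
      using continuous_on_subset[OF cft[of v], of "{0..T} \<times> cbox a b"] by (auto simp: split_beta)
    then show ?thesis unfolding split_beta by (intro continuous_intros)
  qed
  have F: "?F t v = integral (cbox a b) (\<lambda>x. complex_of_real (f t x v) * cis (- (k \<bullet> x)))" if "t \<in> {0..T}" for t v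
    by (rule fourier_eq_integral) (rule continuous_on_subset[OF cf[OF that]], simp)
  have dF: "((\<lambda>t. ?F t v) has_vector_derivative ?I t v) (at t within {0..T})" if t: "t \<in> {0..T}" for t v
  proof (rule has_vector_derivative_transform[OF t F])
    show "((\<lambda>t. integral (cbox a b) (\<lambda>x. complex_of_real (f t x v) * cis (- (k \<bullet> x)))) has_vector_derivative ?I t v) (at t within {0..T})"
    proof (rule leibniz_rule_vector_derivative)
      fix s x assume s: "s \<in> {0..T}"
      have "((\<lambda>s. complex_of_real (f s x v)) has_vector_derivative complex_of_real (ft s x v)) (at s within {0..T})"
        using ft[OF s] by (intro has_vector_derivative_of_real)
      then show "((\<lambda>s. complex_of_real (f s x v) * cis (- (k \<bullet> x))) has_vector_derivative
         complex_of_real (ft s x v) * cis (- (k \<bullet> x))) (at s within {0..T})"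
        by (rule has_vector_derivative_mult_left)
      have "continuous_on (cbox a b) (\<lambda>x. f s x v)" by (rule continuous_on_subset[OF cf[OF s]]) simp
      then show "(\<lambda>x. complex_of_real (f s x v) * cis (- (k \<bullet> x))) integrable_on cbox a b"
        by (intro integrable_continuous continuous_intros)
    qed (use t cft' in auto)
  qed
  have I: "?I t v = (?r t * complex_of_real (M v) - (1 + \<i> * complex_of_real (\<epsilon> * (k \<bullet> v))) * ?F t v) / complex_of_real ?c"
    if "t \<in> {0..T}" for t v
  proof -
    have cc: "complex_of_real ?c \<noteq> 0" using c by simp
    show ?thesis unfolding balance[OF that, symmetric] using cc by simp
  qed
  show ?thesis
  proof
    show "integrable lborel M" "0 < M v" "(\<integral>v. M v \<partial>lborel) = 1" for v using M by (auto simp: bracket_def)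
    show "0 < ?c" "0 < T" using c pos by auto
    show "(\<lambda>v. \<epsilon> * (k \<bullet> v)) \<in> borel_measurable borel" by measurable
    fix t assume t: "t \<in> {0..T}"
    then have "set_integrable lborel (cbox a b \<times> UNIV) (\<lambda>(x, v). f t x v)"
      using sol by (simp add: kinetic_solution_def)
    from fourier_velocity_integrable[OF this]
    show "integrable lborel (?F t)" "(\<integral>v. ?F t v \<partial>lborel) = ?r t" .
    fix v
    show "((\<lambda>s. ?F s v) has_vector_derivative
      (?r t * complex_of_real (M v) - (1 + \<i> * complex_of_real (\<epsilon> * (k \<bullet> v))) * ?F t v) / complex_of_real ?c) (at t within {0..T})"
      using dF[OF t, of v] unfolding I[OF t, of v] .
  next
    have cI: "continuous_on {0..T} (\<lambda>t. ?I t 0)" by (rule integral_continuous_on_param[OF cft'])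
    have cF: "continuous_on {0..T} (\<lambda>t. ?F t 0)" by (rule continuous_on_vector_derivative[OF dF])
    have r: "?r t = (complex_of_real ?c * ?I t 0 + ?F t 0) / complex_of_real (M 0)" if "t \<in> {0..T}" for t
      using balance[OF that, of 0] M(2)[of 0] by (simp add: field_simps)
    have "continuous_on {0..T} (\<lambda>t. (complex_of_real ?c * ?I t 0 + ?F t 0) / complex_of_real (M 0))"
      using M(2)[of 0] by (intro continuous_intros cI cF) auto
    then show "continuous_on {0..T} ?r"
      by (rule continuous_on_eq) (rule r[symmetric])
  qed
qed

text \<open>
  The function \<open>\<Theta> v\<close> is the integral of the absolute second time derivative over \<open>[0, T] \<times> \<Omega>\<close>, as an extended
  nonnegative real: it may be infinite on a null set of velocities.
\<close>
lemma time_regular_truncation: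
  fixes M :: "real ^ 'd \<Rightarrow> real"
  assumes M: "\<And>v. 0 < M v" and ab: "\<forall>i. a $ i < b $ i" and k: "k \<in> frequencies a b"
    and pos: "0 < \<epsilon>" "0 < T" and sol: "kinetic_solution \<alpha> M \<epsilon> T a b f0 f" and reg: "time_regular T a b f"
  defines "F \<equiv> \<lambda>t v. fourier a b (\<lambda>x. f t x v) k" and "r \<equiv> \<lambda>t. fourier a b (\<lambda>x. bracket (f t x)) k"
  obtains \<Theta> where "\<Theta> \<in> borel_measurable borel" "(\<integral>\<^sup>+v. \<Theta> v \<partial>lborel) < \<infinity>"
    "\<And>N v. 1 \<le> N \<Longrightarrow> ennreal (\<Sum>j<N. norm (F (real (Suc j) * (T / real N)) v - F (real j * (T / real N)) v
        - (T / real N) *\<^sub>R ((r (real (Suc j) * (T / real N)) * complex_of_real (M v)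
             - (1 + \<i> * complex_of_real (\<epsilon> * (k \<bullet> v))) * F (real (Suc j) * (T / real N)) v) / complex_of_real (\<epsilon> powr \<alpha>))))
      \<le> ennreal (T / real N) * \<Theta> v"
proof -
  let ?c = "\<epsilon> powr \<alpha>" and ?e = "\<lambda>x. cis (- (k \<bullet> x))"
  obtain ft where
      cft: "\<And>v. continuous_on ({0..T} \<times> UNIV) (\<lambda>(t, x). ft t x v)"
    and ft: "\<And>t x v. t \<in> {0..T} \<Longrightarrow> ((\<lambda>s. f s x v) has_real_derivative ft t x v) (at t within {0..T})"
    and cf: "\<And>t v. t \<in> {0..T} \<Longrightarrow> continuous_on UNIV (\<lambda>x. f t x v)"
    and balance: "\<And>t v. t \<in> {0..T} \<Longrightarrow>
       complex_of_real ?c * integral (cbox a b) (\<lambda>x. complex_of_real (ft t x v) * ?e x)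
       + (1 + \<i> * complex_of_real (\<epsilon> * (k \<bullet> v))) * F t v = r t * complex_of_real (M v)"
    unfolding F_def r_def by (rule kinetic_fourier_balance[OF M ab k sol]) blast
  obtain gt gtt where
      gt: "\<And>t x v. t \<in> {0..T} \<Longrightarrow> ((\<lambda>s. f s x v) has_real_derivative gt t x v) (at t within {0..T})"
    and gtt: "\<And>t x v. t \<in> {0..T} \<Longrightarrow> ((\<lambda>s. gt s x v) has_real_derivative gtt t x v) (at t within {0..T})"
    and cgtt: "\<And>x v. continuous_on {0..T} (\<lambda>t. gtt t x v)"
    and igtt: "set_integrable lborel ({0..T} \<times> cbox a b \<times> UNIV) (\<lambda>(t, x, v). gtt t x v)"
  proof -
    obtain gt gtt where *:
      "\<forall>t\<in>{0..T}. \<forall>x v. ((\<lambda>s. f s x v) has_real_derivative gt t x v) (at t within {0..T}) \<and>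
         ((\<lambda>s. gt s x v) has_real_derivative gtt t x v) (at t within {0..T})"
      "\<forall>x v. continuous_on {0..T} (\<lambda>t. gtt t x v)"
      "set_integrable lborel ({0..T} \<times> cbox a b \<times> UNIV) (\<lambda>(t, x, v). gtt t x v)"
      using reg unfolding time_regular_def by (elim conjE exE) (rule that)
    show ?thesis by (rule that[of gt gtt]) (use * in auto)
  qed
  have ft_gt: "ft t x v = gt t x v" if t: "t \<in> {0..T}" for t x v
    using ft[OF t, of x v] gt[OF t, of x v] pos t
    unfolding has_real_derivative_iff_has_vector_derivative
    by (intro vector_derivative_unique_within_closed_interval[of 0 T t]) auto
  define Z where "Z = (\<lambda>t x v. ennreal (norm (indicator ({0..T} \<times> cbox a b \<times> UNIV) (t, x, v) *\<^sub>R gtt t x v)))"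
  \<comment> \<open>Tonelli: measurable in \<open>v\<close>, with the norm of the second derivative in \<open>L\<^sup>1\<close> as total integral.\<close>
  define \<Theta> where "\<Theta> = (\<lambda>v. \<integral>\<^sup>+x. \<integral>\<^sup>+t. Z t x v \<partial>lborel \<partial>lborel)"
  have iZ: "integrable (lborel :: (real \<times> (real^'d) \<times> (real^'d)) measure)
      (\<lambda>p. indicator ({0..T} \<times> cbox a b \<times> UNIV) p *\<^sub>R (case p of (t, x, v) \<Rightarrow> gtt t x v))"
    using igtt unfolding set_integrable_def .
  have Zp: "(\<lambda>(t, x, v). Z t x v) = (\<lambda>p. ennreal (norm (indicator ({0..T} \<times> cbox a b \<times> UNIV) p *\<^sub>R (case p of (t, x, v) \<Rightarrow> gtt t x v))))"
    by (auto simp: Z_def fun_eq_iff)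
  have mZ: "(\<lambda>(t, x, v). Z t x v) \<in> borel_measurable (lborel :: (real \<times> (real^'d) \<times> (real^'d)) measure)"
    unfolding Zp
    by (rule measurable_compose[OF measurable_compose[OF borel_measurable_integrable[OF iZ] borel_measurable_norm] measurable_ennreal])
  have mZ': "(\<lambda>(t, p). Z t (fst p) (snd p)) \<in> borel_measurable (lborel \<Otimes>\<^sub>M lborel)"
  proof -
    have "(\<lambda>(t, p). Z t (fst p) (snd p)) = (\<lambda>(t, x, v). Z t x v)" by (auto simp: fun_eq_iff)
    then show ?thesis using mZ by (simp add: lborel_prod)
  qed
  have mI: "(\<lambda>p. \<integral>\<^sup>+t. Z t (fst p) (snd p) \<partial>lborel) \<in> borel_measurable (lborel \<Otimes>\<^sub>M lborel)"
    using lborel.borel_measurable_nn_integral[of "\<lambda>p t. Z t (fst p) (snd p)" "lborel :: ((real^'d) \<times> (real^'d)) measure"]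
      measurable_pair_swap[OF mZ'] by (simp add: lborel_prod split_beta)
  have c: "0 < ?c" using pos by simp
  show ?thesis
  proof (rule that)
    show "\<Theta> \<in> borel_measurable borel"
      using lborel.borel_measurable_nn_integral[of "\<lambda>v x. \<integral>\<^sup>+t. Z t x v \<partial>lborel" "lborel :: (real^'d) measure"]
        measurable_pair_swap[OF mI] unfolding \<Theta>_def by (simp add: split_beta)
    have "(\<integral>\<^sup>+v. \<Theta> v \<partial>lborel) = (\<integral>\<^sup>+p. \<integral>\<^sup>+t. Z t (fst p) (snd p) \<partial>lborel \<partial>(lborel \<Otimes>\<^sub>M lborel))"
      unfolding \<Theta>_def using lborel_pair.nn_integral_snd[OF mI] by simp
    also have "\<dots> = (\<integral>\<^sup>+p. (\<lambda>(t, p). Z t (fst p) (snd p)) p \<partial>(lborel \<Otimes>\<^sub>M lborel))"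
      using lborel_pair.nn_integral_snd[OF mZ'] by (simp add: lborel_prod)
    also have "\<dots> = (\<integral>\<^sup>+p. (\<lambda>(t, x, v). Z t x v) p \<partial>lborel)"
      by (simp add: lborel_prod split_beta)
    also have "\<dots> < \<infinity>" unfolding Zp using iZ by (simp add: integrable_iff_bounded)
    finally show "(\<integral>\<^sup>+v. \<Theta> v \<partial>lborel) < \<infinity>" .
    fix N :: nat and v assume N: "1 \<le> N"
    define h where "h = T / real N"
    have h: "0 < h" and Nh: "real N * h = T" using pos N by (auto simp: h_def)
    have tn: "real j * h \<in> {0..T}" if "j \<le> N" for j
      using that h unfolding Nh[symmetric] by (auto intro: mult_right_mono)
    define \<tau> where "\<tau> = (\<lambda>j x. f (real (Suc j) * h) x v - f (real j * h) x v - h * ft (real (Suc j) * h) x v)"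
    have c\<tau>: "continuous_on (cbox a b) (\<tau> j)" if j: "j < N" for j
    proof -
      have "continuous_on UNIV (\<lambda>x. (real (Suc j) * h, x))" by (intro continuous_intros)
      then have "continuous_on UNIV (\<lambda>x. ft (real (Suc j) * h) x v)"
        using continuous_on_compose2[OF cft[of v], of UNIV "\<lambda>x. (real (Suc j) * h, x)"] tn[of "Suc j"] j
        by (auto simp: image_subset_iff)
      then have "continuous_on UNIV (\<tau> j)"
        unfolding \<tau>_def using tn[of j] tn[of "Suc j"] j by (intro continuous_intros cf) auto
      then show ?thesis by (rule continuous_on_subset) simp
    qed
    have pt: "(\<Sum>j<N. \<bar>\<tau> j x\<bar>) \<le> h * integral {0..T} (\<lambda>t. \<bar>gtt t x v\<bar>)" for x
    proof -
      have "(\<Sum>j<N. \<bar>\<tau> j x\<bar>) = (\<Sum>j<N. \<bar>f (real (Suc j) * h) x v - f (real j * h) x v - h * gt (real (Suc j) * h) x v\<bar>)"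
        unfolding \<tau>_def using ft_gt[OF tn] by (intro sum.cong) (simp_all del: of_nat_Suc)
      also have "\<dots> \<le> h * integral {0..T} (\<lambda>t. \<bar>gtt t x v\<bar>)"
        unfolding h_def by (rule summed_truncation_le[OF pos(2) N gt gtt cgtt])
      finally show ?thesis .
    qed
    have tr: "F (real (Suc j) * h) v - F (real j * h) v
        - h *\<^sub>R ((r (real (Suc j) * h) * complex_of_real (M v)
             - (1 + \<i> * complex_of_real (\<epsilon> * (k \<bullet> v))) * F (real (Suc j) * h) v) / complex_of_real ?c)
        = integral (cbox a b) (\<lambda>x. complex_of_real (\<tau> j x) * ?e x)" if j: "j < N" for j
    proof -
      let ?t = "real (Suc j) * h" and ?s = "real j * h"
      have t: "?t \<in> {0..T}" "?s \<in> {0..T}" using tn[of "Suc j"] tn[of j] j by auto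
      have cc: "complex_of_real ?c \<noteq> 0" using c by simp
      have int: "(\<lambda>x. complex_of_real (u x) * ?e x) integrable_on cbox a b" if "continuous_on UNIV u" for u
      proof -
        have "continuous_on (cbox a b) u" using that by (rule continuous_on_subset) simp
        then show ?thesis by (intro integrable_continuous continuous_intros)
      qed
      have Ft: "F t v = integral (cbox a b) (\<lambda>x. complex_of_real (f t x v) * ?e x)" if "t \<in> {0..T}" for t
        unfolding F_def by (rule fourier_eq_integral) (rule continuous_on_subset[OF cf[OF that]], simp)
      have "continuous_on UNIV (\<lambda>x. (?t, x))" by (intro continuous_intros)
      then have c1: "continuous_on UNIV (\<lambda>x. ft ?t x v)"
        using continuous_on_compose2[OF cft[of v], of UNIV "\<lambda>x. (?t, x)"] t by (auto simp: image_subset_iff)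
      have D1: "(r ?t * complex_of_real (M v) - (1 + \<i> * complex_of_real (\<epsilon> * (k \<bullet> v))) * F ?t v) / complex_of_real ?c
        = integral (cbox a b) (\<lambda>x. complex_of_real (ft ?t x v) * ?e x)"
        unfolding balance[OF t(1), symmetric] using cc by simp
      have \<tau>_eq: "(\<lambda>x. complex_of_real (\<tau> j x) * ?e x) =
         (\<lambda>x. complex_of_real (f ?t x v) * ?e x - complex_of_real (f ?s x v) * ?e x - complex_of_real h * (complex_of_real (ft ?t x v) * ?e x))"
        by (simp add: \<tau>_def fun_eq_iff algebra_simps)
      show ?thesis
        unfolding D1 unfolding Ft[OF t(1)] Ft[OF t(2)] \<tau>_eq using int[OF c1] int[OF cf[OF t(1), of v]] int[OF cf[OF t(2), of v]]
        by (simp only: integral_diff integrable_diff integrable_on_mult_right integral_mult_right scaleR_conv_of_real)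
    qed
    have bound: "norm (integral (cbox a b) (\<lambda>x. complex_of_real (\<tau> j x) * ?e x)) \<le> integral (cbox a b) (\<lambda>x. \<bar>\<tau> j x\<bar>)" if "j < N" for j
      using c\<tau>[OF that] by (intro integral_norm_bound_integral integrable_continuous continuous_intros) (auto simp: norm_mult)
    have c\<phi>: "continuous_on (cbox a b) (\<lambda>x. \<Sum>j<N. \<bar>\<tau> j x\<bar>)" using c\<tau> by (intro continuous_intros) auto
    have "(\<Sum>j<N. norm (integral (cbox a b) (\<lambda>x. complex_of_real (\<tau> j x) * ?e x))) \<le> (\<Sum>j<N. integral (cbox a b) (\<lambda>x. \<bar>\<tau> j x\<bar>))"
      using bound by (intro sum_mono) auto
    also have "\<dots> = integral (cbox a b) (\<lambda>x. \<Sum>j<N. \<bar>\<tau> j x\<bar>)"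
      using c\<tau> by (intro integral_sum[symmetric] integrable_continuous continuous_intros) auto
    finally have "ennreal (\<Sum>j<N. norm (integral (cbox a b) (\<lambda>x. complex_of_real (\<tau> j x) * ?e x)))
       \<le> ennreal (integral (cbox a b) (\<lambda>x. \<Sum>j<N. \<bar>\<tau> j x\<bar>))" by (rule ennreal_leI)
    also have "\<dots> = (\<integral>\<^sup>+x. indicator (cbox a b) x * ennreal (\<Sum>j<N. \<bar>\<tau> j x\<bar>) \<partial>lborel)"
      by (rule ennreal_integral_cbox[OF c\<phi>]) (auto intro: sum_nonneg)
    also have "\<dots> \<le> (\<integral>\<^sup>+x. ennreal h * (\<integral>\<^sup>+t. Z t x v \<partial>lborel) \<partial>lborel)"
    proof (rule nn_integral_mono)
      fix x :: "real^'d"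
      show "indicator (cbox a b) x * ennreal (\<Sum>j<N. \<bar>\<tau> j x\<bar>) \<le> ennreal h * (\<integral>\<^sup>+t. Z t x v \<partial>lborel)"
      proof (cases "x \<in> cbox a b")
        case True
        have "ennreal (\<Sum>j<N. \<bar>\<tau> j x\<bar>) \<le> ennreal (h * integral {0..T} (\<lambda>t. \<bar>gtt t x v\<bar>))" using pt by (rule ennreal_leI)
        also have "\<dots> = ennreal h * ennreal (integral {0..T} (\<lambda>t. \<bar>gtt t x v\<bar>))" using h by (simp add: ennreal_mult')
        also have "ennreal (integral {0..T} (\<lambda>t. \<bar>gtt t x v\<bar>)) = (\<integral>\<^sup>+t. indicator {0..T} t * ennreal \<bar>gtt t x v\<bar> \<partial>lborel)"
          using ennreal_integral_cbox[of 0 T "\<lambda>t. \<bar>gtt t x v\<bar>"] continuous_on_rabs[OF cgtt[of x v]] by simp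
        also have "\<dots> = (\<integral>\<^sup>+t. Z t x v \<partial>lborel)"
          using True by (intro nn_integral_cong) (simp add: Z_def indicator_def)
        finally show ?thesis using True by simp
      qed simp
    qed
    also have "\<dots> = ennreal h * \<Theta> v"
    proof -
      have "(\<lambda>x. \<integral>\<^sup>+t. Z t x v \<partial>lborel) \<in> borel_measurable lborel"
        using measurable_Pair2[OF measurable_pair_swap[OF mI], of v] by (simp add: split_beta)
      then show ?thesis unfolding \<Theta>_def by (rule nn_integral_cmult)
    qed
    also have "(\<Sum>j<N. norm (integral (cbox a b) (\<lambda>x. complex_of_real (\<tau> j x) * ?e x)))
       = (\<Sum>j<N. norm (F (real (Suc j) * h) v - F (real j * h) v
           - h *\<^sub>R ((r (real (Suc j) * h) * complex_of_real (M v)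
             - (1 + \<i> * complex_of_real (\<epsilon> * (k \<bullet> v))) * F (real (Suc j) * h) v) / complex_of_real ?c)))"
      by (rule sum.cong[OF refl]) (simp only: tr lessThan_iff)
    finally show "ennreal (\<Sum>j<N. norm (F (real (Suc j) * (T / real N)) v - F (real j * (T / real N)) v
        - (T / real N) *\<^sub>R ((r (real (Suc j) * (T / real N)) * complex_of_real (M v)
             - (1 + \<i> * complex_of_real (\<epsilon> * (k \<bullet> v))) * F (real (Suc j) * (T / real N)) v) / complex_of_real ?c)))
      \<le> ennreal (T / real N) * \<Theta> v"
      unfolding h_def .
  qed
qed

section \<open>The limit of vanishing Knudsen number\<close>

lemma transport_eq: "transport \<alpha> \<epsilon> h k v = 1 + \<i> * complex_of_real (relax \<alpha> \<epsilon> h * (\<epsilon> * (k \<bullet> v)))"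
  by (simp add: transport_def mult.assoc)

lemma relax_bounds:
  assumes "0 < \<epsilon>" "0 < h"
  shows "0 < relax \<alpha> \<epsilon> h" "relax \<alpha> \<epsilon> h < 1"
proof -
  have *: "0 < h / (x + h)" "h / (x + h) < 1" if "0 < x" for x using that assms by auto
  have "0 < \<epsilon> powr \<alpha>" using assms by simp
  from *[OF this] show "0 < relax \<alpha> \<epsilon> h" "relax \<alpha> \<epsilon> h < 1" unfolding relax_def .
qed

text \<open>
  In the mode \<open>0\<close> the density update is plain integration, as \<open>0 powr \<alpha> = 0\<close>, and the update of \<open>f\<close> a convex
  combination of profiles with the same mass.
\<close>
lemma scheme_mass_conservation:
  fixes M :: "real ^ 'd \<Rightarrow> real"
  assumes M: "integrable lborel M" "bracket M = 1" and g: "integrable lborel (g0 0)"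
  shows "scheme_rho \<alpha> m M e \<epsilon> h g0 n 0 = bracket (g0 0)"
proof -
  have tr: "transport \<alpha> \<epsilon> h (0 :: real ^ 'd) v = 1" for v by (simp add: transport_def)
  have M1: "(\<integral>v. complex_of_real (M v) \<partial>lborel) = 1" using M by (simp add: bracket_def integral_complex_of_real)
  have \<rho>: "rho_step \<alpha> m M e \<epsilon> h 0 u = bracket u" for u
    using M(2) by (simp add: rho_step_def Let_def tr bracket_def)
  have "integrable lborel (scheme_f \<alpha> m M e \<epsilon> h g0 n 0) \<and> bracket (scheme_f \<alpha> m M e \<epsilon> h g0 n 0) = bracket (g0 0)" for n
  proof (induction n)
    case 0
    have "scheme_f \<alpha> m M e \<epsilon> h g0 0 0 = g0 0" by (simp add: fun_eq_iff)
    then show ?case using g by simp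
  next
    case (Suc n)
    let ?u = "scheme_f \<alpha> m M e \<epsilon> h g0 n 0"
    let ?l = "complex_of_real (relax \<alpha> \<epsilon> h)"
    have eq: "scheme_f \<alpha> m M e \<epsilon> h g0 (Suc n) 0 = (\<lambda>v. (1 - ?l) * ?u v + (?l * bracket (g0 0)) * complex_of_real (M v))"
      using Suc by (simp add: fun_eq_iff f_step_def Let_def tr \<rho>)
    have iM: "integrable lborel (\<lambda>v. complex_of_real (M v))" using M by simp
    have "integrable lborel (scheme_f \<alpha> m M e \<epsilon> h g0 (Suc n) 0)"
      unfolding eq using Suc iM by (intro Bochner_Integration.integrable_add integrable_mult_right) auto
    moreover have "bracket (scheme_f \<alpha> m M e \<epsilon> h g0 (Suc n) 0) = (1 - ?l) * bracket ?u + (?l * bracket (g0 0)) * 1"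
      unfolding eq bracket_def M1[symmetric] using Suc iM
      by (simp only: Bochner_Integration.integral_add integrable_mult_right integral_mult_right_zero)
    ultimately show ?case using Suc by (simp add: algebra_simps)
  qed
  then show ?thesis by (cases n) (auto simp: \<rho>)
qed

lemma powr_tendsto_0:
  fixes s :: "'b \<Rightarrow> real"
  assumes "0 < \<alpha>" "(s \<longlongrightarrow> 0) \<F>" "\<forall>\<^sub>F x in \<F>. 0 \<le> s x"
  shows "((\<lambda>x. s x powr \<alpha>) \<longlongrightarrow> 0) \<F>"
  using tendsto_powr'[OF assms(2) tendsto_const, of \<alpha>] assms by simp

text \<open>
  The induction carries the limit of \<open>\<langle>f\<^sup>n / (1 + i \<lambda> \<epsilon> k \<bullet> v)\<rangle>\<close>, the numerator of the next density, and a bound of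
  \<open>f\<^sup>n\<close> in \<open>L\<^sup>1\<close>, needed to discard the memory term.
\<close>
lemma scheme_diffusion_limit:
  fixes M :: "real ^ 'd \<Rightarrow> real" and e k :: "real ^ 'd"
  assumes alpha: "0 < \<alpha>" "\<alpha> < 2" and unit: "norm e = 1" and m: "0 \<le> m"
    and M: "integrable lborel M" "bracket M = 1" "\<And>v. 0 \<le> M v" and h: "0 < h" and g: "integrable lborel (g0 k)"
  shows "((\<lambda>\<epsilon>. scheme_rho \<alpha> m M e \<epsilon> h g0 n k) \<longlongrightarrow>
     bracket (g0 k) / complex_of_real (1 + h * (diffusion_coeff (\<alpha> + real CARD('d)) m e * norm k powr \<alpha>)) ^ n) (at_right 0)"
proof -
  define \<kappa> where "\<kappa> = diffusion_coeff (\<alpha> + real CARD('d)) m e"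
  have \<kappa>0: "0 \<le> \<kappa>"
    unfolding \<kappa>_def diffusion_coeff_def bracket_def using m by (intro integral_nonneg_AE) auto
  define d where "d = 1 + h * (\<kappa> * norm k powr \<alpha>)"
  have d: "0 < d" using h \<kappa>0 by (simp add: d_def add_pos_nonneg)
  define L where "L = (\<lambda>n. bracket (g0 k) / complex_of_real d ^ n)"
  define l where "l = (\<lambda>\<epsilon>. relax \<alpha> \<epsilon> h)"
  define w where "w = (\<lambda>\<epsilon> v. 1 + \<i> * complex_of_real (\<epsilon> * l \<epsilon> * (k \<bullet> v)))"
  have tr: "transport \<alpha> \<epsilon> h k v = w \<epsilon> v" for \<epsilon> v by (simp add: transport_def w_def l_def mult_ac)
  have pos: "\<forall>\<^sub>F \<epsilon>::real in at_right 0. 0 < \<epsilon>" by (rule eventually_at_right_less)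
  have id: "((\<lambda>\<epsilon>::real. \<epsilon>) \<longlongrightarrow> 0) (at_right 0)" by (rule tendsto_ident_at)
  have \<epsilon>\<alpha>: "((\<lambda>\<epsilon>. \<epsilon> powr \<alpha>) \<longlongrightarrow> 0) (at_right 0)"
    by (rule powr_tendsto_0[OF alpha(1) id]) (use pos in \<open>auto elim: eventually_mono\<close>)
  have l: "(l \<longlongrightarrow> 1) (at_right 0)"
  proof -
    have "((\<lambda>\<epsilon>. h / (\<epsilon> powr \<alpha> + h)) \<longlongrightarrow> h / (0 + h)) (at_right 0)"
      by (intro tendsto_intros \<epsilon>\<alpha>) (use h in auto)
    then show ?thesis using h by (simp add: l_def relax_def)
  qed
  have \<theta>: "((\<lambda>\<epsilon>. \<epsilon> * l \<epsilon>) \<longlongrightarrow> 0) (at_right 0)"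
    using tendsto_mult[OF id l] by simp
  have res: "((\<lambda>\<epsilon>. \<integral>v. u v / w \<epsilon> v ^ j \<partial>lborel) \<longlongrightarrow> (\<integral>v. u v \<partial>lborel)) (at_right 0)"
    if "integrable lborel u" for u :: "real ^ 'd \<Rightarrow> complex" and j
    unfolding w_def by (rule resolvent_integral_tendsto[OF that _ \<theta>]) simp
  have iM: "integrable lborel (\<lambda>v. complex_of_real (M v))" using M by simp
  have M1: "(\<integral>v. complex_of_real (M v) \<partial>lborel) = 1" using M by (simp add: bracket_def integral_complex_of_real)
  have w1: "1 \<le> norm (w \<epsilon> v)" for \<epsilon> v unfolding w_def by (rule norm_one_plus_i_ge_1)
  have wint: "integrable lborel (\<lambda>v. u v / w \<epsilon> v ^ j)" if "integrable lborel u" for u :: "real ^ 'd \<Rightarrow> complex" and \<epsilon> j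
  proof -
    have "norm (1 / w \<epsilon> v ^ j) \<le> 1" for v
      using one_le_power[OF w1, of \<epsilon> v j] by (simp add: norm_divide norm_power divide_le_eq_1)
    then have "integrable lborel (\<lambda>v. u v * (1 / w \<epsilon> v ^ j))"
      by (intro integrable_mult_bounded that) (auto simp: w_def)
    then show ?thesis by simp
  qed
  define q where "q = (\<lambda>\<epsilon>. (\<epsilon> * l \<epsilon> * norm k) powr \<alpha> / (1 - l \<epsilon>) * tail_bracket \<alpha> m e (\<epsilon> * l \<epsilon> * norm k))"
  have q: "(q \<longlongrightarrow> h * (\<kappa> * norm k powr \<alpha>)) (at_right 0)"
  proof (cases "k = 0")
    case True
    then show ?thesis by (simp add: q_def)
  next
    case False
    have lpos: "0 < l \<epsilon>" "l \<epsilon> < 1" if "0 < \<epsilon>" for \<epsilon> using relax_bounds[OF that h] by (simp_all add: l_def)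
    have "((\<lambda>\<epsilon>. \<epsilon> * l \<epsilon> * norm k) \<longlongrightarrow> 0 * norm k) (at_right 0)" by (intro tendsto_intros \<theta>)
    moreover have "\<forall>\<^sub>F \<epsilon> in at_right 0. 0 < \<epsilon> * l \<epsilon> * norm k"
      using pos by eventually_elim (use lpos False in auto)
    ultimately have "filterlim (\<lambda>\<epsilon>. \<epsilon> * l \<epsilon> * norm k) (at_right 0) (at_right 0)"
      by (auto simp: filterlim_at elim: eventually_mono)
    from filterlim_compose[OF tail_bracket_tendsto[OF alpha unit m] this]
    have TB: "((\<lambda>\<epsilon>. tail_bracket \<alpha> m e (\<epsilon> * l \<epsilon> * norm k)) \<longlongrightarrow> \<kappa>) (at_right 0)" by (simp add: \<kappa>_def)
    have "((\<lambda>\<epsilon>. l \<epsilon> powr \<alpha> * norm k powr \<alpha> * (\<epsilon> powr \<alpha> + h)) \<longlongrightarrow> 1 powr \<alpha> * norm k powr \<alpha> * (0 + h)) (at_right 0)"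
      by (intro tendsto_intros l \<epsilon>\<alpha>) auto
    then have "((\<lambda>\<epsilon>. (\<epsilon> * l \<epsilon> * norm k) powr \<alpha> / (1 - l \<epsilon>)) \<longlongrightarrow> 1 powr \<alpha> * norm k powr \<alpha> * (0 + h)) (at_right 0)"
    proof (rule Lim_transform_eventually)
      show "\<forall>\<^sub>F \<epsilon> in at_right 0. l \<epsilon> powr \<alpha> * norm k powr \<alpha> * (\<epsilon> powr \<alpha> + h) = (\<epsilon> * l \<epsilon> * norm k) powr \<alpha> / (1 - l \<epsilon>)"
        using pos
      proof eventually_elim
        case (elim \<epsilon>)
        have p: "0 < \<epsilon> powr \<alpha>" using elim by simp
        have "1 - h / (x + h) = x / (x + h)" if "0 < x" for x using that h by (simp add: field_simps)
        from this[OF p] have "1 - l \<epsilon> = \<epsilon> powr \<alpha> / (\<epsilon> powr \<alpha> + h)" by (simp add: l_def relax_def)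
        moreover have "(\<epsilon> * l \<epsilon> * norm k) powr \<alpha> = \<epsilon> powr \<alpha> * (l \<epsilon> powr \<alpha> * norm k powr \<alpha>)"
          using elim lpos[OF elim] by (simp add: powr_mult)
        ultimately show ?case using p h by simp
      qed
    qed
    from tendsto_mult[OF this TB] show ?thesis by (simp add: q_def mult_ac)
  qed
  have den: "((\<lambda>\<epsilon>. (\<integral>v. complex_of_real (M v) / w \<epsilon> v \<partial>lborel) + complex_of_real (q \<epsilon>)) \<longlongrightarrow> complex_of_real d) (at_right 0)"
    using tendsto_add[OF res[OF iM, of 1] tendsto_of_real[OF q]] using M(2) by (simp add: bracket_def d_def)
  define f where "f = (\<lambda>\<epsilon> n. scheme_f \<alpha> m M e \<epsilon> h g0 n k)"
  define \<rho> where "\<rho> = (\<lambda>\<epsilon> n. rho_step \<alpha> m M e \<epsilon> h k (f \<epsilon> n))"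
  have \<rho>: "\<rho> \<epsilon> n = (\<integral>v. f \<epsilon> n v / w \<epsilon> v \<partial>lborel) / ((\<integral>v. complex_of_real (M v) / w \<epsilon> v \<partial>lborel) + complex_of_real (q \<epsilon>))" for \<epsilon> n
    by (simp add: \<rho>_def rho_step_def Let_def tr bracket_def q_def l_def mult_ac)
  have \<rho>_lim: "((\<lambda>\<epsilon>. \<rho> \<epsilon> n) \<longlongrightarrow> L (Suc n)) (at_right 0)"
    if "((\<lambda>\<epsilon>. \<integral>v. f \<epsilon> n v / w \<epsilon> v \<partial>lborel) \<longlongrightarrow> L n) (at_right 0)" for n
    using tendsto_divide[OF that den] d unfolding \<rho> L_def by (simp add: field_simps)
  have fS: "f \<epsilon> (Suc n) v = (complex_of_real (1 - l \<epsilon>) * f \<epsilon> n v + complex_of_real (l \<epsilon>) * \<rho> \<epsilon> n * complex_of_real (M v)) / w \<epsilon> v" for \<epsilon> n v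
    by (simp add: f_def \<rho>_def f_step_def Let_def tr l_def)
  have "((\<lambda>\<epsilon>. \<integral>v. f \<epsilon> n v / w \<epsilon> v \<partial>lborel) \<longlongrightarrow> L n) (at_right 0) \<and>
     (\<exists>C. \<forall>\<^sub>F \<epsilon> in at_right 0. integrable lborel (f \<epsilon> n) \<and> (\<integral>v. norm (f \<epsilon> n v) \<partial>lborel) \<le> C)" for n
  proof (induction n)
    case 0
    have "f \<epsilon> 0 = g0 k" for \<epsilon> by (simp add: f_def fun_eq_iff)
    then show ?case using res[OF g, of 1] g by (auto simp: L_def bracket_def intro!: exI[of _ "\<integral>v. norm (g0 k v) \<partial>lborel"])
  next
    case (Suc n)
    then obtain C where C: "\<forall>\<^sub>F \<epsilon> in at_right 0. integrable lborel (f \<epsilon> n) \<and> (\<integral>v. norm (f \<epsilon> n v) \<partial>lborel) \<le> C"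
      by blast
    note lim = \<rho>_lim[OF conjunct1[OF Suc]]
    have \<rho>b: "\<forall>\<^sub>F \<epsilon> in at_right 0. norm (\<rho> \<epsilon> n) < norm (L (Suc n)) + 1"
      using tendsto_norm[OF lim] by (rule order_tendstoD) simp
    \<comment> \<open>The next numerator divides \<open>f\<^sup>n\<close> and \<open>M\<close> twice by \<open>1 + i \<lambda> \<epsilon> k \<bullet> v\<close>: once in the step, once in the bracket.\<close>
    have "((\<lambda>\<epsilon>. complex_of_real (1 - l \<epsilon>) * (\<integral>v. f \<epsilon> n v / w \<epsilon> v ^ 2 \<partial>lborel)) \<longlongrightarrow> 0) (at_right 0)"
    proof (rule Lim_null_comparison)
      show "\<forall>\<^sub>F \<epsilon> in at_right 0. norm (complex_of_real (1 - l \<epsilon>) * (\<integral>v. f \<epsilon> n v / w \<epsilon> v ^ 2 \<partial>lborel)) \<le> \<bar>1 - l \<epsilon>\<bar> * C"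
        using C
      proof eventually_elim
        case (elim \<epsilon>)
        have "norm (\<integral>v. f \<epsilon> n v / w \<epsilon> v ^ 2 \<partial>lborel) \<le> (\<integral>v. norm (f \<epsilon> n v / w \<epsilon> v ^ 2) \<partial>lborel)"
          by (rule integral_norm_bound)
        also have "\<dots> \<le> (\<integral>v. norm (f \<epsilon> n v) \<partial>lborel)"
        proof (intro integral_mono integrable_norm wint)
          fix v
          have "1 \<le> norm (w \<epsilon> v) ^ 2" using w1 by (rule one_le_power)
          then show "norm (f \<epsilon> n v / w \<epsilon> v ^ 2) \<le> norm (f \<epsilon> n v)"
            by (simp add: norm_divide norm_power divide_le_eq mult_le_cancel_left1)
        qed (use elim in auto)
        also have "\<dots> \<le> C" using elim by simp
        finally show ?case unfolding norm_mult norm_of_real by (intro mult_left_mono) auto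
      qed
      have "((\<lambda>\<epsilon>. \<bar>1 - l \<epsilon>\<bar> * C) \<longlongrightarrow> \<bar>1 - 1\<bar> * C) (at_right 0)" by (intro tendsto_intros l)
      then show "((\<lambda>\<epsilon>. \<bar>1 - l \<epsilon>\<bar> * C) \<longlongrightarrow> 0) (at_right 0)" by simp
    qed
    moreover have "((\<lambda>\<epsilon>. complex_of_real (l \<epsilon>) * \<rho> \<epsilon> n * (\<integral>v. complex_of_real (M v) / w \<epsilon> v ^ 2 \<partial>lborel)) \<longlongrightarrow>
        complex_of_real 1 * L (Suc n) * 1) (at_right 0)"
      using res[OF iM, of 2] unfolding M1 by (intro tendsto_intros l lim)
    ultimately have "((\<lambda>\<epsilon>. complex_of_real (1 - l \<epsilon>) * (\<integral>v. f \<epsilon> n v / w \<epsilon> v ^ 2 \<partial>lborel)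
        + complex_of_real (l \<epsilon>) * \<rho> \<epsilon> n * (\<integral>v. complex_of_real (M v) / w \<epsilon> v ^ 2 \<partial>lborel)) \<longlongrightarrow> 0 + complex_of_real 1 * L (Suc n) * 1) (at_right 0)"
      by (rule tendsto_add)
    then have "((\<lambda>\<epsilon>. \<integral>v. f \<epsilon> (Suc n) v / w \<epsilon> v \<partial>lborel) \<longlongrightarrow> 0 + complex_of_real 1 * L (Suc n) * 1) (at_right 0)"
    proof (rule Lim_transform_eventually)
      show "\<forall>\<^sub>F \<epsilon> in at_right 0. complex_of_real (1 - l \<epsilon>) * (\<integral>v. f \<epsilon> n v / w \<epsilon> v ^ 2 \<partial>lborel)
        + complex_of_real (l \<epsilon>) * \<rho> \<epsilon> n * (\<integral>v. complex_of_real (M v) / w \<epsilon> v ^ 2 \<partial>lborel) = (\<integral>v. f \<epsilon> (Suc n) v / w \<epsilon> v \<partial>lborel)"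
        using C
      proof eventually_elim
        case (elim \<epsilon>)
        have "(\<integral>v. f \<epsilon> (Suc n) v / w \<epsilon> v \<partial>lborel) = (\<integral>v. complex_of_real (1 - l \<epsilon>) * (f \<epsilon> n v / w \<epsilon> v ^ 2)
           + (complex_of_real (l \<epsilon>) * \<rho> \<epsilon> n) * (complex_of_real (M v) / w \<epsilon> v ^ 2) \<partial>lborel)"
          unfolding fS by (intro Bochner_Integration.integral_cong refl) (simp add: power2_eq_square add_divide_distrib)
        also have "\<dots> = complex_of_real (1 - l \<epsilon>) * (\<integral>v. f \<epsilon> n v / w \<epsilon> v ^ 2 \<partial>lborel)
        + complex_of_real (l \<epsilon>) * \<rho> \<epsilon> n * (\<integral>v. complex_of_real (M v) / w \<epsilon> v ^ 2 \<partial>lborel)"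
          using wint[OF iM, of \<epsilon> 2] wint[of "f \<epsilon> n" \<epsilon> 2] elim
          by (simp only: Bochner_Integration.integral_add integrable_mult_right integral_mult_right_zero)
        finally show ?case ..
      qed
    qed
    moreover have "\<forall>\<^sub>F \<epsilon> in at_right 0. integrable lborel (f \<epsilon> (Suc n)) \<and> (\<integral>v. norm (f \<epsilon> (Suc n) v) \<partial>lborel) \<le> C + (norm (L (Suc n)) + 1)"
      using C \<rho>b pos
    proof eventually_elim
      case (elim \<epsilon>)
      have lb: "0 < l \<epsilon>" "l \<epsilon> < 1" using relax_bounds[OF elim(3) h] by (simp_all add: l_def)
      have "f \<epsilon> (Suc n) = (\<lambda>v. (complex_of_real (1 - l \<epsilon>) * f \<epsilon> n v + complex_of_real (l \<epsilon>) * \<rho> \<epsilon> n * complex_of_real (M v)) / w \<epsilon> v ^ 1)"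
        by (simp add: fun_eq_iff fS)
      moreover have "integrable lborel (\<lambda>v. (complex_of_real (1 - l \<epsilon>) * f \<epsilon> n v + complex_of_real (l \<epsilon>) * \<rho> \<epsilon> n * complex_of_real (M v)) / w \<epsilon> v ^ 1)"
        using elim iM by (intro wint Bochner_Integration.integrable_add integrable_mult_right) auto
      ultimately have int: "integrable lborel (f \<epsilon> (Suc n))" by (simp only:)
      have "(\<integral>v. norm (f \<epsilon> (Suc n) v) \<partial>lborel) \<le> (\<integral>v. norm (f \<epsilon> n v) + norm (\<rho> \<epsilon> n) * M v \<partial>lborel)"
      proof (intro integral_mono integrable_norm int Bochner_Integration.integrable_add integrable_mult_right M(1))
        fix v
        have "norm (f \<epsilon> (Suc n) v) \<le> norm (complex_of_real (1 - l \<epsilon>) * f \<epsilon> n v + complex_of_real (l \<epsilon>) * \<rho> \<epsilon> n * complex_of_real (M v))"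
          unfolding fS w_def by (rule norm_divide_one_plus_i_le)
        also have "\<dots> \<le> norm (complex_of_real (1 - l \<epsilon>) * f \<epsilon> n v) + norm (complex_of_real (l \<epsilon>) * \<rho> \<epsilon> n * complex_of_real (M v))"
          by (rule norm_triangle_ineq)
        also have "\<dots> = (1 - l \<epsilon>) * norm (f \<epsilon> n v) + l \<epsilon> * (norm (\<rho> \<epsilon> n) * M v)"
          using lb M(3)[of v] by (simp only: norm_mult norm_of_real abs_of_pos abs_of_nonneg diff_gt_0_iff_gt mult.assoc)
        also have "\<dots> \<le> 1 * norm (f \<epsilon> n v) + 1 * (norm (\<rho> \<epsilon> n) * M v)"
          using lb M(3)[of v] by (intro add_mono mult_right_mono) auto
        finally show "norm (f \<epsilon> (Suc n) v) \<le> norm (f \<epsilon> n v) + norm (\<rho> \<epsilon> n) * M v" by simp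
      qed (use elim in auto)
      also have "\<dots> = (\<integral>v. norm (f \<epsilon> n v) \<partial>lborel) + norm (\<rho> \<epsilon> n) * 1"
      proof -
        have "(\<integral>v. M v \<partial>lborel) = 1" using M by (simp add: bracket_def)
        then show ?thesis using elim M(1) by (subst Bochner_Integration.integral_add) auto
      qed
      finally show ?case using int elim by simp
    qed
    ultimately show ?case by auto
  qed
  note main = this
  have "((\<lambda>\<epsilon>. scheme_rho \<alpha> m M e \<epsilon> h g0 n k) \<longlongrightarrow> L n) (at_right 0)"
  proof (cases n)
    case 0
    then show ?thesis by (simp add: L_def)
  next
    case (Suc j)
    have "((\<lambda>\<epsilon>. \<rho> \<epsilon> j) \<longlongrightarrow> L (Suc j)) (at_right 0)" using main[of j] by (intro \<rho>_lim) blast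
    then show ?thesis by (simp add: Suc \<rho>_def f_def)
  qed
  then show ?thesis by (simp add: L_def d_def \<kappa>_def)
qed

text \<open>
  Both bases lie in \<open>[0, 1]\<close>, so their \<open>n\<close>-th powers differ by at most \<open>n\<close> times their difference, which is
  between \<open>0\<close> and \<open>x\<^sup>2\<close>.
\<close>
lemma implicit_euler_exponential_error:
  fixes x :: real
  assumes x: "0 \<le> x"
  shows "\<bar>(1 / (1 + x)) ^ n - exp (- x) ^ n\<bar> \<le> real n * x\<^sup>2"
proof -
  have 1: "exp (- x) \<le> 1 / (1 + x)"
    using exp_ge_add_one_self[of x] x by (simp add: exp_minus inverse_eq_divide frac_le)
  have "1 / (1 + x) - exp (- x) \<le> 1 / (1 + x) - (1 - x)" using exp_ge_add_one_self[of "- x"] by simp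
  also have "\<dots> = x\<^sup>2 / (1 + x)" using x by (simp add: field_simps power2_eq_square)
  also have "\<dots> \<le> x\<^sup>2 / 1" using x by (intro divide_left_mono) auto
  finally have 2: "\<bar>1 / (1 + x) - exp (- x)\<bar> \<le> x\<^sup>2" using 1 by simp
  have "norm ((1 / (1 + x)) ^ n - exp (- x) ^ n) \<le> real n * norm (1 / (1 + x) - exp (- x))"
    using norm_power_diff[of "1 / (1 + x)" "exp (- x)" n] x by simp
  also have "\<dots> \<le> real n * x\<^sup>2" using 2 by (intro mult_left_mono) auto
  finally show ?thesis by simp
qed

lemma diffusion_solution_exponential:
  assumes sol: "diffusion_solution T c r0 r" and t: "t \<in> {0..T}"
  shows "r t = r0 * complex_of_real (exp (- c * t))"
proof -
  have r: "r 0 = r0" "\<And>t. t \<in> {0..T} \<Longrightarrow> (r has_vector_derivative - (c *\<^sub>R r t)) (at t within {0..T})"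
    using sol by (auto simp: diffusion_solution_def)
  have "((\<lambda>s. complex_of_real (exp (c * s)) * r s) has_vector_derivative 0) (at s within {0..T})" if s: "s \<in> {0..T}" for s
  proof -
    have "((\<lambda>s. exp (c * s)) has_real_derivative exp (c * s) * c) (at s within {0..T})"
      by (auto intro!: derivative_eq_intros)
    then have "((\<lambda>s. complex_of_real (exp (c * s))) has_vector_derivative complex_of_real (exp (c * s) * c)) (at s within {0..T})"
      by (rule has_vector_derivative_of_real)
    from has_vector_derivative_mult[OF this r(2)[OF s]] show ?thesis
      by (simp add: scaleR_conv_of_real algebra_simps)
  qed
  note der = this
  obtain K where K: "\<And>s. s \<in> {0..T} \<Longrightarrow> complex_of_real (exp (c * s)) * r s = K"
    by (rule has_vector_derivative_zero_constant[OF _ der]) auto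
  have "complex_of_real (exp (c * t)) * r t = complex_of_real (exp (c * 0)) * r 0"
    using K[OF t] K[of 0] t by simp
  then have "complex_of_real (exp (c * t)) * r t = r0" using r by simp
  then show ?thesis by (simp add: exp_minus field_simps)
qed

text \<open>
  With \<open>x = c T / N\<close> the error is at most \<open>|r0|\<close> times \<open>N x\<^sup>2 = (c T)\<^sup>2 / N\<close>, uniformly in \<open>n \<le> N\<close>.
\<close>
lemma implicit_euler_diffusion_convergence:
  fixes r0 :: complex
  assumes T: "0 < T" and c: "0 \<le> c" and sol: "diffusion_solution T c r0 r" and \<eta>: "0 < \<eta>"
  shows "\<exists>N0\<ge>1. \<forall>N\<ge>N0. \<forall>n\<le>N. norm (r0 / complex_of_real (1 + T / real N * c) ^ n - r (real n * (T / real N))) < \<eta>"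
proof -
  obtain N1 :: nat where N1: "norm r0 * (T * c)\<^sup>2 / \<eta> < real N1" using reals_Archimedean2 by blast
  show ?thesis
  proof (intro exI conjI allI impI)
    show "1 \<le> max 1 N1" by simp
    fix N n assume N: "max 1 N1 \<le> N" and n: "n \<le> N"
    define x where "x = T / real N * c"
    have x: "0 \<le> x" using T c by (simp add: x_def)
    have "real n * (T / real N) \<in> {0..T}" using T N n by (auto simp: field_simps)
    then have "r (real n * (T / real N)) = r0 * complex_of_real (exp (- c * (real n * (T / real N))))"
      by (rule diffusion_solution_exponential[OF sol])
    also have "exp (- c * (real n * (T / real N))) = exp (- x) ^ n"
      by (simp add: x_def exp_of_nat_mult[symmetric] mult_ac)
    finally have "r0 / complex_of_real (1 + x) ^ n - r (real n * (T / real N))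
       = r0 * complex_of_real ((1 / (1 + x)) ^ n - exp (- x) ^ n)"
      by (simp add: right_diff_distrib power_divide)
    then have "norm (r0 / complex_of_real (1 + x) ^ n - r (real n * (T / real N))) \<le> norm r0 * (real n * x\<^sup>2)"
      using implicit_euler_exponential_error[OF x, of n] by (simp only: norm_mult norm_of_real) (intro mult_left_mono, auto)
    also have "\<dots> \<le> norm r0 * (real N * x\<^sup>2)" using n by (intro mult_left_mono mult_right_mono) auto
    also have "real N * x\<^sup>2 = (T * c)\<^sup>2 / real N"
      using N by (simp add: x_def power2_eq_square)
    also have "norm r0 * ((T * c)\<^sup>2 / real N) < \<eta>"
    proof -
      have "norm r0 * (T * c)\<^sup>2 / \<eta> < real N" using N N1 by linarith
      then show ?thesis using \<eta> N by (simp add: field_simps)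
    qed
    finally show "norm (r0 / complex_of_real (1 + T / real N * c) ^ n - r (real n * (T / real N))) < \<eta>"
      by (simp add: x_def)
  qed
qed

section \<open>Consistency, convergence and order\<close>

lemma step_sequence: "0 < T \<Longrightarrow> filterlim (\<lambda>N. T / real N) (at_right 0) sequentially"
  by (auto simp: filterlim_at lim_const_over_n intro!: eventually_sequentiallyI[of 1])

text \<open>
  The three properties at fixed \<open>\<epsilon>\<close> follow by identifying the scheme with the abstract mode: \<open>q h\<close> is the
  tail term. Only the last one uses the size of \<open>1 - A - q\<close>; the others use that it tends to \<open>0\<close>.
\<close>
lemma kinetic_scheme_properties:
  fixes M :: "real ^ 'd \<Rightarrow> real" and a b e k :: "real ^ 'd" and f0 :: "real ^ 'd \<Rightarrow> real ^ 'd \<Rightarrow> real"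
  defines "f0hat \<equiv> (\<lambda>k v. fourier a b (\<lambda>x. f0 x v) k)"
  assumes alpha: "0 < \<alpha>" "\<alpha> < 2" and unit: "norm e = 1"
    and equilibrium: "anomalous_equilibrium (\<alpha> + real CARD('d)) m M"
    and ab: "\<forall>i. a $ i < b $ i" and k: "k \<in> frequencies a b" and pos: "0 < \<epsilon>" "0 < T"
    and sol: "kinetic_solution \<alpha> M \<epsilon> T a b f0 f"
  shows "consistent_step T (\<lambda>h. rho_step \<alpha> m M e \<epsilon> h k) (\<lambda>h. f_step \<alpha> m M e \<epsilon> h k)
            (\<lambda>t. fourier a b (\<lambda>x. bracket (f t x)) k) (\<lambda>t v. fourier a b (\<lambda>x. f t x v) k)" (is ?consistent)
    and "convergent_scheme T (\<lambda>h n. scheme_rho \<alpha> m M e \<epsilon> h f0hat n k) (\<lambda>h n. scheme_f \<alpha> m M e \<epsilon> h f0hat n k)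
            (\<lambda>t. fourier a b (\<lambda>x. bracket (f t x)) k) (\<lambda>t v. fourier a b (\<lambda>x. f t x v) k)" (is ?convergent)
    and "tail_rate \<alpha> (\<alpha> + real CARD('d)) m M \<Longrightarrow> time_regular T a b f \<Longrightarrow>
         first_order T (\<lambda>h n. scheme_rho \<alpha> m M e \<epsilon> h f0hat n k) (\<lambda>h n. scheme_f \<alpha> m M e \<epsilon> h f0hat n k)
            (\<lambda>t. fourier a b (\<lambda>x. bracket (f t x)) k) (\<lambda>t v. fourier a b (\<lambda>x. f t x v) k)" (is "?rate \<Longrightarrow> ?regular \<Longrightarrow> ?first_order")
proof -
  let ?F = "\<lambda>t v. fourier a b (\<lambda>x. f t x v) k" and ?r = "\<lambda>t. fourier a b (\<lambda>x. bracket (f t x)) k"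
  have m: "0 < m" and M: "integrable lborel M" "\<And>v. 0 < M v" "bracket M = 1" "\<And>v. M (- v) = M v"
    and tail: "M \<sim>[at_infinity] (\<lambda>v. m / norm v powr (\<alpha> + real CARD('d)))"
    using equilibrium by (auto simp: anomalous_equilibrium_def)
  have M1: "(\<integral>v. M v \<partial>lborel) = 1" using M(3) by (simp add: bracket_def)
  interpret K: relaxation_mode M "\<epsilon> powr \<alpha>" T "\<lambda>v. \<epsilon> * (k \<bullet> v)" ?F ?r
    by (rule kinetic_relaxation_mode[OF M(1-3) ab k pos sol])
  have l: "relax \<alpha> \<epsilon> h = K.l h" for h by (simp add: K.l_def relax_def)
  have tr: "transport \<alpha> \<epsilon> h k v = 1 + \<i> * complex_of_real (K.l h * (\<epsilon> * (k \<bullet> v)))" for h v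
    unfolding transport_eq l ..
  define s where "s = (\<lambda>h. \<epsilon> * K.l h * norm k)"
  define q where "q = (\<lambda>h. s h powr \<alpha> * tail_bracket \<alpha> m e (s h))"
  have \<rho>_step: "rho_step \<alpha> m M e \<epsilon> h k g = (\<integral>v. g v / (1 + \<i> * complex_of_real (K.l h * (\<epsilon> * (k \<bullet> v)))) \<partial>lborel)
      / (K.A h + complex_of_real (q h / (1 - K.l h)))" for h g
    unfolding rho_step_def Let_def tr l K.A_def bracket_def q_def s_def by (simp only: times_divide_eq_left)
  have f_step: "f_step \<alpha> m M e \<epsilon> h k g v = (complex_of_real (1 - K.l h) * g v
       + complex_of_real (K.l h) * (rho_step \<alpha> m M e \<epsilon> h k g * complex_of_real (M v)))
      / (1 + \<i> * complex_of_real (K.l h * (\<epsilon> * (k \<bullet> v))))" for h g v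
    unfolding f_step_def Let_def tr l by (simp only: mult.assoc times_divide_eq_left mult_1_left)
  have q0: "0 \<le> q h" for h using tail_bracket_nonneg[of m \<alpha> e "s h"] m by (simp add: q_def)
  have s0: "0 \<le> s h" if "0 < h" for h using K.l_bounds[OF that] pos by (simp add: s_def)
  have s_lim: "(s \<longlongrightarrow> 0) (at_right 0)"
  proof -
    have "(s \<longlongrightarrow> \<epsilon> * 0 * norm k) (at_right 0)" unfolding s_def by (intro tendsto_intros K.l_tendsto_0)
    then show ?thesis by simp
  qed
  have q_lim: "(q \<longlongrightarrow> 0) (at_right 0)"
  proof (cases "k = 0")
    case True
    then show ?thesis by (simp add: q_def s_def)
  next
    case False
    have sp: "\<forall>\<^sub>F h in at_right 0. 0 < s h"
      using eventually_at_right_less[of "0::real"] by eventually_elim (use K.l_bounds pos False in \<open>simp add: s_def\<close>)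
    then have "filterlim s (at_right 0) (at_right 0)"
      using s_lim by (auto simp: filterlim_at elim: eventually_mono)
    from filterlim_compose[OF tail_bracket_tendsto[OF alpha unit less_imp_le[OF m]] this]
    have TB: "((\<lambda>h. tail_bracket \<alpha> m e (s h)) \<longlongrightarrow> diffusion_coeff (\<alpha> + real CARD('d)) m e) (at_right 0)" .
    have "((\<lambda>h. s h powr \<alpha>) \<longlongrightarrow> 0) (at_right 0)"
      by (rule powr_tendsto_0[OF alpha(1) s_lim]) (use sp in \<open>auto elim: eventually_mono\<close>)
    from tendsto_mult[OF this TB] show ?thesis by (simp add: q_def)
  qed
  show ?consistent
    unfolding consistent_step_def f_step unfolding \<rho>_step
    using K.one_step_consistency[OF q_lim] by blast
  have F0: "f0hat k v = ?F 0 v" for v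
    using sol by (simp add: f0hat_def kinetic_solution_def)
  have "bracket (f0hat k) = ?r 0"
    using K.density[of 0] pos by (simp add: bracket_def F0)
  then obtain C where C: "0 \<le> C"
    "\<And>N n H. 1 \<le> N \<Longrightarrow> n \<le> N \<Longrightarrow>
       (\<And>j. j \<le> N \<Longrightarrow> (\<integral>v. norm (K.G (T / real N) j v - ?F (real j * (T / real N)) v) \<partial>lborel) \<le> H) \<Longrightarrow>
       norm (scheme_rho \<alpha> m M e \<epsilon> (T / real N) f0hat n k - ?r (real n * (T / real N)))
           \<le> C * (H + norm (1 - K.A (T / real N) - complex_of_real (q (T / real N)))) \<and>
       integrable lborel (\<lambda>v. scheme_f \<alpha> m M e \<epsilon> (T / real N) f0hat n k v - ?F (real n * (T / real N)) v) \<and>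
       bracket (\<lambda>v. norm (scheme_f \<alpha> m M e \<epsilon> (T / real N) f0hat n k v - ?F (real n * (T / real N)) v))
          \<le> C * (H + norm (1 - K.A (T / real N) - complex_of_real (q (T / real N))))"
    using K.scheme_error[of q "\<lambda>h n. scheme_f \<alpha> m M e \<epsilon> h f0hat n k" "\<lambda>h n. scheme_rho \<alpha> m M e \<epsilon> h f0hat n k"]
    unfolding bracket_def[of "\<lambda>v. norm (_ v)"] by (auto simp: q0 F0 \<rho>_step f_step)
  show ?convergent
    unfolding convergent_scheme_def
  proof (intro allI impI)
    fix \<eta> :: real assume \<eta>: "0 < \<eta>"
    obtain H where H: "H \<longlonglongrightarrow> 0"
      "\<And>N n. 1 \<le> N \<Longrightarrow> n \<le> N \<Longrightarrow> (\<integral>v. norm (K.G (T / real N) n v - ?F (real n * (T / real N)) v) \<partial>lborel) \<le> H N"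
      by (rule K.exact_density_error_tendsto_0) blast
    have "((\<lambda>h. 1 - K.A h - complex_of_real (q h)) \<longlongrightarrow> 1 - 1 - complex_of_real 0) (at_right 0)"
      by (intro tendsto_intros K.A_tendsto_1 q_lim)
    from tendsto_mult[OF tendsto_const tendsto_add[OF H(1) tendsto_norm[OF filterlim_compose[OF this step_sequence[OF pos(2)]]]]]
    have "(\<lambda>N. C * (H N + norm (1 - K.A (T / real N) - complex_of_real (q (T / real N))))) \<longlonglongrightarrow> C * (0 + norm (1 - 1 - complex_of_real 0))" .
    then have "\<forall>\<^sub>F N in sequentially. C * (H N + norm (1 - K.A (T / real N) - complex_of_real (q (T / real N)))) < \<eta>"
      using \<eta> by (intro order_tendstoD) auto
    then obtain N0 where N0: "\<And>N. N0 \<le> N \<Longrightarrow> C * (H N + norm (1 - K.A (T / real N) - complex_of_real (q (T / real N)))) < \<eta>"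
      by (auto simp: eventually_sequentially)
    show "\<exists>N0\<ge>1. \<forall>N\<ge>N0. \<forall>n\<le>N. let h = T / real N; t = real n * h in
        norm (scheme_rho \<alpha> m M e \<epsilon> h f0hat n k - ?r t) < \<eta> \<and>
        integrable lborel (\<lambda>v. scheme_f \<alpha> m M e \<epsilon> h f0hat n k v - ?F t v) \<and>
        bracket (\<lambda>v. norm (scheme_f \<alpha> m M e \<epsilon> h f0hat n k v - ?F t v)) < \<eta>"
    proof (intro exI[of _ "max 1 N0"] conjI allI impI)
      fix N n assume N: "max 1 N0 \<le> N" and n: "n \<le> N"
      then have N1: "1 \<le> N" "N0 \<le> N" by auto
      show "let h = T / real N; t = real n * h in
        norm (scheme_rho \<alpha> m M e \<epsilon> h f0hat n k - ?r t) < \<eta> \<and>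
        integrable lborel (\<lambda>v. scheme_f \<alpha> m M e \<epsilon> h f0hat n k v - ?F t v) \<and>
        bracket (\<lambda>v. norm (scheme_f \<alpha> m M e \<epsilon> h f0hat n k v - ?F t v)) < \<eta>"
        unfolding Let_def
        using C(2)[OF N1(1) n H(2)[OF N1(1)]] N0[OF N1(2)] by (auto intro: le_less_trans)
    qed simp
  qed
  assume rate: ?rate and reg: ?regular
  obtain \<Theta> where \<Theta>: "\<Theta> \<in> borel_measurable borel" "(\<integral>\<^sup>+v. \<Theta> v \<partial>lborel) < \<infinity>"
    "\<And>N v. 1 \<le> N \<Longrightarrow> ennreal (\<Sum>j<N. norm (K.truncation N j v)) \<le> ennreal (T / real N) * \<Theta> v"
    unfolding K.truncation_def K.D_def
    by (rule time_regular_truncation[OF M(2) ab k pos sol reg]) blast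
  obtain C1 where C1: "0 \<le> C1"
    "\<And>N n. 1 \<le> N \<Longrightarrow> n \<le> N \<Longrightarrow> (\<integral>v. norm (K.G (T / real N) n v - ?F (real n * (T / real N)) v) \<partial>lborel) \<le> C1 * (T / real N)"
    by (rule K.exact_density_error_linear[OF \<Theta>]) blast+
  obtain C0 where C0: "0 \<le> C0"
    "\<And>s e'. 0 < s \<Longrightarrow> norm e' = 1 \<Longrightarrow>
       \<bar>(\<integral>v. M v * ((s * (v \<bullet> e'))\<^sup>2 / (1 + (s * (v \<bullet> e'))\<^sup>2)) \<partial>lborel) - s powr \<alpha> * tail_bracket \<alpha> m e s\<bar> \<le> C0 * s"
    by (rule even_defect_linear[OF alpha unit M(1) tail_correction_bigo[OF alpha(1) rate tail]]) blast
  have \<delta>: "norm (1 - K.A h - complex_of_real (q h)) \<le> C0 * (\<epsilon> * norm k / \<epsilon> powr \<alpha>) * h" if h: "0 < h" for h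
  proof -
    have "norm (1 - K.A h - complex_of_real (q h)) \<le> C0 * s h"
    proof (cases "k = 0")
      case True
      have "K.A h = 1" unfolding K.A_def using True M1 by simp
      then have "1 - K.A h - complex_of_real (q h) = 0" using True by (simp add: q_def s_def)
      then show ?thesis using C0(1) s0[OF h] by simp
    next
      case False
      \<comment> \<open>The defect of \<open>M\<close> is taken in the direction of \<open>k\<close>, the tail bracket in the direction of \<open>e\<close>.\<close>
      define e' where "e' = k /\<^sub>R norm k"
      have e': "norm e' = 1" using False by (simp add: e'_def)
      have sp: "0 < s h" using K.l_bounds[OF h] pos False by (simp add: s_def)
      have x: "K.l h * (\<epsilon> * (k \<bullet> v)) = ((K.l h * \<epsilon>) *\<^sub>R k) \<bullet> v" "((K.l h * \<epsilon>) *\<^sub>R k) \<bullet> v = s h * (v \<bullet> e')" for v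
        using False by (simp_all add: s_def e'_def inner_commute)
      have "K.A h = complex_of_real (1 - (\<integral>v. M v * ((s h * (v \<bullet> e'))\<^sup>2 / (1 + (s h * (v \<bullet> e'))\<^sup>2)) \<partial>lborel))"
        unfolding K.A_def x(1) even_profile_transform[OF M(1) M(4)] M1 unfolding x(2) ..
      then have "1 - K.A h - complex_of_real (q h) = complex_of_real
        ((\<integral>v. M v * ((s h * (v \<bullet> e'))\<^sup>2 / (1 + (s h * (v \<bullet> e'))\<^sup>2)) \<partial>lborel) - s h powr \<alpha> * tail_bracket \<alpha> m e (s h))"
        by (simp add: q_def)
      then show ?thesis using C0(2)[OF sp e'] by (simp only: norm_of_real)
    qed
    also have "\<dots> \<le> C0 * (\<epsilon> * (h / \<epsilon> powr \<alpha>) * norm k)"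
    proof -
      have "K.l h \<le> h / \<epsilon> powr \<alpha>" 
        unfolding K.l_def using h K.c_pos by (intro divide_left_mono mult_pos_pos add_pos_pos) (simp_all only: le_add_same_cancel1 less_imp_le)
      then show ?thesis unfolding s_def using C0 pos by (intro mult_left_mono mult_right_mono) auto
    qed
    finally show ?thesis by (simp add: mult_ac)
  qed
  define B where "B = C * (C1 + C0 * (\<epsilon> * norm k / \<epsilon> powr \<alpha>))"
  show ?first_order
    unfolding first_order_def
  proof (intro exI[of _ B] allI impI)
    fix N n :: nat assume N: "1 \<le> N" and n: "n \<le> N"
    have h: "0 < T / real N" using N pos by simp
    have "C * (C1 * (T / real N) + norm (1 - K.A (T / real N) - complex_of_real (q (T / real N)))) \<le> B * (T / real N)"
      using mult_left_mono[OF add_left_mono[OF \<delta>[OF h]] C(1), of "C1 * (T / real N)"]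
      by (simp add: B_def algebra_simps)
    then show "let h = T / real N; t = real n * h in
        norm (scheme_rho \<alpha> m M e \<epsilon> h f0hat n k - ?r t) \<le> B * h \<and>
        integrable lborel (\<lambda>v. scheme_f \<alpha> m M e \<epsilon> h f0hat n k v - ?F t v) \<and>
        bracket (\<lambda>v. norm (scheme_f \<alpha> m M e \<epsilon> h f0hat n k v - ?F t v)) \<le> B * h"
      unfolding Let_def
      using C(2)[OF N n C1(2)[OF N]] by (auto intro: order_trans)
  qed
qed

theorem proposition3p2:
  fixes \<alpha> \<beta> m T :: real
    and M :: "real ^ 'd \<Rightarrow> real"
    and e a b :: "real ^ 'd"
    and f0 :: "real ^ 'd \<Rightarrow> real ^ 'd \<Rightarrow> real"
  defines "f0hat \<equiv> (\<lambda>k v. fourier a b (\<lambda>x. f0 x v) k)"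
    and "\<kappa> \<equiv> diffusion_coeff \<beta> m e"
  assumes dim: "CARD('d) \<in> {1, 2, 3}"
    and alpha: "0 < \<alpha>" "\<alpha> < 2"
    and beta: "\<beta> = \<alpha> + real CARD('d)"
    and equilibrium: "anomalous_equilibrium \<beta> m M"
    and unit: "norm e = 1"
    and domain: "\<forall>i. a $ i < b $ i"
    and f0_periodic: "\<forall>v. box_periodic a b (\<lambda>x. f0 x v)"
    and f0_integrable: "set_integrable lborel (cbox a b \<times> UNIV) (\<lambda>(x, v). f0 x v)"
    and final_time: "0 < T"
  shows
    "(tail_rate \<alpha> \<beta> m M \<longrightarrow>
       (\<forall>\<epsilon>>0. \<forall>f. kinetic_solution \<alpha> M \<epsilon> T a b f0 f \<and> time_regular T a b f \<longrightarrow>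
         (\<forall>k\<in>frequencies a b.
            first_order T
              (\<lambda>\<Delta>t n. scheme_rho \<alpha> m M e \<epsilon> \<Delta>t f0hat n k)
              (\<lambda>\<Delta>t n. scheme_f \<alpha> m M e \<epsilon> \<Delta>t f0hat n k)
              (\<lambda>t. fourier a b (\<lambda>x. bracket (f t x)) k)
              (\<lambda>t v. fourier a b (\<lambda>x. f t x v) k)))) \<and>
     (\<forall>\<epsilon>>0. \<forall>N\<ge>1. \<forall>n\<in>{1..N}.
       scheme_rho \<alpha> m M e \<epsilon> (T / real N) f0hat n 0 = bracket (f0hat 0)) \<and>
     (\<forall>\<epsilon>>0. \<forall>f. kinetic_solution \<alpha> M \<epsilon> T a b f0 f \<longrightarrow>
       (\<forall>k\<in>frequencies a b.
          consistent_step T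
            (\<lambda>h. rho_step \<alpha> m M e \<epsilon> h k)
            (\<lambda>h. f_step \<alpha> m M e \<epsilon> h k)
            (\<lambda>t. fourier a b (\<lambda>x. bracket (f t x)) k)
            (\<lambda>t v. fourier a b (\<lambda>x. f t x v) k) \<and>
          convergent_scheme T
            (\<lambda>\<Delta>t n. scheme_rho \<alpha> m M e \<epsilon> \<Delta>t f0hat n k)
            (\<lambda>\<Delta>t n. scheme_f \<alpha> m M e \<epsilon> \<Delta>t f0hat n k)
            (\<lambda>t. fourier a b (\<lambda>x. bracket (f t x)) k)
            (\<lambda>t v. fourier a b (\<lambda>x. f t x v) k))) \<and>
     (\<forall>k\<in>frequencies a b. \<exists>R :: nat \<Rightarrow> nat \<Rightarrow> complex.
       (\<forall>N\<ge>1. let \<Delta>t = T / real N in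
          R N 0 = bracket (f0hat k) \<and>
          (\<forall>n\<le>N. ((\<lambda>\<epsilon>. scheme_rho \<alpha> m M e \<epsilon> \<Delta>t f0hat n k) \<longlongrightarrow> R N n) (at_right 0)) \<and>
          (\<forall>n<N. (R N (Suc n) - R N n) / complex_of_real \<Delta>t =
                  - complex_of_real (\<kappa> * norm k powr \<alpha>) * R N (Suc n))) \<and>
       (\<forall>r. diffusion_solution T (\<kappa> * norm k powr \<alpha>) (bracket (f0hat k)) r \<longrightarrow>
          (\<forall>\<eta>>0. \<exists>N0\<ge>1. \<forall>N\<ge>N0. \<forall>n\<le>N.
             norm (R N n - r (real n * (T / real N))) < \<eta>)))"
proof -
  have m: "0 < m" and M: "integrable lborel M" "bracket M = 1" "\<And>v. 0 \<le> M v"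
    using equilibrium by (auto simp: anomalous_equilibrium_def less_imp_le)
  have f0hat: "integrable lborel (f0hat k)" for k
    using fourier_velocity_integrable(1)[OF f0_integrable] by (simp add: f0hat_def)
  have \<kappa>0: "0 \<le> \<kappa>"
    unfolding \<kappa>_def diffusion_coeff_def bracket_def using m by (intro integral_nonneg_AE) auto
  note properties = kinetic_scheme_properties[OF alpha unit equilibrium[unfolded beta] domain _ _ final_time,
      where ?f0.0 = f0, folded f0hat_def beta]
  have mass: "scheme_rho \<alpha> m M e \<epsilon> (T / real N) f0hat n 0 = bracket (f0hat 0)" for \<epsilon> N n
    by (intro scheme_mass_conservation M f0hat)
  have diffusion: "\<exists>R :: nat \<Rightarrow> nat \<Rightarrow> complex.
       (\<forall>N\<ge>1. let \<Delta>t = T / real N in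
          R N 0 = bracket (f0hat k) \<and>
          (\<forall>n\<le>N. ((\<lambda>\<epsilon>. scheme_rho \<alpha> m M e \<epsilon> \<Delta>t f0hat n k) \<longlongrightarrow> R N n) (at_right 0)) \<and>
          (\<forall>n<N. (R N (Suc n) - R N n) / complex_of_real \<Delta>t =
                  - complex_of_real (\<kappa> * norm k powr \<alpha>) * R N (Suc n))) \<and>
       (\<forall>r. diffusion_solution T (\<kappa> * norm k powr \<alpha>) (bracket (f0hat k)) r \<longrightarrow>
          (\<forall>\<eta>>0. \<exists>N0\<ge>1. \<forall>N\<ge>N0. \<forall>n\<le>N.
             norm (R N n - r (real n * (T / real N))) < \<eta>))" for k
  proof -
    define c where "c = \<kappa> * norm k powr \<alpha>"
    define R where "R = (\<lambda>N n. bracket (f0hat k) / complex_of_real (1 + T / real N * c) ^ n)"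
    have c: "0 \<le> c" using \<kappa>0 by (simp add: c_def)
    have "((\<lambda>\<epsilon>. scheme_rho \<alpha> m M e \<epsilon> (T / real N) f0hat n k) \<longlongrightarrow> R N n) (at_right 0)" if "1 \<le> N" for N n
      using scheme_diffusion_limit[OF alpha unit less_imp_le[OF m] M _ f0hat, where h = "T / real N" and k = k and n = n] that final_time
      unfolding R_def c_def \<kappa>_def beta by simp
    moreover have "(R N (Suc n) - R N n) / complex_of_real (T / real N) = - complex_of_real c * R N (Suc n)" if "1 \<le> N" for N n
    proof -
      define h where "h = T / real N"
      have h: "0 < h" using that final_time by (simp add: h_def)
      have d: "complex_of_real (1 + h * c) \<noteq> 0" 
      proof -
        have "0 < 1 + h * c" using h c by (simp add: add_pos_nonneg)
        then show ?thesis by (simp only: of_real_eq_0_iff)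
      qed
      have "R N n = complex_of_real (1 + h * c) * R N (Suc n)" unfolding R_def h_def[symmetric] using d by simp
      then have "R N (Suc n) - R N n = - complex_of_real c * R N (Suc n) * complex_of_real h" by (simp add: algebra_simps)
      then show ?thesis using h by (simp add: h_def[symmetric])
    qed
    moreover have "R N 0 = bracket (f0hat k)" for N by (simp add: R_def)
    ultimately show ?thesis
      using implicit_euler_diffusion_convergence[OF final_time c] unfolding c_def[symmetric] Let_def
      by (intro exI[of _ R]) (auto simp: R_def)
  qed
  show ?thesis
    using properties mass diffusion by blast
qed

end
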